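(* Let $\pi_R$ be the right regular action of the bialgebra $s14$ on $S14$ described in the context. For $N\ge0$ the span $W_N\subset S14$ of the basis monomials of degree $N$ is invariant, $\tilde A$ acts on it as $N$, and $\dim W_0=1$, $\dim W_N=2(N+1)$ for $N\ge1$. Moreover: (0) $W_0=\mathbb{C}1$ is the trivial representation ($\tilde A,\tilde B,\tilde D$ act by zero). (1) $W_1$ is the direct sum of two isomorphic two-dimensional irreducible representations with bases $(v^1_0,v^1_1)=(\tilde a+\tilde d,\tilde b+\tilde c)$ and $(v^2_0,v^2_1)=(\tilde b-\tilde c,\tilde a-\tilde d)$, on which $\tilde B:v^k_0\leftrightarrow v^k_1$ and $\tilde D:v^k_0\mapsto v^k_0,\ v^k_1\mapsto-v^k_1$; $\tilde B^2,\tilde D^2$ take the value $1$. (2) For $N\ge2$, $\tilde B$ acts by zero on $W_N$, and $W_N$ is the direct sum of two isomorphic representations of dimension $N+1$, one with basis $\tilde a^k\tilde d^\ell$ and the other with basis $\tilde b^k\tilde c^\ell$ ($k+\ell=N$). The representation with basis $\tilde a^k\tilde d^\ell$ is a direct sum of $N+1$ one-dimensional representations, as follows. (2a) If $N=2n$, $n\ge1$: one of them is spanned by $w_0=\sum_{k=0}^n\binom nk\tilde a^{2n-2k}\tilde d^{2k}$, on which $\tilde D$ acts by zero; the others are spanned by $u^\pm_\tau=u_0\pm\tau u_1$, $\tau=2,4,\dots,2n$, with $\pi_R(\tilde D)u^\pm_\tau=\pm\tau u^\pm_\tau$, where $u_0=\sum_{k=0}^n\alpha_k\tilde a^{2n-2k}\tilde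 d^{2k}$, $u_1=\sum_{k=0}^{n-1}\beta_k\tilde a^{2n-2k-1}\tilde d^{2k+1}$, $\alpha_0=\beta_0=1$, and the coefficients (depending on $\tau$) are fixed by $$\tau^2\beta_k=2(n-k)\alpha_k-2(k+1)\alpha_{k+1}\ (0\le k\le n-1),\qquad \alpha_k=(2k+1)\beta_k-(2n-2k+1)\beta_{k-1}\ (0\le k\le n),$$ with $\beta_{-1}=\beta_n=0$. (2b) If $N=2n+1$, $n\ge1$: they are spanned by $w^\pm_\tau=w_0\pm\tau w_1$, $\tau=1,3,\dots,2n+1$, with $\pi_R(\tilde D)w^\pm_\tau=\pm\tau w^\pm_\tau$, where $w_0=\sum_{k=0}^n\alpha'_k\tilde a^{2n-2k+1}\tilde d^{2k}$, $w_1=\sum_{k=0}^n\beta'_k\tilde a^{2n-2k}\tilde d^{2k+1}$, $\alpha'_0=\beta'_0=1$, and the coefficients are fixed by $$\tau^2\beta'_k=(2n-2k+1)\alpha'_k-2(k+1)\alpha'_{k+1},\qquad \alpha'_k=(2k+1)\beta'_k-2(n-k+1)\beta'_{k-1}\qquad(0\le k\le n),$$ with $\alpha'_{n+1}=\beta'_{-1}=0$.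
   Context: $S14$ is the unital associative $\mathbb{C}$-algebra generated by $\tilde a,\tilde b,\tilde c,\tilde d$ with relations $\tilde b\tilde c+\tilde c\tilde b=0$, $\tilde a\tilde d+\tilde d\tilde a=0$, $\tilde a\tilde b=\tilde b\tilde a=\tilde a\tilde c=\tilde c\tilde a=\tilde b\tilde d=\tilde d\tilde b=\tilde c\tilde d=\tilde d\tilde c=0$; it has basis $\tilde a^k\tilde d^\ell$, $\tilde b^k\tilde c^\ell$ ($k,\ell\ge0$, unit counted once). It is a bialgebra with $\delta\tilde a=\tilde a\otimes\tilde a+\tilde b\otimes\tilde b-\tilde c\otimes\tilde c+\tilde d\otimes\tilde d$, $\delta\tilde b=\tilde a\otimes\tilde b+\tilde b\otimes\tilde a-\tilde c\otimes\tilde d+\tilde d\otimes\tilde c$, $\delta\tilde c=\tilde a\otimes\tilde c+\tilde c\otimes\tilde a-\tilde b\otimes\tilde d+\tilde d\otimes\tilde b$, $\delta\tilde d=\tilde a\otimes\tilde d+\tilde d\otimes\tilde a-\tilde b\otimes\tilde c+\tilde c\otimes\tilde b$, $\varepsilon(\tilde a)=1$, $\varepsilon(\tilde b)=\varepsilon(\tilde c)=\varepsilon(\tilde d)=0$. $s14$ is the algebra generated by the following functionals on $S14$ (product $\langle uv,f\rangle=\langle u\otimes v,\delta(f)\rangle$, unit $\varepsilon$): $\langle\tilde A,\tilde a^k\tilde d^\ell\rangle=k\delta_{\ell0}$, $\langle\tilde A,\tilde b^k\tilde c^\ell\rangle=0$; $\langle\tilde B,\tilde a^k\tilde d^\ell\rangle=0$,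 $\langle\tilde B,\tilde b^k\tilde c^\ell\rangle=\delta_{k1}\delta_{\ell0}$; $\langle\tilde D,\tilde a^k\tilde d^\ell\rangle=\delta_{\ell1}$, $\langle\tilde D,\tilde b^k\tilde c^\ell\rangle=0$; $\tilde C=\tilde D\tilde B$; together with $E$ ($\langle E,1\rangle=1$, zero on other basis elements) and $K=(-1)^{\tilde A}$ ($\langle K,\tilde a^k\tilde d^\ell\rangle=(-1)^k\delta_{\ell0}$, $\langle K,\tilde b^k\tilde c^\ell\rangle=0$ for $k+\ell\ge1$); $E$ acts as $1$ on $1$ and as $0$ in degrees $\ge1$, and $K$ acts as $(-1)^N$ in degree $N$. The right regular action is $\pi_R(Z)f=f_{(1)}\langle Z,f_{(2)}\rangle$ with $\delta(f)=f_{(1)}\otimes f_{(2)}$ (Sweedler notation). The degree of $\tilde a^k\tilde d^\ell$ or $\tilde b^k\tilde c^\ell$ is $k+\ell$. Isomorphism of representations in (2) is as representations of the algebra generated by $\tilde A,\tilde B,\tilde D$. *)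

theory Defs
  imports Complex_Main "HOL-Library.Poly_Mapping"
begin

section \<open>Complex vector spaces and algebras\<close>

class complex_vector = ab_group_add +
  fixes scaleC :: "complex \<Rightarrow> 'a \<Rightarrow> 'a" (infixr "*\<^sub>C" 75)
  assumes scaleC_add_right: "c *\<^sub>C (x + y) = c *\<^sub>C x + c *\<^sub>C y"
    and scaleC_add_left: "(c + c') *\<^sub>C x = c *\<^sub>C x + c' *\<^sub>C x"
    and scaleC_scaleC: "c *\<^sub>C c' *\<^sub>C x = (c * c') *\<^sub>C x"
    and scaleC_one: "1 *\<^sub>C x = x"

class complex_algebra = complex_vector + ring + monoid_mult +
  assumes mult_scaleC_left: "(c *\<^sub>C x) * y = c *\<^sub>C (x * y)"
    and mult_scaleC_right: "x * (c *\<^sub>C y) = c *\<^sub>C (x * y)"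

global_interpretation cvs: vector_space "scaleC :: complex \<Rightarrow> 'a \<Rightarrow> 'a :: complex_vector"
  by unfold_locales
    (simp_all add: scaleC_add_right scaleC_add_left scaleC_scaleC scaleC_one)

instantiation complex :: complex_algebra
begin
definition scaleC_complex :: "complex \<Rightarrow> complex \<Rightarrow> complex" where
  "scaleC_complex c x = c * x"
instance by standard (simp_all add: scaleC_complex_def algebra_simps)
end

abbreviation clinear :: "('a::complex_vector \<Rightarrow> 'b::complex_vector) \<Rightarrow> bool" where
  "clinear \<equiv> Vector_Spaces.linear scaleC scaleC"

lemma clinearI:
  assumes "\<And>x y. f (x + y) = f x + f y" "\<And>c x. f (c *\<^sub>C x) = c *\<^sub>C f x"
  shows "clinear f"
  using assms by (simp add: Vector_Spaces.linear_iff cvs.vector_space_axioms)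

lemma clinear_add: "clinear f \<Longrightarrow> f (x + y) = f x + f y"
  and clinear_scale: "clinear f \<Longrightarrow> f (c *\<^sub>C x) = c *\<^sub>C f x"
  by (simp_all add: Vector_Spaces.linear_iff)

definition cbilinear ::
  "('a::complex_vector \<Rightarrow> 'b::complex_vector \<Rightarrow> 'c::complex_vector) \<Rightarrow> bool" where
  "cbilinear h \<longleftrightarrow> (\<forall>x. clinear (h x)) \<and> (\<forall>y. clinear (\<lambda>x. h x y))"

lemma cbilinearI:
  assumes "\<And>x x' y. h (x + x') y = h x y + h x' y"
    and "\<And>x y y'. h x (y + y') = h x y + h x y'"
    and "\<And>c x y. h (c *\<^sub>C x) y = c *\<^sub>C h x y"
    and "\<And>c x y. h x (c *\<^sub>C y) = c *\<^sub>C h x y"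
  shows "cbilinear h"
  using assms by (simp add: cbilinear_def clinearI)

lemma cbilinearD:
  assumes "cbilinear h"
  shows "h (x + x') y = h x y + h x' y" "h x (y + y') = h x y + h x y'"
    "h (c *\<^sub>C x) y = c *\<^sub>C h x y" "h x (c *\<^sub>C y) = c *\<^sub>C h x y"
  using assms clinear_add clinear_scale unfolding cbilinear_def by blast+


section \<open>Linear extension from a basis\<close>

abbreviation fscale :: "complex \<Rightarrow> ('k \<Rightarrow>\<^sub>0 complex) \<Rightarrow> ('k \<Rightarrow>\<^sub>0 complex)" where
  "fscale c \<equiv> Poly_Mapping.map ((*) c)"

definition lin_ext :: "('k \<Rightarrow> 'a::complex_vector) \<Rightarrow> ('k \<Rightarrow>\<^sub>0 complex) \<Rightarrow> 'a" where
  "lin_ext h p = (\<Sum>k\<in>Poly_Mapping.keys p. Poly_Mapping.lookup p k *\<^sub>C h k)"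

lemma lookup_fscale: "Poly_Mapping.lookup (fscale c p) k = c * Poly_Mapping.lookup p k"
  by transfer (simp add: when_def)

lemma lin_ext_superset:
  assumes "finite S" "Poly_Mapping.keys p \<subseteq> S"
  shows "lin_ext h p = (\<Sum>k\<in>S. Poly_Mapping.lookup p k *\<^sub>C h k)"
  unfolding lin_ext_def
  by (rule sum.mono_neutral_left) (use assms in \<open>auto simp: in_keys_iff\<close>)

lemma lin_ext_zero [simp]: "lin_ext h 0 = 0"
  by (simp add: lin_ext_def)

lemma lin_ext_add: "lin_ext h (p + q) = lin_ext h p + lin_ext h q"
proof -
  let ?S = "Poly_Mapping.keys p \<union> Poly_Mapping.keys q"
  have "Poly_Mapping.keys (p + q) \<subseteq> ?S" by (rule Poly_Mapping.keys_add)
  then show ?thesis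
    by (simp add: lin_ext_superset[of ?S] lookup_add scaleC_add_left sum.distrib)
qed

lemma lin_ext_single [simp]: "lin_ext h (Poly_Mapping.single k c) = c *\<^sub>C h k"
  by (simp add: lin_ext_def)

lemma lin_ext_fscale: "lin_ext h (fscale c p) = c *\<^sub>C lin_ext h p"
proof -
  have "Poly_Mapping.keys (fscale c p) \<subseteq> Poly_Mapping.keys p"
    by (auto simp: in_keys_iff lookup_fscale)
  then show ?thesis
    by (subst lin_ext_superset[of "Poly_Mapping.keys p"])
      (simp_all add: lookup_fscale lin_ext_def cvs.scale_sum_right scaleC_scaleC)
qed

lemma lin_ext_uminus: "lin_ext h (- p) = - lin_ext h p"
  using lin_ext_add[of h p "- p"] by (simp add: eq_neg_iff_add_eq_0 add.commute)

lemma lin_ext_diff: "lin_ext h (p - q) = lin_ext h p - lin_ext h q"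
  using lin_ext_add[of h p "- q"] by (simp add: lin_ext_uminus)

lemma lin_ext_fun_add: "lin_ext (\<lambda>k. h k + h' k) p = lin_ext h p + lin_ext h' p"
  by (simp add: lin_ext_def scaleC_add_right sum.distrib)

lemma lin_ext_fun_scale: "lin_ext (\<lambda>k. c *\<^sub>C h k) p = c *\<^sub>C lin_ext h p"
  by (simp add: lin_ext_def cvs.scale_sum_right scaleC_scaleC mult.commute)

lemma poly_mapping_add_induct:
  fixes p :: "'k \<Rightarrow>\<^sub>0 'b::comm_monoid_add"
  assumes "P 0" "\<And>k c. P (Poly_Mapping.single k c)" "\<And>p q. P p \<Longrightarrow> P q \<Longrightarrow> P (p + q)"
  shows "P p"
proof -
  have eq: "(\<Sum>k\<in>Poly_Mapping.keys p. Poly_Mapping.single k (Poly_Mapping.lookup p k)) = p"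
    by (rule poly_mapping_eqI) (auto simp: lookup_sum lookup_single when_def in_keys_iff)
  have "P (\<Sum>k\<in>S. Poly_Mapping.single k (Poly_Mapping.lookup p k))" if "finite S" for S
    using that by (induction S) (auto intro: assms)
  from this[of "Poly_Mapping.keys p"] show ?thesis by (simp add: eq)
qed


section \<open>Tensor products\<close>

text \<open>The tensor product is the free vector space on pairs modulo the span of the bilinearity
  relators.\<close>

inductive_set tensor_null ::
  "('a::complex_vector \<times> 'b::complex_vector \<Rightarrow>\<^sub>0 complex) set" where
  zero: "0 \<in> tensor_null"
| add: "p \<in> tensor_null \<Longrightarrow> q \<in> tensor_null \<Longrightarrow> p + q \<in> tensor_null"
| scale: "p \<in> tensor_null \<Longrightarrow> fscale c p \<in> tensor_null"
| add_left: "Poly_Mapping.single (x + x', y) 1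
    - Poly_Mapping.single (x, y) 1 - Poly_Mapping.single (x', y) 1 \<in> tensor_null"
| add_right: "Poly_Mapping.single (x, y + y') 1
    - Poly_Mapping.single (x, y) 1 - Poly_Mapping.single (x, y') 1 \<in> tensor_null"
| scale_left: "Poly_Mapping.single (c *\<^sub>C x, y) 1 - Poly_Mapping.single (x, y) c \<in> tensor_null"
| scale_right: "Poly_Mapping.single (x, c *\<^sub>C y) 1 - Poly_Mapping.single (x, y) c \<in> tensor_null"

lemma tensor_null_uminus: "p \<in> tensor_null \<Longrightarrow> - p \<in> tensor_null"
proof -
  have "fscale (-1) p = - p" by (rule poly_mapping_eqI) (simp add: lookup_fscale)
  then show "p \<in> tensor_null \<Longrightarrow> - p \<in> tensor_null" using tensor_null.scale[of p "-1"] by simp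
qed

lemma tensor_null_diff: "p \<in> tensor_null \<Longrightarrow> q \<in> tensor_null \<Longrightarrow> p - q \<in> tensor_null"
  using tensor_null.add[of p "- q"] tensor_null_uminus[of q] by simp

quotient_type (overloaded) ('a, 'b) tensor = "('a::complex_vector \<times> 'b::complex_vector) \<Rightarrow>\<^sub>0 complex" /
  "\<lambda>p q. p - q \<in> tensor_null"
proof (rule equivpI)
  show "reflp (\<lambda>p q :: ('a \<times> 'b) \<Rightarrow>\<^sub>0 complex. p - q \<in> tensor_null)"
    by (auto intro!: reflpI tensor_null.zero)
  show "symp (\<lambda>p q :: ('a \<times> 'b) \<Rightarrow>\<^sub>0 complex. p - q \<in> tensor_null)"
    by (auto intro!: sympI dest: tensor_null_uminus)
  show "transp (\<lambda>p q :: ('a \<times> 'b) \<Rightarrow>\<^sub>0 complex. p - q \<in> tensor_null)"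
    by (rule transpI) (use tensor_null.add in fastforce)
qed

instantiation tensor :: (complex_vector, complex_vector) complex_vector
begin
lift_definition zero_tensor :: "('a, 'b) tensor" is 0 .
lift_definition plus_tensor :: "('a, 'b) tensor \<Rightarrow> ('a, 'b) tensor \<Rightarrow> ('a, 'b) tensor" is "(+)"
  using tensor_null.add by (force simp: algebra_simps)
lift_definition uminus_tensor :: "('a, 'b) tensor \<Rightarrow> ('a, 'b) tensor" is uminus
  using tensor_null_uminus by force
lift_definition minus_tensor :: "('a, 'b) tensor \<Rightarrow> ('a, 'b) tensor \<Rightarrow> ('a, 'b) tensor" is "(-)"
  using tensor_null_diff by (force simp: algebra_simps)
lift_definition scaleC_tensor :: "complex \<Rightarrow> ('a, 'b) tensor \<Rightarrow> ('a, 'b) tensor" is fscale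
proof -
  fix c :: complex and p q :: "('a \<times> 'b) \<Rightarrow>\<^sub>0 complex"
  have "fscale c p - fscale c q = fscale c (p - q)"
    by (rule poly_mapping_eqI) (simp add: lookup_fscale lookup_minus algebra_simps)
  then show "p - q \<in> tensor_null \<Longrightarrow> fscale c p - fscale c q \<in> tensor_null"
    using tensor_null.scale by simp
qed
instance
proof
  fix t t' t'' :: "('a, 'b) tensor" and c c' :: complex
  have eq: "p = q \<Longrightarrow> p - q \<in> tensor_null" for p q :: "('a \<times> 'b) \<Rightarrow>\<^sub>0 complex"
    by (simp add: tensor_null.zero)
  show "t + t' + t'' = t + (t' + t'')" by transfer (simp add: tensor_null.zero add.assoc)
  show "t + t' = t' + t" by transfer (simp add: tensor_null.zero add.commute)
  show "0 + t = t" by transfer (simp add: tensor_null.zero)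
  show "- t + t = 0" by transfer (simp add: tensor_null.zero)
  show "t - t' = t + - t'" by transfer (simp add: tensor_null.zero)
  show "c *\<^sub>C (t + t') = c *\<^sub>C t + c *\<^sub>C t'"
    by transfer
      (rule eq, rule poly_mapping_eqI, simp add: lookup_fscale lookup_add algebra_simps)
  show "(c + c') *\<^sub>C t = c *\<^sub>C t + c' *\<^sub>C t"
    by transfer
      (rule eq, rule poly_mapping_eqI, simp add: lookup_fscale lookup_add algebra_simps)
  show "c *\<^sub>C c' *\<^sub>C t = (c * c') *\<^sub>C t"
    by transfer (rule eq, rule poly_mapping_eqI, simp add: lookup_fscale algebra_simps)
  show "1 *\<^sub>C t = t"
    by transfer (rule eq, rule poly_mapping_eqI, simp add: lookup_fscale)
qed
end

lift_definition tensor_pure ::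
  "'a::complex_vector \<Rightarrow> 'b::complex_vector \<Rightarrow> ('a, 'b) tensor" (infixr "\<otimes>\<^sub>C" 72)
  is "\<lambda>x y. Poly_Mapping.single (x, y) 1" .

text \<open>The linear map induced by \<open>h\<close>; meaningful for bilinear \<open>h\<close> only, where it does not depend
  on the chosen representative.\<close>

definition tensor_lift ::
  "('a::complex_vector \<Rightarrow> 'b::complex_vector \<Rightarrow> 'c::complex_vector) \<Rightarrow> ('a, 'b) tensor \<Rightarrow> 'c" where
  "tensor_lift h t = lin_ext (case_prod h) (rep_tensor t)"

lemma lin_ext_tensor_null:
  assumes "cbilinear h" "p \<in> tensor_null"
  shows "lin_ext (case_prod h) p = 0"
  using assms(2)
  by induction
    (simp_all add: lin_ext_add lin_ext_diff lin_ext_fscale scaleC_one cbilinearD[OF assms(1)])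

lemma tensor_lift_abs:
  assumes "cbilinear h"
  shows "tensor_lift h (abs_tensor p) = lin_ext (case_prod h) p"
proof -
  have "rep_tensor (abs_tensor p) - p \<in> tensor_null"
    using rep_abs_rsp_left[OF Quotient3_tensor, of p p] by (simp add: tensor_null.zero)
  from lin_ext_tensor_null[OF assms this] show ?thesis
    by (simp add: tensor_lift_def lin_ext_diff)
qed

lemma tensor_lift_pure: "cbilinear h \<Longrightarrow> tensor_lift h (x \<otimes>\<^sub>C y) = h x y"
  by (simp add: tensor_pure.abs_eq tensor_lift_abs scaleC_one)

lemma clinear_tensor_lift:
  assumes "cbilinear h"
  shows "clinear (tensor_lift h)"
proof (rule clinearI)
  fix t t' :: "('a, 'b) tensor" and c
  obtain p q where "t = abs_tensor p" "t' = abs_tensor q"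
    by (metis Quotient3_abs_rep[OF Quotient3_tensor])
  then show "tensor_lift h (t + t') = tensor_lift h t + tensor_lift h t'"
    and "tensor_lift h (c *\<^sub>C t) = c *\<^sub>C tensor_lift h t"
    by (simp_all add: plus_tensor.abs_eq scaleC_tensor.abs_eq tensor_lift_abs assms
        lin_ext_add lin_ext_fscale)
qed

lemma cbilinear_tensor_pure: "cbilinear (\<otimes>\<^sub>C)"
proof (rule cbilinearI)
  fix x x' :: 'a and y y' :: 'b and c
  show "(x + x') \<otimes>\<^sub>C y = x \<otimes>\<^sub>C y + x' \<otimes>\<^sub>C y"
    by transfer (use tensor_null.add_left in \<open>simp add: algebra_simps\<close>)
  show "x \<otimes>\<^sub>C (y + y') = x \<otimes>\<^sub>C y + x \<otimes>\<^sub>C y'"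
    by transfer (use tensor_null.add_right in \<open>simp add: algebra_simps\<close>)
  show "(c *\<^sub>C x) \<otimes>\<^sub>C y = c *\<^sub>C (x \<otimes>\<^sub>C y)"
    by transfer (use tensor_null.scale_left in simp)
  show "x \<otimes>\<^sub>C (c *\<^sub>C y) = c *\<^sub>C (x \<otimes>\<^sub>C y)"
    by transfer (use tensor_null.scale_right in simp)
qed

lemmas tensor_pure_bilinear = cbilinearD[OF cbilinear_tensor_pure]

lemma tensor_induct [case_names zero pure add]:
  assumes "P 0" "\<And>x y. P (x \<otimes>\<^sub>C y)" "\<And>t t'. P t \<Longrightarrow> P t' \<Longrightarrow> P (t + t')"
  shows "P t"
proof -
  have "P (abs_tensor p)" for p
  proof (induction p rule: poly_mapping_add_induct)
    case 1
    then show ?case using assms(1) by (simp add: zero_tensor.abs_eq)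
  next
    case (2 k c)
    obtain x y where k: "k = (x, y)" by (cases k)
    have "c *\<^sub>C (x \<otimes>\<^sub>C y) = abs_tensor (Poly_Mapping.single k c)"
      by (simp add: tensor_pure.abs_eq scaleC_tensor.abs_eq k)
    then show ?case using assms(2)[of "c *\<^sub>C x" y] by (simp add: tensor_pure_bilinear)
  next
    case (3 p q)
    then show ?case using assms(3) by (metis plus_tensor.abs_eq)
  qed
  then show ?thesis by (metis Quotient3_abs_rep[OF Quotient3_tensor])
qed

lemma tensor_lift_fun_add:
  "tensor_lift (\<lambda>x y. h x y + h' x y) t = tensor_lift h t + tensor_lift h' t"
  using lin_ext_fun_add[of "case_prod h" "case_prod h'"]
  by (simp add: tensor_lift_def case_prod_unfold)

lemma tensor_lift_fun_scale: "tensor_lift (\<lambda>x y. c *\<^sub>C h x y) t = c *\<^sub>C tensor_lift h t"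
  using lin_ext_fun_scale[of c "case_prod h"]
  by (simp add: tensor_lift_def case_prod_unfold)

lemma cbilinear_tensor_mult:
  fixes x :: "'a::complex_algebra" and y :: "'b::complex_algebra"
  shows "cbilinear (\<lambda>x' y'. (x * x') \<otimes>\<^sub>C (y * y'))"
  by (rule cbilinearI)
    (simp_all add: distrib_left mult_scaleC_right tensor_pure_bilinear)

lemma cbilinear_tensor_mult':
  fixes t' :: "('a::complex_algebra, 'b::complex_algebra) tensor"
  shows "cbilinear (\<lambda>x y. tensor_lift (\<lambda>x' y'. (x * x') \<otimes>\<^sub>C (y * y')) t')"
  by (rule cbilinearI)
    (simp_all add: distrib_right mult_scaleC_left tensor_pure_bilinear
      tensor_lift_fun_add tensor_lift_fun_scale)

lemma cbilinear_tensor_mult_right: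
  fixes x' :: "'a::complex_algebra" and y' :: "'b::complex_algebra"
  shows "cbilinear (\<lambda>x y. (x * x') \<otimes>\<^sub>C (y * y'))"
  by (rule cbilinearI)
    (simp_all add: distrib_right mult_scaleC_left tensor_pure_bilinear)

lemma tensor_pure_times_pure:
  fixes x x' :: "'a::complex_algebra" and y y' :: "'b::complex_algebra"
  shows "tensor_lift (\<lambda>x y. tensor_lift (\<lambda>x' y'. (x * x') \<otimes>\<^sub>C (y * y')) (x' \<otimes>\<^sub>C y'))
    (x \<otimes>\<^sub>C y) = (x * x') \<otimes>\<^sub>C (y * y')"
  by (simp add: tensor_lift_pure cbilinear_tensor_mult cbilinear_tensor_mult_right)

instantiation tensor :: (complex_algebra, complex_algebra) complex_algebra
begin
definition one_tensor :: "('a, 'b) tensor" where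
  "one_tensor = 1 \<otimes>\<^sub>C 1"
definition times_tensor :: "('a, 'b) tensor \<Rightarrow> ('a, 'b) tensor \<Rightarrow> ('a, 'b) tensor" where
  "times_tensor t t' = tensor_lift (\<lambda>x y. tensor_lift (\<lambda>x' y'. (x * x') \<otimes>\<^sub>C (y * y')) t') t"
instance
proof
  fix t t' t'' :: "('a, 'b) tensor" and c :: complex
  have pure: "(x \<otimes>\<^sub>C y) * (x' \<otimes>\<^sub>C y') = (x * x') \<otimes>\<^sub>C (y * y')" for x x' :: 'a and y y' :: 'b
    by (simp add: times_tensor_def tensor_pure_times_pure)
  have dr: "(t + t') * t'' = t * t'' + t' * t''" for t t' t'' :: "('a, 'b) tensor"
    by (simp add: times_tensor_def clinear_add[OF clinear_tensor_lift[OF cbilinear_tensor_mult']])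
  have dl: "t * (t' + t'') = t * t' + t * t''" for t t' t'' :: "('a, 'b) tensor"
    by (simp add: times_tensor_def clinear_add[OF clinear_tensor_lift[OF cbilinear_tensor_mult]]
        tensor_lift_fun_add)
  have sl: "(c *\<^sub>C t) * t' = c *\<^sub>C (t * t')" for c and t t' :: "('a, 'b) tensor"
    by (simp add: times_tensor_def clinear_scale[OF clinear_tensor_lift[OF cbilinear_tensor_mult']])
  have sr: "t * (c *\<^sub>C t') = c *\<^sub>C (t * t')" for c and t t' :: "('a, 'b) tensor"
    by (simp add: times_tensor_def clinear_scale[OF clinear_tensor_lift[OF cbilinear_tensor_mult]]
        tensor_lift_fun_scale)
  have zl: "0 * t = 0" for t :: "('a, 'b) tensor" using dr[of 0 0 t] by simp
  have zr: "t * 0 = 0" for t :: "('a, 'b) tensor" using dl[of t 0 0] by simp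
  show "(t + t') * t'' = t * t'' + t' * t''" by (rule dr)
  show "t * (t' + t'') = t * t' + t * t''" by (rule dl)
  show "(c *\<^sub>C t) * t' = c *\<^sub>C (t * t')" by (rule sl)
  show "t * (c *\<^sub>C t') = c *\<^sub>C (t * t')" by (rule sr)
  show "1 * t = t"
    by (induction t rule: tensor_induct) (simp_all add: one_tensor_def pure dl zr)
  show "t * 1 = t"
    by (induction t rule: tensor_induct) (simp_all add: one_tensor_def pure dr zl)
  have assoc1: "(x \<otimes>\<^sub>C y) * (x' \<otimes>\<^sub>C y') * t'' = (x \<otimes>\<^sub>C y) * ((x' \<otimes>\<^sub>C y') * t'')"
    for x x' :: 'a and y y' :: 'b
    by (induction t'' rule: tensor_induct) (simp_all add: pure dl zr mult.assoc)
  have assoc2: "(x \<otimes>\<^sub>C y) * t' * t'' = (x \<otimes>\<^sub>C y) * (t' * t'')" for x :: 'a and y :: 'b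
    by (induction t' rule: tensor_induct) (simp_all add: assoc1 dl dr zr zl)
  show "t * t' * t'' = t * (t' * t'')"
    by (induction t rule: tensor_induct) (simp_all add: assoc2 dr zl)
qed
end

lemma tensor_pure_mult:
  fixes x x' :: "'a::complex_algebra" and y y' :: "'b::complex_algebra"
  shows "(x \<otimes>\<^sub>C y) * (x' \<otimes>\<^sub>C y') = (x * x') \<otimes>\<^sub>C (y * y')"
  by (simp add: times_tensor_def tensor_pure_times_pure)


section \<open>Free algebras\<close>

text \<open>Words form a monoid under concatenation, so \<open>'g list \<Rightarrow>\<^sub>0 complex\<close> with the convolution
  product of \<open>HOL-Library.Poly_Mapping\<close> is the free unital associative algebra over \<open>'g\<close>.\<close>

instantiation list :: (type) monoid_add
begin
definition zero_list :: "'a list" where "zero_list = []"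
definition plus_list :: "'a list \<Rightarrow> 'a list \<Rightarrow> 'a list" where "plus_list = (@)"
instance by standard (simp_all add: zero_list_def plus_list_def)
end

definition free_gen :: "'g \<Rightarrow> ('g list \<Rightarrow>\<^sub>0 complex)" where
  "free_gen x = Poly_Mapping.single [x] 1"

definition free_eval :: "('g \<Rightarrow> 'a::complex_algebra) \<Rightarrow> ('g list \<Rightarrow>\<^sub>0 complex) \<Rightarrow> 'a" where
  "free_eval \<phi> = lin_ext (\<lambda>w. prod_list (map \<phi> w))"

lemma free_eval_gen [simp]: "free_eval \<phi> (free_gen x) = \<phi> x"
  by (simp add: free_eval_def free_gen_def scaleC_one)

lemma free_eval_one [simp]: "free_eval \<phi> 1 = 1"
  by (simp add: free_eval_def zero_list_def scaleC_one flip: single_one)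

lemma free_eval_add: "free_eval \<phi> (p + q) = free_eval \<phi> p + free_eval \<phi> q"
  and free_eval_diff: "free_eval \<phi> (p - q) = free_eval \<phi> p - free_eval \<phi> q"
  and free_eval_zero [simp]: "free_eval \<phi> 0 = 0"
  and free_eval_fscale: "free_eval \<phi> (fscale c p) = c *\<^sub>C free_eval \<phi> p"
  by (simp_all add: free_eval_def lin_ext_add lin_ext_diff lin_ext_fscale)

lemma free_eval_mult: "free_eval \<phi> (p * q) = free_eval \<phi> p * free_eval \<phi> q"
proof (induction p rule: poly_mapping_add_induct)
  case (2 k c)
  show ?case
    by (induction q rule: poly_mapping_add_induct)
      (simp_all add: distrib_left free_eval_add, simp add: free_eval_def mult_single plus_list_def
        mult_scaleC_left mult_scaleC_right scaleC_scaleC)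
qed (simp_all add: distrib_right free_eval_add)

inductive_set two_sided_ideal :: "'r::ring_1 set \<Rightarrow> 'r set" for R where
  zero: "0 \<in> two_sided_ideal R"
| gen: "r \<in> R \<Longrightarrow> p * r * q \<in> two_sided_ideal R"
| add: "x \<in> two_sided_ideal R \<Longrightarrow> y \<in> two_sided_ideal R \<Longrightarrow> x + y \<in> two_sided_ideal R"

lemma two_sided_ideal_mult_left: "x \<in> two_sided_ideal R \<Longrightarrow> p * x \<in> two_sided_ideal R"
  by (induction rule: two_sided_ideal.induct)
    (auto simp: distrib_left mult.assoc[symmetric] intro: two_sided_ideal.intros)

lemma two_sided_ideal_mult_right: "x \<in> two_sided_ideal R \<Longrightarrow> x * p \<in> two_sided_ideal R"
proof (induction rule: two_sided_ideal.induct)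
  case (gen r q q')
  then show ?case using two_sided_ideal.gen[of r R q "q' * p"] by (simp add: mult.assoc)
qed (auto simp: distrib_right intro: two_sided_ideal.intros)

lemma two_sided_ideal_uminus: "x \<in> two_sided_ideal R \<Longrightarrow> - x \<in> two_sided_ideal R"
  using two_sided_ideal_mult_left[of x R "- 1"] by simp

lemma two_sided_ideal_diff:
  "x \<in> two_sided_ideal R \<Longrightarrow> y \<in> two_sided_ideal R \<Longrightarrow> x - y \<in> two_sided_ideal R"
  using two_sided_ideal.add[of x R "- y"] two_sided_ideal_uminus[of y R] by simp

lemma free_eval_two_sided_ideal:
  assumes "p \<in> two_sided_ideal R" "\<And>r. r \<in> R \<Longrightarrow> free_eval \<phi> r = 0"
  shows "free_eval \<phi> p = 0"
  using assms(1) by induction (simp_all add: free_eval_add free_eval_mult assms(2))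


section \<open>The bialgebra $S14$\<close>

datatype S14_gen = Ga | Gb | Gc | Gd

definition S14_relators :: "(S14_gen list \<Rightarrow>\<^sub>0 complex) set" where
  "S14_relators = (let a = free_gen Ga; b = free_gen Gb; c = free_gen Gc; d = free_gen Gd in
    {b * c + c * b, a * d + d * a,
     a * b, b * a, a * c, c * a, b * d, d * b, c * d, d * c})"

quotient_type S14 = "S14_gen list \<Rightarrow>\<^sub>0 complex" / "\<lambda>p q. p - q \<in> two_sided_ideal S14_relators"
proof (rule equivpI)
  show "reflp (\<lambda>p q. p - q \<in> two_sided_ideal S14_relators)"
    by (auto intro!: reflpI two_sided_ideal.zero)
  show "symp (\<lambda>p q. p - q \<in> two_sided_ideal S14_relators)"
    by (auto intro!: sympI dest: two_sided_ideal_uminus)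
  show "transp (\<lambda>p q. p - q \<in> two_sided_ideal S14_relators)"
    by (rule transpI) (use two_sided_ideal.add in fastforce)
qed

instantiation S14 :: complex_algebra
begin
lift_definition zero_S14 :: S14 is 0 .
lift_definition one_S14 :: S14 is 1 .
lift_definition plus_S14 :: "S14 \<Rightarrow> S14 \<Rightarrow> S14" is "(+)"
  using two_sided_ideal.add by (force simp: algebra_simps)
lift_definition uminus_S14 :: "S14 \<Rightarrow> S14" is uminus
  using two_sided_ideal_uminus by force
lift_definition minus_S14 :: "S14 \<Rightarrow> S14 \<Rightarrow> S14" is "(-)"
  using two_sided_ideal_diff by (force simp: algebra_simps)
lift_definition times_S14 :: "S14 \<Rightarrow> S14 \<Rightarrow> S14" is "(*)"
proof -
  fix p p' q q' :: "S14_gen list \<Rightarrow>\<^sub>0 complex"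
  assume "p - p' \<in> two_sided_ideal S14_relators" "q - q' \<in> two_sided_ideal S14_relators"
  then have "(p - p') * q + p' * (q - q') \<in> two_sided_ideal S14_relators"
    by (intro two_sided_ideal.add two_sided_ideal_mult_left two_sided_ideal_mult_right)
  then show "p * q - p' * q' \<in> two_sided_ideal S14_relators" by (simp add: algebra_simps)
qed
lift_definition scaleC_S14 :: "complex \<Rightarrow> S14 \<Rightarrow> S14" is fscale
proof -
  fix c :: complex and p q :: "S14_gen list \<Rightarrow>\<^sub>0 complex"
  have "fscale c p - fscale c q = Poly_Mapping.single 0 c * (p - q)"
    by (simp add: mult_map_scale_conv_mult algebra_simps)
  then show "p - q \<in> two_sided_ideal S14_relators \<Longrightarrow>
      fscale c p - fscale c q \<in> two_sided_ideal S14_relators"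
    by (simp add: two_sided_ideal_mult_left)
qed
instance
proof
  fix x y z :: S14 and c c' :: complex
  have eq: "p = q \<Longrightarrow> p - q \<in> two_sided_ideal S14_relators" for p q
    by (simp add: two_sided_ideal.zero)
  have comm: "p * Poly_Mapping.single 0 c = Poly_Mapping.single 0 c * p"
    for p :: "S14_gen list \<Rightarrow>\<^sub>0 complex" and c
    by (induction p rule: poly_mapping_add_induct)
      (simp_all add: distrib_left distrib_right mult_single mult.commute)
  show "x + y + z = x + (y + z)" by transfer (simp add: two_sided_ideal.zero add.assoc)
  show "x + y = y + x" by transfer (simp add: two_sided_ideal.zero add.commute)
  show "0 + x = x" by transfer (simp add: two_sided_ideal.zero)
  show "- x + x = 0" by transfer (simp add: two_sided_ideal.zero)
  show "x - y = x + - y" by transfer (simp add: two_sided_ideal.zero)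
  show "x * y * z = x * (y * z)" by transfer (simp add: two_sided_ideal.zero mult.assoc)
  show "(x + y) * z = x * z + y * z" by transfer (simp add: two_sided_ideal.zero distrib_right)
  show "x * (y + z) = x * y + x * z" by transfer (simp add: two_sided_ideal.zero distrib_left)
  show "1 * x = x" by transfer (simp add: two_sided_ideal.zero)
  show "x * 1 = x" by transfer (simp add: two_sided_ideal.zero)
  show "c *\<^sub>C (x + y) = c *\<^sub>C x + c *\<^sub>C y"
    by transfer (rule eq, simp add: mult_map_scale_conv_mult distrib_left)
  show "(c + c') *\<^sub>C x = c *\<^sub>C x + c' *\<^sub>C x"
    by transfer (rule eq, simp add: mult_map_scale_conv_mult single_add distrib_right)
  show "c *\<^sub>C c' *\<^sub>C x = (c * c') *\<^sub>C x"
    by transfer (rule eq, simp add: mult_map_scale_conv_mult mult_single flip: mult.assoc)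
  show "1 *\<^sub>C x = x"
    by transfer (rule eq, simp add: mult_map_scale_conv_mult)
  show "(c *\<^sub>C x) * y = c *\<^sub>C (x * y)"
    by transfer (rule eq, simp add: mult_map_scale_conv_mult mult.assoc)
  show "x * (c *\<^sub>C y) = c *\<^sub>C (x * y)"
    by transfer (rule eq, simp add: mult_map_scale_conv_mult comm flip: mult.assoc)
qed
end

lift_definition S14_of :: "S14_gen \<Rightarrow> S14" is free_gen .

abbreviation Sa :: S14 where "Sa \<equiv> S14_of Ga"
abbreviation Sb :: S14 where "Sb \<equiv> S14_of Gb"
abbreviation Sc :: S14 where "Sc \<equiv> S14_of Gc"
abbreviation Sd :: S14 where "Sd \<equiv> S14_of Gd"

lemma S14_relators_mem: "r \<in> S14_relators \<Longrightarrow> r \<in> two_sided_ideal S14_relators"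
  using two_sided_ideal.gen[of r S14_relators 1 1] by simp

lemma S14_relations:
  "Sb * Sc + Sc * Sb = 0" "Sa * Sd + Sd * Sa = 0"
  "Sa * Sb = 0" "Sb * Sa = 0" "Sa * Sc = 0" "Sc * Sa = 0"
  "Sb * Sd = 0" "Sd * Sb = 0" "Sc * Sd = 0" "Sd * Sc = 0"
  by (transfer; simp; rule S14_relators_mem; simp add: S14_relators_def Let_def)+

primrec delta_gen :: "S14_gen \<Rightarrow> (S14, S14) tensor" where
  "delta_gen Ga = Sa \<otimes>\<^sub>C Sa + Sb \<otimes>\<^sub>C Sb - Sc \<otimes>\<^sub>C Sc + Sd \<otimes>\<^sub>C Sd"
| "delta_gen Gb = Sa \<otimes>\<^sub>C Sb + Sb \<otimes>\<^sub>C Sa - Sc \<otimes>\<^sub>C Sd + Sd \<otimes>\<^sub>C Sc"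
| "delta_gen Gc = Sa \<otimes>\<^sub>C Sc + Sc \<otimes>\<^sub>C Sa - Sb \<otimes>\<^sub>C Sd + Sd \<otimes>\<^sub>C Sb"
| "delta_gen Gd = Sa \<otimes>\<^sub>C Sd + Sd \<otimes>\<^sub>C Sa - Sb \<otimes>\<^sub>C Sc + Sc \<otimes>\<^sub>C Sb"

primrec counit_gen :: "S14_gen \<Rightarrow> complex" where
  "counit_gen Ga = 1"
| "counit_gen Gb = 0"
| "counit_gen Gc = 0"
| "counit_gen Gd = 0"

lemma tensor_zero_left [simp]: "0 \<otimes>\<^sub>C y = 0" and tensor_zero_right [simp]: "x \<otimes>\<^sub>C 0 = 0"
  using tensor_pure_bilinear(1)[of 0 0 y] tensor_pure_bilinear(2)[of x 0 0] by simp_all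

lemma tensor_minus_left: "(- x) \<otimes>\<^sub>C y = - (x \<otimes>\<^sub>C y)"
  and tensor_minus_right: "x \<otimes>\<^sub>C (- y) = - (x \<otimes>\<^sub>C y)"
  using tensor_pure_bilinear(1)[of x "- x" y] tensor_pure_bilinear(2)[of x y "- y"]
  by (simp_all add: eq_neg_iff_add_eq_0 add.commute)

lemma delta_gen_relators: "r \<in> S14_relators \<Longrightarrow> free_eval delta_gen r = 0"
proof -
  have "Sc * Sb = - (Sb * Sc)" "Sd * Sa = - (Sa * Sd)"
    using S14_relations(1,2) by (simp_all add: eq_neg_iff_add_eq_0 add.commute)
  then show "r \<in> S14_relators \<Longrightarrow> free_eval delta_gen r = 0"
    unfolding S14_relators_def Let_def
    by (auto simp: free_eval_add free_eval_mult tensor_pure_mult S14_relations(3-)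
        algebra_simps tensor_minus_left tensor_minus_right)
qed

text \<open>The coproduct and the counit are the algebra homomorphisms with the given values on the
  generators.\<close>

lift_definition delta :: "S14 \<Rightarrow> (S14, S14) tensor" is "free_eval delta_gen"
  using free_eval_two_sided_ideal[OF _ delta_gen_relators] by (fastforce simp: free_eval_diff)

lift_definition counit :: "S14 \<Rightarrow> complex" is "free_eval counit_gen"
proof -
  have "r \<in> S14_relators \<Longrightarrow> free_eval counit_gen r = 0" for r
    by (auto simp: S14_relators_def Let_def free_eval_add free_eval_mult)
  from free_eval_two_sided_ideal[OF _ this]
  show "p - q \<in> two_sided_ideal S14_relators \<Longrightarrow> free_eval counit_gen p = free_eval counit_gen q"
    for p q by (fastforce simp: free_eval_diff)
qed

lemma delta_hom:
  "delta (x + y) = delta x + delta y" "delta (x * y) = delta x * delta y"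
  "delta 1 = 1" "delta (c *\<^sub>C x) = c *\<^sub>C delta x" "delta (S14_of g) = delta_gen g"
  by (transfer; simp add: free_eval_add free_eval_mult free_eval_fscale)+

lemma counit_hom:
  "counit (x + y) = counit x + counit y" "counit (x * y) = counit x * counit y"
  "counit 1 = 1" "counit (c *\<^sub>C x) = c * counit x" "counit (S14_of g) = counit_gen g"
  by (transfer; simp add: free_eval_add free_eval_mult free_eval_fscale scaleC_complex_def)+


section \<open>Functionals given on the monomial basis\<close>

lemma S14_of_prod: "prod_list (map S14_of w) = abs_S14 (Poly_Mapping.single w 1)"
proof (induction w)
  case Nil
  then show ?case by (simp add: one_S14.abs_eq zero_list_def flip: single_one)
next
  case (Cons x w)
  then show ?case
    by (simp add: S14_of.abs_eq times_S14.abs_eq free_gen_def mult_single plus_list_def)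
qed

lemma clinear_S14_eqI:
  assumes "clinear u" "clinear v"
    and "\<And>w. u (prod_list (map S14_of w)) = v (prod_list (map S14_of w))"
  shows "u = v"
proof
  fix x
  have "u (abs_S14 p) = v (abs_S14 p)" for p
  proof (induction p rule: poly_mapping_add_induct)
    case 1
    then show ?case
      using clinear_scale[OF assms(1), of 0 0] clinear_scale[OF assms(2), of 0 0]
      by (simp flip: zero_S14.abs_eq)
  next
    case (2 w c)
    have "abs_S14 (Poly_Mapping.single w c) = c *\<^sub>C prod_list (map S14_of w)"
      by (simp add: S14_of_prod scaleC_S14.abs_eq)
    then show ?case by (simp add: clinear_scale[OF assms(1)] clinear_scale[OF assms(2)] assms(3))
  next
    case (3 p q)
    then show ?case
      by (simp add: clinear_add[OF assms(1)] clinear_add[OF assms(2)] flip: plus_S14.abs_eq)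
  qed
  then show "u x = v x" by (metis Quotient3_abs_rep[OF Quotient3_S14])
qed

lemma S14_swap:
  "Sc * Sb = (-1) *\<^sub>C (Sb * Sc)" "Sd * Sa = (-1) *\<^sub>C (Sa * Sd)"
  using S14_relations(1,2) by (simp_all add: eq_neg_iff_add_eq_0 add.commute)

lemma S14_swap_power:
  "Sd * Sa ^ k = (-1) ^ k *\<^sub>C (Sa ^ k * Sd)" "Sc * Sb ^ k = (-1) ^ k *\<^sub>C (Sb ^ k * Sc)"
proof (induction k)
  case (Suc k)
  have "Sd * Sa ^ Suc k = (Sd * Sa) * Sa ^ k" by (simp add: mult.assoc)
  also have "\<dots> = (-1) *\<^sub>C (Sa * (Sd * Sa ^ k))"
    by (simp only: S14_swap mult_scaleC_left mult.assoc)
  also have "\<dots> = (-1) ^ Suc k *\<^sub>C (Sa ^ Suc k * Sd)"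
    by (simp only: Suc mult_scaleC_right scaleC_scaleC power_Suc mult.assoc)
  finally show "Sd * Sa ^ Suc k = (-1) ^ Suc k *\<^sub>C (Sa ^ Suc k * Sd)" .
  have "Sc * Sb ^ Suc k = (Sc * Sb) * Sb ^ k" by (simp add: mult.assoc)
  also have "\<dots> = (-1) *\<^sub>C (Sb * (Sc * Sb ^ k))"
    by (simp only: S14_swap mult_scaleC_left mult.assoc)
  also have "\<dots> = (-1) ^ Suc k *\<^sub>C (Sb ^ Suc k * Sc)"
    by (simp only: Suc mult_scaleC_right scaleC_scaleC power_Suc mult.assoc)
  finally show "Sc * Sb ^ Suc k = (-1) ^ Suc k *\<^sub>C (Sb ^ Suc k * Sc)" .
qed (simp_all add: scaleC_one)

lemma S14_word_cases:
  "\<exists>c k l. prod_list (map S14_of w) = c *\<^sub>C (Sa ^ k * Sd ^ l) \<or>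
    prod_list (map S14_of w) = c *\<^sub>C (Sb ^ k * Sc ^ l)" (is "?P (prod_list (map S14_of w))")
proof (induction w)
  case Nil
  have "1 = 1 *\<^sub>C (Sa ^ 0 * Sd ^ 0)" by (simp add: scaleC_one)
  then show ?case by (simp only: list.map prod_list.Nil) blast
next
  case (Cons x w)
  have ad: "?P (c *\<^sub>C (Sa ^ k * Sd ^ l))" and bc: "?P (c *\<^sub>C (Sb ^ k * Sc ^ l))" for c k l
    by blast+
  have zero: "?P 0" using ad[of 0] by simp
  have swap_ad: "Sd * (Sa ^ k * Sd ^ l) = (-1) ^ k *\<^sub>C (Sa ^ k * Sd ^ Suc l)" for k l
    by(simp add: S14_swap_power mult_scaleC_left flip: mult.assoc)
  have swap_bc: "Sc * (Sb ^ k * Sc ^ l) = (-1) ^ k *\<^sub>C (Sb ^ k * Sc ^ Suc l)" for k l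
    by(simp add: S14_swap_power mult_scaleC_left flip: mult.assoc)
  have a_ad: "Sa * (Sa ^ k * Sd ^ l) = Sa ^ Suc k * Sd ^ l" for k l by (simp add: mult.assoc)
  have b_bc: "Sb * (Sb ^ k * Sc ^ l) = Sb ^ Suc k * Sc ^ l" for k l by (simp add: mult.assoc)
  have kill_ad: "y * (Sa ^ k * Sd ^ l) = (if k = 0 \<and> l = 0 then y else 0)"
    if "y * Sa = 0" "y * Sd = 0" for y k l
    using that by (cases k; cases l) (simp_all flip: mult.assoc)
  have kill_bc: "y * (Sb ^ k * Sc ^ l) = (if k = 0 \<and> l = 0 then y else 0)"
    if "y * Sb = 0" "y * Sc = 0" for y k l
    using that by (cases k; cases l) (simp_all flip: mult.assoc)
  have gens: "?P (c *\<^sub>C S14_of x)" for c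
    using ad[of c 1 0] ad[of c 0 1] bc[of c 1 0] bc[of c 0 1] by (cases x) simp_all
  have 1: "?P (S14_of x * (c *\<^sub>C (Sa ^ k * Sd ^ l)))" for c k l
    using ad zero gens
    by (cases x) (auto simp only: mult_scaleC_right swap_ad a_ad kill_ad S14_relations
        scaleC_scaleC cvs.scale_zero_right split: if_split)
  have 2: "?P (S14_of x * (c *\<^sub>C (Sb ^ k * Sc ^ l)))" for c k l
    using bc zero gens
    by (cases x) (auto simp only: mult_scaleC_right swap_bc b_bc kill_bc S14_relations
        scaleC_scaleC cvs.scale_zero_right split: if_split)
  from Cons obtain c k l where "prod_list (map S14_of w) = c *\<^sub>C (Sa ^ k * Sd ^ l) \<or>
      prod_list (map S14_of w) = c *\<^sub>C (Sb ^ k * Sc ^ l)" by blast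
  then show ?case
    by (simp only: list.map prod_list.Cons) (metis 1 2)
qed

primrec inversions :: "'g \<Rightarrow> 'g \<Rightarrow> 'g list \<Rightarrow> nat" where
  "inversions x y [] = 0"
| "inversions x y (z # w) = (if z = y then count_list w x else 0) + inversions x y w"

lemma inversions_append:
  "inversions x y (v @ w) = inversions x y v + inversions x y w + count_list v y * count_list w x"
  by (induction v) simp_all

lemma inversions_replicate: "x \<noteq> y \<Longrightarrow> inversions x y (replicate k z) = 0"
  by (induction k) (auto simp: count_list_0_iff)

definition word_value ::
  "(nat \<Rightarrow> nat \<Rightarrow> complex) \<Rightarrow> (nat \<Rightarrow> nat \<Rightarrow> complex) \<Rightarrow> S14_gen list \<Rightarrow> complex" where
  "word_value f g w =
    (if set w \<subseteq> {Ga, Gd} then (-1) ^ inversions Ga Gd w * f (count_list w Ga) (count_list w Gd)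
     else if set w \<subseteq> {Gb, Gc} then (-1) ^ inversions Gb Gc w * g (count_list w Gb) (count_list w Gc)
     else 0)"

lemma word_value_ideal:
  assumes "p \<in> two_sided_ideal S14_relators"
  shows "lin_ext (word_value f g) p = 0"
  using assms
proof induction
  case (gen r p q)
  have key: "lin_ext (word_value f g) (Poly_Mapping.single v c * r * Poly_Mapping.single w c') = 0"
    for v w c c'
    using gen unfolding S14_relators_def Let_def
    by (auto simp: free_gen_def distrib_left distrib_right mult_single plus_list_def lin_ext_add
        word_value_def inversions_append power_add scaleC_complex_def)
  have "lin_ext (word_value f g) (Poly_Mapping.single v c * r * q) = 0" for v c
    by (induction q rule: poly_mapping_add_induct) (simp_all add: distrib_left lin_ext_add key)
  then show ?case
    by (induction p rule: poly_mapping_add_induct) (simp_all add: distrib_right lin_ext_add)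
qed (simp_all add: lin_ext_add)

text \<open>The linear functional with the value \<open>f k l\<close> on $a^k d^l$ and \<open>g k l\<close> on $b^k c^l$. The two
  families of monomials share the unit, so \<open>f\<close> and \<open>g\<close> must agree at \<open>0 0\<close>.\<close>

definition basis_functional ::
  "(nat \<Rightarrow> nat \<Rightarrow> complex) \<Rightarrow> (nat \<Rightarrow> nat \<Rightarrow> complex) \<Rightarrow> S14 \<Rightarrow> complex" where
  "basis_functional f g = (THE u. clinear u \<and>
    (\<forall>k l. u (Sa ^ k * Sd ^ l) = f k l) \<and> (\<forall>k l. u (Sb ^ k * Sc ^ l) = g k l))"

lemma basis_functional_ex1:
  fixes f g :: "nat \<Rightarrow> nat \<Rightarrow> complex"
  assumes "f 0 0 = g 0 0"
  shows "\<exists>!u. clinear u \<and>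
    (\<forall>k l. u (Sa ^ k * Sd ^ l) = f k l) \<and> (\<forall>k l. u (Sb ^ k * Sc ^ l) = g k l)"
proof (rule ex_ex1I)
  define u where "u x = lin_ext (word_value f g) (rep_S14 x)" for x
  have u_abs: "u (abs_S14 p) = lin_ext (word_value f g) p" for p
  proof -
    have "rep_S14 (abs_S14 p) - p \<in> two_sided_ideal S14_relators"
      using rep_abs_rsp_left[OF Quotient3_S14, of p p] by (simp add: two_sided_ideal.zero)
    from word_value_ideal[OF this] show ?thesis by (simp add: u_def lin_ext_diff)
  qed
  have "clinear u"
  proof (rule clinearI)
    fix x y :: S14 and c
    obtain p q where "x = abs_S14 p" "y = abs_S14 q"
      by (metis Quotient3_abs_rep[OF Quotient3_S14])
    then show "u (x + y) = u x + u y" and "u (c *\<^sub>C x) = c *\<^sub>C u x"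
      by (simp_all add: plus_S14.abs_eq scaleC_S14.abs_eq u_abs lin_ext_add lin_ext_fscale)
  qed
  moreover have u_word: "u (prod_list (map S14_of w)) = word_value f g w" for w
    by (simp add: S14_of_prod u_abs scaleC_one)
  have power: "prod_list (map S14_of (replicate k x @ replicate l y)) = S14_of x ^ k * S14_of y ^ l"
    for k l x y by (simp add: prod_list_replicate)
  have cnt: "count_list (replicate k x) y = (if x = y then k else 0)" for k and x y :: S14_gen
    by (induction k) auto
  have "u (Sa ^ k * Sd ^ l) = f k l" for k l
    using u_word[of "replicate k Ga @ replicate l Gd"]
    by (simp only: power) (auto simp: word_value_def inversions_append inversions_replicate cnt)
  moreover have "u (Sb ^ k * Sc ^ l) = g k l" for k l
    using u_word[of "replicate k Gb @ replicate l Gc"] assms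
    by (simp only: power, cases k; cases l)
      (auto simp: word_value_def inversions_append inversions_replicate cnt)
  ultimately show "\<exists>u. clinear u \<and>
    (\<forall>k l. u (Sa ^ k * Sd ^ l) = f k l) \<and> (\<forall>k l. u (Sb ^ k * Sc ^ l) = g k l)" by blast
next
  fix u v
  assume u: "clinear u \<and> (\<forall>k l. u (Sa ^ k * Sd ^ l) = f k l) \<and> (\<forall>k l. u (Sb ^ k * Sc ^ l) = g k l)"
    and v: "clinear v \<and> (\<forall>k l. v (Sa ^ k * Sd ^ l) = f k l) \<and> (\<forall>k l. v (Sb ^ k * Sc ^ l) = g k l)"
  show "u = v"
  proof (rule clinear_S14_eqI)
    fix w
    show "u (prod_list (map S14_of w)) = v (prod_list (map S14_of w))"
      using S14_word_cases[of w] u v by (auto simp: clinear_scale)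
  qed (use u v in blast)+
qed

lemma basis_functional:
  assumes "f 0 0 = g 0 0"
  shows "clinear (basis_functional f g)"
    and "basis_functional f g (Sa ^ k * Sd ^ l) = f k l"
    and "basis_functional f g (Sb ^ k * Sc ^ l) = g k l"
  using theI'[OF basis_functional_ex1[of f g, OF assms]] unfolding basis_functional_def by blast+


section \<open>The algebra $s14$ and its right regular action\<close>

definition conv :: "(S14 \<Rightarrow> complex) \<Rightarrow> (S14 \<Rightarrow> complex) \<Rightarrow> S14 \<Rightarrow> complex" where
  "conv u v f = tensor_lift (\<lambda>x y. u x * v y) (delta f)"

definition tA :: "S14 \<Rightarrow> complex" where
  "tA = basis_functional (\<lambda>k l. if l = 0 then of_nat k else 0) (\<lambda>k l. 0)"

definition tB :: "S14 \<Rightarrow> complex" where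
  "tB = basis_functional (\<lambda>k l. 0) (\<lambda>k l. if k = 1 \<and> l = 0 then 1 else 0)"

definition tD :: "S14 \<Rightarrow> complex" where
  "tD = basis_functional (\<lambda>k l. if l = 1 then 1 else 0) (\<lambda>k l. 0)"

definition tC :: "S14 \<Rightarrow> complex" where
  "tC = conv tD tB"

definition tE :: "S14 \<Rightarrow> complex" where
  "tE = basis_functional (\<lambda>k l. if k = 0 \<and> l = 0 then 1 else 0) (\<lambda>k l. if k = 0 \<and> l = 0 then 1 else 0)"

definition tK :: "S14 \<Rightarrow> complex" where
  "tK = basis_functional (\<lambda>k l. if l = 0 then (-1) ^ k else 0) (\<lambda>k l. if k = 0 \<and> l = 0 then 1 else 0)"

inductive_set functional_algebra :: "(S14 \<Rightarrow> complex) set \<Rightarrow> (S14 \<Rightarrow> complex) set" for G where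
  gen: "u \<in> G \<Longrightarrow> u \<in> functional_algebra G"
| unit: "counit \<in> functional_algebra G"
| add: "u \<in> functional_algebra G \<Longrightarrow> v \<in> functional_algebra G \<Longrightarrow>
    (\<lambda>f. u f + v f) \<in> functional_algebra G"
| scale: "u \<in> functional_algebra G \<Longrightarrow> (\<lambda>f. c * u f) \<in> functional_algebra G"
| conv: "u \<in> functional_algebra G \<Longrightarrow> v \<in> functional_algebra G \<Longrightarrow>
    conv u v \<in> functional_algebra G"

definition s14 :: "(S14 \<Rightarrow> complex) set" where
  "s14 = functional_algebra {tA, tB, tC, tD, tE, tK}"

definition s14_ABD :: "(S14 \<Rightarrow> complex) set" where
  "s14_ABD = functional_algebra {tA, tB, tD}"

definition piR :: "(S14 \<Rightarrow> complex) \<Rightarrow> S14 \<Rightarrow> S14" where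
  "piR Z f = tensor_lift (\<lambda>x y. Z y *\<^sub>C x) (delta f)"

text \<open>Subrepresentations of the right regular representation, restricted to a set of functionals.\<close>

definition subrep :: "(S14 \<Rightarrow> complex) set \<Rightarrow> S14 set \<Rightarrow> bool" where
  "subrep \<A> V \<longleftrightarrow> cvs.subspace V \<and> (\<forall>Z\<in>\<A>. \<forall>f\<in>V. piR Z f \<in> V)"

definition irreducible_rep :: "(S14 \<Rightarrow> complex) set \<Rightarrow> S14 set \<Rightarrow> bool" where
  "irreducible_rep \<A> V \<longleftrightarrow> subrep \<A> V \<and> V \<noteq> {0} \<and>
    (\<forall>U. subrep \<A> U \<and> U \<subseteq> V \<longrightarrow> U = {0} \<or> U = V)"

definition isomorphic_reps :: "(S14 \<Rightarrow> complex) set \<Rightarrow> S14 set \<Rightarrow> S14 set \<Rightarrow> bool" where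
  "isomorphic_reps \<A> V V' \<longleftrightarrow> subrep \<A> V \<and> subrep \<A> V' \<and>
    (\<exists>\<phi>. bij_betw \<phi> V V' \<and>
      (\<forall>f\<in>V. \<forall>g\<in>V. \<phi> (f + g) = \<phi> f + \<phi> g) \<and> (\<forall>c. \<forall>f\<in>V. \<phi> (c *\<^sub>C f) = c *\<^sub>C \<phi> f) \<and>
      (\<forall>Z\<in>\<A>. \<forall>f\<in>V. \<phi> (piR Z f) = piR Z (\<phi> f)))"

definition rep_direct_sum ::
  "(S14 \<Rightarrow> complex) set \<Rightarrow> 'i set \<Rightarrow> ('i \<Rightarrow> S14 set) \<Rightarrow> S14 set \<Rightarrow> bool" where
  "rep_direct_sum \<A> I V W \<longleftrightarrow> finite I \<and> (\<forall>i\<in>I. subrep \<A> (V i)) \<and>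
    W = {\<Sum>i\<in>I. x i | x. \<forall>i\<in>I. x i \<in> V i} \<and>
    (\<forall>x. (\<forall>i\<in>I. x i \<in> V i) \<and> (\<Sum>i\<in>I. x i) = 0 \<longrightarrow> (\<forall>i\<in>I. x i = 0))"

definition has_basis :: "S14 set \<Rightarrow> 'i set \<Rightarrow> ('i \<Rightarrow> S14) \<Rightarrow> bool" where
  "has_basis V I v \<longleftrightarrow> inj_on v I \<and> cvs.independent (v ` I) \<and> cvs.span (v ` I) = V"

definition W :: "nat \<Rightarrow> S14 set" where
  "W N = cvs.span ({Sa ^ k * Sd ^ l | k l. k + l = N} \<union> {Sb ^ k * Sc ^ l | k l. k + l = N})"

definition W_ad :: "nat \<Rightarrow> S14 set" where
  "W_ad N = cvs.span {Sa ^ k * Sd ^ l | k l. k + l = N}"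

definition W_bc :: "nat \<Rightarrow> S14 set" where
  "W_bc N = cvs.span {Sb ^ k * Sc ^ l | k l. k + l = N}"


section \<open>The coefficient recursions\<close>

text \<open>The coefficient families are indexed by \<open>int\<close> and vanish outside the range in which they
  are used in the eigenvectors; this contains the boundary conventions for the indices
  \<open>-1\<close>, \<open>n\<close> and \<open>n + 1\<close>.\<close>

definition even_coeffs :: "nat \<Rightarrow> nat \<Rightarrow> (int \<Rightarrow> complex) \<Rightarrow> (int \<Rightarrow> complex) \<Rightarrow> bool" where
  "even_coeffs n \<tau> \<alpha> \<beta> \<longleftrightarrow>
    (\<forall>k. k \<notin> {0..int n} \<longrightarrow> \<alpha> k = 0) \<and> (\<forall>k. k \<notin> {0..int n - 1} \<longrightarrow> \<beta> k = 0) \<and>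
    \<alpha> 0 = 1 \<and> \<beta> 0 = 1 \<and>
    (\<forall>k\<in>{0..int n - 1}. of_nat \<tau> ^ 2 * \<beta> k =
      of_int (2 * (int n - k)) * \<alpha> k - of_int (2 * (k + 1)) * \<alpha> (k + 1)) \<and>
    (\<forall>k\<in>{0..int n}. \<alpha> k =
      of_int (2 * k + 1) * \<beta> k - of_int (2 * int n - 2 * k + 1) * \<beta> (k - 1))"

definition odd_coeffs :: "nat \<Rightarrow> nat \<Rightarrow> (int \<Rightarrow> complex) \<Rightarrow> (int \<Rightarrow> complex) \<Rightarrow> bool" where
  "odd_coeffs n \<tau> \<alpha> \<beta> \<longleftrightarrow>
    (\<forall>k. k \<notin> {0..int n} \<longrightarrow> \<alpha> k = 0) \<and> (\<forall>k. k \<notin> {0..int n} \<longrightarrow> \<beta> k = 0) \<and>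
    \<alpha> 0 = 1 \<and> \<beta> 0 = 1 \<and>
    (\<forall>k\<in>{0..int n}. of_nat \<tau> ^ 2 * \<beta> k =
      of_int (2 * int n - 2 * k + 1) * \<alpha> k - of_int (2 * (k + 1)) * \<alpha> (k + 1)) \<and>
    (\<forall>k\<in>{0..int n}. \<alpha> k =
      of_int (2 * k + 1) * \<beta> k - of_int (2 * (int n - k + 1)) * \<beta> (k - 1))"

text \<open>For a sign \<open>s\<close>, these are the vectors $u_0 + s\tau u_1$ and $w_0 + s\tau w_1$.\<close>

definition even_vec :: "nat \<Rightarrow> (int \<Rightarrow> complex) \<Rightarrow> (int \<Rightarrow> complex) \<Rightarrow> int \<Rightarrow> nat \<Rightarrow> S14" where
  "even_vec n \<alpha> \<beta> s \<tau> =
    (\<Sum>k=0..n. \<alpha> (int k) *\<^sub>C (Sa ^ (2 * n - 2 * k) * Sd ^ (2 * k))) +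
    of_int (s * int \<tau>) *\<^sub>C
      (\<Sum>k<n. \<beta> (int k) *\<^sub>C (Sa ^ (2 * n - 2 * k - 1) * Sd ^ (2 * k + 1)))"

definition odd_vec :: "nat \<Rightarrow> (int \<Rightarrow> complex) \<Rightarrow> (int \<Rightarrow> complex) \<Rightarrow> int \<Rightarrow> nat \<Rightarrow> S14" where
  "odd_vec n \<alpha> \<beta> s \<tau> =
    (\<Sum>k=0..n. \<alpha> (int k) *\<^sub>C (Sa ^ (2 * n - 2 * k + 1) * Sd ^ (2 * k))) +
    of_int (s * int \<tau>) *\<^sub>C
      (\<Sum>k=0..n. \<beta> (int k) *\<^sub>C (Sa ^ (2 * n - 2 * k) * Sd ^ (2 * k + 1)))"

definition even_null_vec :: "nat \<Rightarrow> S14" where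
  "even_null_vec n = (\<Sum>k=0..n. of_nat (n choose k) *\<^sub>C (Sa ^ (2 * n - 2 * k) * Sd ^ (2 * k)))"

end

theory Submission
  imports Defs "HOL-Computational_Algebra.Polynomial"
begin

text \<open>The action of each generator of $s14$ obeys a simple rule under right multiplication by the
  generators $x$ of $S14$: \<open>tA\<close> acts as the Euler derivation, \<open>tD\<close> satisfies
  $D(fx) = f\,D(x) - D(f)\,x$, and \<open>tB\<close> vanishes in degrees at least two. The algebra
  automorphism $a \leftrightarrow b$, $c \leftrightarrow -d$ commutes with the action and provides
  all the isomorphisms. On polynomials $p(t)$ in $t = d/a$, \<open>tD\<close> becomes
  $p \mapsto (Lp)(-t)$ with $Lp = (1 + t^2)p' - Ntp$. Since $L$ has the eigenfunctions
  $q = (1 + it)^j(1 - it)^{N-j}$ with eigenvalues $i(2j - N)$, the even part of $q$ has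
  coefficients $\alpha_k$, and $-i$ times the odd part of $q$ has coefficients $\tau\beta_k$,
  that solve the recursions for $\tau = 2j - N$.\<close>

text \<open>The obstacle is that the action of \<open>Z\<close> on a product with a generator
  involves other functionals, the shifts \<open>\<lambda>y. Z (y * g)\<close>, because each
  \<open>delta_gen\<close> mixes all four generators. The simple rules exist because
  \<open>tA\<close>, \<open>tB\<close>, \<open>tD\<close>, \<open>tE\<close>, \<open>tK\<close> and
  \<open>counit\<close> span a space closed under these shifts: \<open>tE\<close> arises as the
  shift of \<open>tB\<close> by \<open>Sb\<close>, \<open>counit\<close> as that of
  \<open>tD\<close> by \<open>Sd\<close>. Coassociativity and homogeneity are proved for arbitrary
  linear functionals instead, and coassociativity reduces invariance under all of \<open>s14\<close>
  to generators. The imaginary eigenvalues of L become real ones of \<open>tD\<close> through t to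
  -t. L exchanges parity: for the two parts e and o it gives Le = -\<tau>o and Lo = \<tau>e, and
  after the sign change in odd degrees e + so is mapped to s\<tau>(e + so) for s = 1 or -1. The
  closed form serves only for the existence of the coefficients; the eigenvector property follows
  from the recursions themselves. That the lines fill the space is a count: N + 1 distinct
  eigenvalues in dimension N + 1.\<close>

lemma clinear_zero: "clinear f \<Longrightarrow> f 0 = 0"
  using clinear_scale[of f 0 0] by simp

lemma clinear_neg: "clinear f \<Longrightarrow> f (- x) = - f x"
  using clinear_scale[of f "- 1" x] by (simp add: scaleC_one)

lemma clinear_diff: "clinear f \<Longrightarrow> f (x - y) = f x - f y"
  using clinear_add[of f x "- y"] by (simp add: clinear_neg)

lemma clinear_sum: "clinear f \<Longrightarrow> f (\<Sum>i\<in>I. g i) = (\<Sum>i\<in>I. f (g i))"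
  by (induction I rule: infinite_finite_induct) (simp_all add: clinear_zero clinear_add)

lemmas clinear_simps = clinear_zero clinear_neg clinear_diff clinear_add clinear_scale

text \<open>The shift by a right factor is what remains of a functional when the last letter is
  split off its argument; the inductions with an arbitrary functional pass to such shifts.\<close>

lemma clinear_rmul:
  fixes Z :: "'a::complex_algebra \<Rightarrow> 'b::complex_vector"
  shows "clinear Z \<Longrightarrow> clinear (\<lambda>y. Z (y * x))"
  by (rule clinearI) (simp_all add: distrib_right mult_scaleC_left clinear_simps)

lemma clinear_eq_on_span:
  assumes "clinear f" "clinear g" "\<And>x. x \<in> B \<Longrightarrow> f x = g x" "x \<in> cvs.span B"
  shows "f x = g x"
  using assms(4) by (induction rule: cvs.span_induct_alt)
    (simp_all add: clinear_simps assms(1-3))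

text \<open>Unlike the basis monomials, words can be extended by any generator without signs or case
  distinctions, so \<open>rev_induct\<close> fits the rules for right multiplication.\<close>

definition word :: "S14_gen list \<Rightarrow> S14" where
  "word w = prod_list (map S14_of w)"

lemma word_Nil [simp]: "word [] = 1"
  and word_snoc [simp]: "word (w @ [g]) = word w * S14_of g"
  by (simp_all add: word_def)

lemma S14_monomial_words:
  "Sa ^ k * Sd ^ l = word (replicate k Ga @ replicate l Gd)"
  "Sb ^ k * Sc ^ l = word (replicate k Gb @ replicate l Gc)"
  by (simp_all add: word_def prod_list_replicate)

lemma clinear_word_eqI:
  assumes "clinear u" "clinear v" "\<And>w. u (word w) = v (word w)"
  shows "u = v"
  using clinear_S14_eqI[OF assms(1,2)] assms(3) by (simp add: word_def)

text \<open>Every word is a scalar multiple of a basis monomial. This criterion suits the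
  functionals of \<open>s14\<close>, which are given by their values on monomials.\<close>

lemma clinear_monomial_eqI:
  fixes u v :: "S14 \<Rightarrow> 'a::complex_vector"
  assumes "clinear u" "clinear v"
    and "\<And>k l. u (Sa ^ k * Sd ^ l) = v (Sa ^ k * Sd ^ l)"
    and "\<And>k l. u (Sb ^ k * Sc ^ l) = v (Sb ^ k * Sc ^ l)"
  shows "u = v"
proof (rule clinear_S14_eqI[OF assms(1,2)])
  fix w
  show "u (prod_list (map S14_of w)) = v (prod_list (map S14_of w))"
    using S14_word_cases[of w] assms by (auto simp: clinear_scale)
qed

section \<open>Right multiplication of monomials by generators\<close>

lemma S14_power_swap:
  "Sd ^ l * Sa = (-1) ^ l *\<^sub>C (Sa * Sd ^ l)" "Sc ^ l * Sb = (-1) ^ l *\<^sub>C (Sb * Sc ^ l)"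
proof (induction l)
  case (Suc l)
  have "Sd ^ Suc l * Sa = Sd * (Sd ^ l * Sa)" by (simp add: mult.assoc)
  also have "\<dots> = (-1) ^ l *\<^sub>C ((Sd * Sa) * Sd ^ l)"
    by (simp only: Suc mult_scaleC_right mult.assoc)
  finally show "Sd ^ Suc l * Sa = (-1) ^ Suc l *\<^sub>C (Sa * Sd ^ Suc l)"
    by (simp add: S14_swap mult_scaleC_left scaleC_one mult.assoc)
  have "Sc ^ Suc l * Sb = Sc * (Sc ^ l * Sb)" by (simp add: mult.assoc)
  also have "\<dots> = (-1) ^ l *\<^sub>C ((Sc * Sb) * Sc ^ l)"
    by (simp only: Suc mult_scaleC_right mult.assoc)
  finally show "Sc ^ Suc l * Sb = (-1) ^ Suc l *\<^sub>C (Sb * Sc ^ Suc l)"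
    by (simp add: S14_swap mult_scaleC_left scaleC_one mult.assoc)
qed (simp_all add: scaleC_one)

lemma mult_eq_zero_power:
  fixes x y :: S14
  assumes "x * y = 0"
  shows "x ^ k * y = (if k = 0 then y else 0)" "z * x ^ k * y = (if k = 0 then z * y else 0)"
  using assms by (cases k; simp add: power_Suc2 mult.assoc del: power_Suc)+

lemma S14_monomial_mult:
  "Sa ^ k * Sd ^ l * Sa = (-1) ^ l *\<^sub>C (Sa ^ Suc k * Sd ^ l)"
  "Sa ^ k * Sd ^ l * Sd = Sa ^ k * Sd ^ Suc l"
  "Sa ^ k * Sd ^ l * Sb = (if k = 0 \<and> l = 0 then Sb else 0)"
  "Sa ^ k * Sd ^ l * Sc = (if k = 0 \<and> l = 0 then Sc else 0)"
  "Sb ^ k * Sc ^ l * Sb = (-1) ^ l *\<^sub>C (Sb ^ Suc k * Sc ^ l)"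
  "Sb ^ k * Sc ^ l * Sc = Sb ^ k * Sc ^ Suc l"
  "Sb ^ k * Sc ^ l * Sa = (if k = 0 \<and> l = 0 then Sa else 0)"
  "Sb ^ k * Sc ^ l * Sd = (if k = 0 \<and> l = 0 then Sd else 0)"
  by (simp_all add: mult_eq_zero_power S14_relations)
    (simp_all add: mult.assoc S14_power_swap mult_scaleC_right,
      simp_all add: power_commutes flip: mult.assoc)

section \<open>Action of linear functionals\<close>

lemma cbilinear_piR: "clinear Z \<Longrightarrow> cbilinear (\<lambda>x y. Z y *\<^sub>C x)"
  and cbilinear_conv: "clinear u \<Longrightarrow> clinear v \<Longrightarrow> cbilinear (\<lambda>x y. u x * v y :: complex)"
  by (rule cbilinearI;
    simp add: clinear_simps scaleC_add_left scaleC_add_right scaleC_scaleC scaleC_complex_def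
      algebra_simps)+

lemma clinear_piR: "clinear Z \<Longrightarrow> clinear (piR Z)"
  using clinear_simps(4,5)[OF clinear_tensor_lift[OF cbilinear_piR[of Z]]]
  by (intro clinearI) (simp_all add: piR_def delta_hom)

lemma clinear_conv: "clinear u \<Longrightarrow> clinear v \<Longrightarrow> clinear (conv u v)"
  using clinear_simps(4,5)[OF clinear_tensor_lift[OF cbilinear_conv[of u v]]]
  by (intro clinearI) (simp_all add: conv_def delta_hom)

lemma piR_one: "clinear Z \<Longrightarrow> piR Z 1 = Z 1 *\<^sub>C 1"
  and conv_one: "clinear u \<Longrightarrow> clinear v \<Longrightarrow> conv u v 1 = u 1 * v 1"
  by (simp_all add: piR_def conv_def delta_hom one_tensor_def tensor_lift_pure
      cbilinear_piR cbilinear_conv)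

text \<open>Both sides are linear in \<open>t\<close>, so pure tensors suffice; there
  \<open>q\<close> is absorbed into the argument of \<open>Z\<close>, while \<open>p\<close> leaves
  the contraction as a right factor.\<close>

lemma tensor_lift_piR_mult:
  fixes p q :: S14
  assumes "clinear Z"
  shows "tensor_lift (\<lambda>x y. Z y *\<^sub>C x) (t * (p \<otimes>\<^sub>C q)) =
    tensor_lift (\<lambda>x y. Z (y * q) *\<^sub>C x) t * p"
proof -
  note lin = clinear_tensor_lift[OF cbilinear_piR[OF assms]]
    clinear_tensor_lift[OF cbilinear_piR[OF clinear_rmul[OF assms]]]
  show ?thesis
    by (induction t rule: tensor_induct)
      (simp_all add: lin[THEN clinear_zero] lin[THEN clinear_add] distrib_right tensor_pure_mult
        tensor_lift_pure cbilinear_piR assms clinear_rmul mult_scaleC_left)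
qed

lemma tensor_lift_conv_mult:
  fixes u v :: "S14 \<Rightarrow> complex"
  assumes "clinear u" "clinear v"
  shows "tensor_lift (\<lambda>x y. u x * v y) (t * (p \<otimes>\<^sub>C q)) =
    tensor_lift (\<lambda>x y. u (x * p) * v (y * q)) t"
proof -
  note lin = clinear_tensor_lift[OF cbilinear_conv[OF assms]]
    clinear_tensor_lift[OF cbilinear_conv[OF assms[THEN clinear_rmul]]]
  show ?thesis
    by (induction t rule: tensor_induct)
      (simp_all add: lin[THEN clinear_zero] lin[THEN clinear_add] distrib_right tensor_pure_mult
        tensor_lift_pure cbilinear_conv assms clinear_rmul)
qed

text \<open>Multiplicativity of \<open>delta\<close> turns the coproduct of the last letter into
  four shifts of \<open>Z\<close>, one for each generator in the second tensor factor.\<close>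

lemma piR_mult_gen:
  assumes "clinear Z"
  shows
    "piR Z (f * Sa) = piR (\<lambda>y. Z (y * Sa)) f * Sa + piR (\<lambda>y. Z (y * Sb)) f * Sb
      - piR (\<lambda>y. Z (y * Sc)) f * Sc + piR (\<lambda>y. Z (y * Sd)) f * Sd"
    "piR Z (f * Sb) = piR (\<lambda>y. Z (y * Sb)) f * Sa + piR (\<lambda>y. Z (y * Sa)) f * Sb
      - piR (\<lambda>y. Z (y * Sd)) f * Sc + piR (\<lambda>y. Z (y * Sc)) f * Sd"
    "piR Z (f * Sc) = piR (\<lambda>y. Z (y * Sc)) f * Sa + piR (\<lambda>y. Z (y * Sa)) f * Sc
      - piR (\<lambda>y. Z (y * Sd)) f * Sb + piR (\<lambda>y. Z (y * Sb)) f * Sd"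
    "piR Z (f * Sd) = piR (\<lambda>y. Z (y * Sd)) f * Sa + piR (\<lambda>y. Z (y * Sa)) f * Sd
      - piR (\<lambda>y. Z (y * Sc)) f * Sb + piR (\<lambda>y. Z (y * Sb)) f * Sc"
  by (simp_all add: piR_def delta_hom distrib_left right_diff_distrib tensor_lift_piR_mult assms
      clinear_add[OF clinear_tensor_lift[OF cbilinear_piR[OF assms]]]
      clinear_diff[OF clinear_tensor_lift[OF cbilinear_piR[OF assms]]])

text \<open>Stated as equations between functions, since they are applied to the shifted functional
  under \<open>piR\<close> in the proof of coassociativity.\<close>

lemma conv_mult_gen:
  assumes "clinear u" "clinear v"
  shows
    "(\<lambda>f. conv u v (f * Sa)) = (\<lambda>f. conv (\<lambda>y. u (y * Sa)) (\<lambda>y. v (y * Sa)) f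
      + conv (\<lambda>y. u (y * Sb)) (\<lambda>y. v (y * Sb)) f
      - conv (\<lambda>y. u (y * Sc)) (\<lambda>y. v (y * Sc)) f + conv (\<lambda>y. u (y * Sd)) (\<lambda>y. v (y * Sd)) f)"
    "(\<lambda>f. conv u v (f * Sb)) = (\<lambda>f. conv (\<lambda>y. u (y * Sa)) (\<lambda>y. v (y * Sb)) f
      + conv (\<lambda>y. u (y * Sb)) (\<lambda>y. v (y * Sa)) f
      - conv (\<lambda>y. u (y * Sc)) (\<lambda>y. v (y * Sd)) f + conv (\<lambda>y. u (y * Sd)) (\<lambda>y. v (y * Sc)) f)"
    "(\<lambda>f. conv u v (f * Sc)) = (\<lambda>f. conv (\<lambda>y. u (y * Sa)) (\<lambda>y. v (y * Sc)) f
      + conv (\<lambda>y. u (y * Sc)) (\<lambda>y. v (y * Sa)) f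
      - conv (\<lambda>y. u (y * Sb)) (\<lambda>y. v (y * Sd)) f + conv (\<lambda>y. u (y * Sd)) (\<lambda>y. v (y * Sb)) f)"
    "(\<lambda>f. conv u v (f * Sd)) = (\<lambda>f. conv (\<lambda>y. u (y * Sa)) (\<lambda>y. v (y * Sd)) f
      + conv (\<lambda>y. u (y * Sd)) (\<lambda>y. v (y * Sa)) f
      - conv (\<lambda>y. u (y * Sb)) (\<lambda>y. v (y * Sc)) f + conv (\<lambda>y. u (y * Sc)) (\<lambda>y. v (y * Sb)) f)"
  by (simp_all add: fun_eq_iff conv_def delta_hom distrib_left right_diff_distrib
      tensor_lift_conv_mult assms
      clinear_add[OF clinear_tensor_lift[OF cbilinear_conv[OF assms]]]
      clinear_diff[OF clinear_tensor_lift[OF cbilinear_conv[OF assms]]])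

lemma piR_fun_add: "piR (\<lambda>y. u y + v y) f = piR u f + piR v f"
  and piR_fun_scale: "piR (\<lambda>y. c * u y) f = c *\<^sub>C piR u f"
  using tensor_lift_fun_add[of "\<lambda>x y. u y *\<^sub>C x" "\<lambda>x y. v y *\<^sub>C x"]
    tensor_lift_fun_scale[of c "\<lambda>x y. u y *\<^sub>C x"]
  by (simp_all add: piR_def scaleC_add_left scaleC_scaleC)

lemma piR_fun_zero [simp]: "piR (\<lambda>y. 0) f = 0"
  using piR_fun_scale[of 0 "\<lambda>y. 0" f] by simp

lemma piR_fun_neg: "piR (\<lambda>y. - u y) f = - piR u f"
  using piR_fun_scale[of "- 1" u f] by (simp add: scaleC_one)

lemma piR_fun_diff: "piR (\<lambda>y. u y - v y) f = piR u f - piR v f"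
  using piR_fun_add[of u "\<lambda>y. - v y" f] by (simp add: piR_fun_neg)

text \<open>This is the coassociativity of \<open>delta\<close>.\<close>

lemma piR_conv:
  assumes "clinear u" "clinear v"
  shows "piR (conv u v) f = piR u (piR v f)"
proof -
  have "piR (conv u v) (word w) = piR u (piR v (word w))" for w
    using assms
  \<comment> \<open>The functionals must be arbitrary: splitting off a letter on either side leaves
    pairs of shifts of \<open>u\<close> and \<open>v\<close>, and the induction hypothesis is
    applied to each such pair. What remains to compare is coassociativity on a single
    generator.\<close>
  proof (induction w arbitrary: u v rule: rev_induct)
    case Nil
    then show ?case
      by (simp add: piR_one conv_one clinear_conv clinear_scale[OF clinear_piR] scaleC_scaleC
          mult.commute)
  next
    case (snoc g w)
    note lin = snoc.prems[THEN clinear_rmul]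
    note [simp] = clinear_add[OF clinear_piR[OF snoc.prems(1)]]
      clinear_diff[OF clinear_piR[OF snoc.prems(1)]]
    show ?case
      by (cases g)
        (simp_all add: piR_mult_gen clinear_conv snoc.prems conv_mult_gen piR_fun_add piR_fun_diff
          snoc.IH lin algebra_simps)
  qed
  then have "piR (conv u v) = (\<lambda>f. piR u (piR v f))"
    by (intro clinear_word_eqI clinear_piR clinear_conv assms clinearI)
      (simp_all add: clinear_simps[OF clinear_piR] assms)
  then show ?thesis by metis
qed

section \<open>The generators of $s14$\<close>

lemma tA_basis: "clinear tA" "tA (Sa ^ k * Sd ^ l) = (if l = 0 then of_nat k else 0)"
    "tA (Sb ^ k * Sc ^ l) = 0"
  unfolding tA_def by (rule basis_functional; simp)+

lemma tB_basis: "clinear tB" "tB (Sa ^ k * Sd ^ l) = 0"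
    "tB (Sb ^ k * Sc ^ l) = (if k = 1 \<and> l = 0 then 1 else 0)"
  unfolding tB_def by (rule basis_functional; simp)+

lemma tD_basis: "clinear tD" "tD (Sa ^ k * Sd ^ l) = (if l = 1 then 1 else 0)"
    "tD (Sb ^ k * Sc ^ l) = 0"
  unfolding tD_def by (rule basis_functional; simp)+

lemma tE_basis: "clinear tE" "tE (Sa ^ k * Sd ^ l) = (if k = 0 \<and> l = 0 then 1 else 0)"
    "tE (Sb ^ k * Sc ^ l) = (if k = 0 \<and> l = 0 then 1 else 0)"
  unfolding tE_def by (rule basis_functional; simp)+

lemma tK_basis: "clinear tK" "tK (Sa ^ k * Sd ^ l) = (if l = 0 then (-1) ^ k else 0)"
    "tK (Sb ^ k * Sc ^ l) = (if k = 0 \<and> l = 0 then 1 else 0)"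
  unfolding tK_def by (rule basis_functional; simp)+

lemma clinear_counit: "clinear counit"
  by (rule clinearI) (simp_all add: counit_hom scaleC_complex_def)

lemma counit_power: "counit (x ^ k) = counit x ^ k"
  by (induction k) (simp_all add: counit_hom)

lemma counit_basis: "counit (Sa ^ k * Sd ^ l) = (if l = 0 then 1 else 0)"
    "counit (Sb ^ k * Sc ^ l) = (if k = 0 \<and> l = 0 then 1 else 0)"
  by (auto simp: counit_hom counit_power power_0_left)

lemma clinear_fun_intros:
  fixes u v :: "'a::complex_vector \<Rightarrow> complex"
  shows "clinear (\<lambda>y::'a. 0::complex)"
    "clinear u \<Longrightarrow> clinear (\<lambda>y. - u y)"
    "clinear u \<Longrightarrow> clinear v \<Longrightarrow> clinear (\<lambda>y. u y + v y)"
    "clinear u \<Longrightarrow> clinear (\<lambda>y. c * u y)"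
  by (rule clinearI; simp add: clinear_simps scaleC_complex_def algebra_simps)+

text \<open>The span of these six functionals is closed under shifts by generators, so the recursion
  in \<open>piR_mult_gen\<close> never leaves it. Each identity is an equality of linear
  functionals, checked on the monomial basis.\<close>

lemma functional_mult_gen:
  "tA (f * Sa) = tA f + counit f" "tA (f * Sb) = 0" "tA (f * Sc) = 0" "tA (f * Sd) = 0"
  "tB (f * Sa) = 0" "tB (f * Sb) = tE f" "tB (f * Sc) = 0" "tB (f * Sd) = 0"
  "tD (f * Sa) = - tD f" "tD (f * Sb) = 0" "tD (f * Sc) = 0" "tD (f * Sd) = counit f"
  "tE (f * Sa) = 0" "tE (f * Sb) = 0" "tE (f * Sc) = 0" "tE (f * Sd) = 0"
  "tK (f * Sa) = - tK f" "tK (f * Sb) = 0" "tK (f * Sc) = 0" "tK (f * Sd) = 0"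
  "counit (f * Sa) = counit f" "counit (f * Sb) = 0" "counit (f * Sc) = 0" "counit (f * Sd) = 0"
proof -
  note lin = tA_basis(1) tB_basis(1) tD_basis(1) tE_basis(1) tK_basis(1) clinear_counit
  note bas = tA_basis(2,3) tB_basis(2,3) tD_basis(2,3) tE_basis(2,3) tK_basis(2,3) counit_basis
  note val = bas[of 1 0, simplified] bas[of 0 1, simplified] bas[of 0 0, simplified]
  note scl = lin[THEN clinear_scale] lin[THEN clinear_zero] scaleC_complex_def
  have "(\<lambda>f. tA (f * Sa)) = (\<lambda>f. tA f + counit f)" "(\<lambda>f. tA (f * Sb)) = (\<lambda>f. 0)"
    "(\<lambda>f. tA (f * Sc)) = (\<lambda>f. 0)" "(\<lambda>f. tA (f * Sd)) = (\<lambda>f. 0)"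
    "(\<lambda>f. tB (f * Sa)) = (\<lambda>f. 0)" "(\<lambda>f. tB (f * Sb)) = tE"
    "(\<lambda>f. tB (f * Sc)) = (\<lambda>f. 0)" "(\<lambda>f. tB (f * Sd)) = (\<lambda>f. 0)"
    "(\<lambda>f. tD (f * Sa)) = (\<lambda>f. - tD f)" "(\<lambda>f. tD (f * Sb)) = (\<lambda>f. 0)"
    "(\<lambda>f. tD (f * Sc)) = (\<lambda>f. 0)" "(\<lambda>f. tD (f * Sd)) = counit"
    "(\<lambda>f. tE (f * Sa)) = (\<lambda>f. 0)" "(\<lambda>f. tE (f * Sb)) = (\<lambda>f. 0)"
    "(\<lambda>f. tE (f * Sc)) = (\<lambda>f. 0)" "(\<lambda>f. tE (f * Sd)) = (\<lambda>f. 0)"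
    "(\<lambda>f. tK (f * Sa)) = (\<lambda>f. - tK f)" "(\<lambda>f. tK (f * Sb)) = (\<lambda>f. 0)"
    "(\<lambda>f. tK (f * Sc)) = (\<lambda>f. 0)" "(\<lambda>f. tK (f * Sd)) = (\<lambda>f. 0)"
    by (rule clinear_monomial_eqI;
        (intro clinear_fun_intros lin lin[THEN clinear_rmul])?;
        (simp add: S14_monomial_mult bas val scl power_Suc[of "- 1"] del: power_Suc)?)+
  then show
    "tA (f * Sa) = tA f + counit f" "tA (f * Sb) = 0" "tA (f * Sc) = 0" "tA (f * Sd) = 0"
    "tB (f * Sa) = 0" "tB (f * Sb) = tE f" "tB (f * Sc) = 0" "tB (f * Sd) = 0"
    "tD (f * Sa) = - tD f" "tD (f * Sb) = 0" "tD (f * Sc) = 0" "tD (f * Sd) = counit f"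
    "tE (f * Sa) = 0" "tE (f * Sb) = 0" "tE (f * Sc) = 0" "tE (f * Sd) = 0"
    "tK (f * Sa) = - tK f" "tK (f * Sb) = 0" "tK (f * Sc) = 0" "tK (f * Sd) = 0"
    by (simp_all add: fun_eq_iff)
  show "counit (f * Sa) = counit f" "counit (f * Sb) = 0" "counit (f * Sc) = 0"
    "counit (f * Sd) = 0"
    by (simp_all add: counit_hom)
qed

lemma functional_one: "tA 1 = 0" "tB 1 = 0" "tD 1 = 0" "tE 1 = 1" "tK 1 = 1"
  using tA_basis(2)[of 0 0] tB_basis(2)[of 0 0] tD_basis(2)[of 0 0] tE_basis(2)[of 0 0]
    tK_basis(2)[of 0 0] by simp_all

lemmas clinear_functionals =
  tA_basis(1) tB_basis(1) tD_basis(1) tE_basis(1) tK_basis(1) clinear_counit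

lemma piR_generators_one [simp]:
  "piR counit 1 = 1" "piR tA 1 = 0" "piR tB 1 = 0" "piR tD 1 = 0" "piR tE 1 = 1" "piR tK 1 = 1"
  by (simp_all add: piR_one clinear_functionals functional_one counit_hom scaleC_one)

text \<open>The counit axiom for the second tensor factor; through it the unit of a functional
  algebra acts as the identity.\<close>

lemma piR_counit: "piR counit f = f"
proof -
  have "piR counit (word w) = word w" for w
  proof (induction w rule: rev_induct)
    case (snoc g w)
    then show ?case
      by (cases g) (simp_all add: piR_mult_gen clinear_functionals functional_mult_gen)
  qed simp
  then have "piR counit = (\<lambda>f. f)"
    by (intro clinear_word_eqI clinear_piR clinear_counit clinearI) simp_all
  then show ?thesis by metis
qed

lemma piR_tA_mult_gen: "piR tA (f * S14_of g) = piR tA f * S14_of g + f * S14_of g"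
  by (cases g) (simp_all add: piR_mult_gen clinear_functionals functional_mult_gen piR_fun_add
      piR_counit distrib_right)

lemma piR_tE_mult_gen: "piR tE (f * S14_of g) = 0"
  by (cases g) (simp_all add: piR_mult_gen clinear_functionals functional_mult_gen)

lemma piR_tK_mult_gen: "piR tK (f * S14_of g) = - (piR tK f * S14_of g)"
  by (cases g) (simp_all add: piR_mult_gen clinear_functionals functional_mult_gen piR_fun_neg)

text \<open>The values of the action on generators, read off from \<open>delta_gen\<close>:
  \<open>tB\<close> selects the terms with b in the second factor, \<open>tD\<close> those with
  d.\<close>

primrec tB_gen :: "S14_gen \<Rightarrow> S14" where
  "tB_gen Ga = Sb" | "tB_gen Gb = Sa" | "tB_gen Gc = Sd" | "tB_gen Gd = Sc"

primrec tD_gen :: "S14_gen \<Rightarrow> S14" where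
  "tD_gen Ga = Sd" | "tD_gen Gb = - Sc" | "tD_gen Gc = - Sb" | "tD_gen Gd = Sa"

text \<open>\<open>tE\<close> acts as the projection to degree zero, so this rule is why
  \<open>tB\<close> sees nothing beyond degree one.\<close>

lemma piR_tB_mult_gen: "piR tB (f * S14_of g) = piR tE f * tB_gen g"
  by (cases g) (simp_all add: piR_mult_gen clinear_functionals functional_mult_gen)

text \<open>The first term comes from \<open>tD (f * Sd) = counit f\<close>, the second, with its
  sign, from \<open>tD (f * Sa) = - tD f\<close>.\<close>

lemma piR_tD_mult_gen: "piR tD (f * S14_of g) = f * tD_gen g - piR tD f * S14_of g"
  by (cases g) (simp_all add: piR_mult_gen clinear_functionals functional_mult_gen piR_counit
      piR_fun_neg)

lemma piR_gen:
  "piR tA (S14_of g) = S14_of g" "piR tB (S14_of g) = tB_gen g" "piR tD (S14_of g) = tD_gen g"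
  "piR tE (S14_of g) = 0" "piR tK (S14_of g) = - S14_of g"
  using piR_tA_mult_gen[of 1 g] piR_tB_mult_gen[of 1 g] piR_tD_mult_gen[of 1 g]
    piR_tE_mult_gen[of 1 g] piR_tK_mult_gen[of 1 g] by simp_all

section \<open>Automorphisms\<close>

text \<open>Evaluated on a representative in the free algebra, hence meaningful only if
  \<open>\<phi>\<close> satisfies \<open>respects_relators\<close>.\<close>

definition S14_hom :: "(S14_gen \<Rightarrow> S14) \<Rightarrow> S14 \<Rightarrow> S14" where
  "S14_hom \<phi> x = free_eval \<phi> (rep_S14 x)"

definition respects_relators :: "(S14_gen \<Rightarrow> S14) \<Rightarrow> bool" where
  "respects_relators \<phi> \<longleftrightarrow> (\<forall>r\<in>S14_relators. free_eval \<phi> r = 0)"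

lemma S14_hom_abs:
  assumes "respects_relators \<phi>"
  shows "S14_hom \<phi> (abs_S14 p) = free_eval \<phi> p"
proof -
  have "rep_S14 (abs_S14 p) - p \<in> two_sided_ideal S14_relators"
    using rep_abs_rsp_left[OF Quotient3_S14, of p p] by (simp add: two_sided_ideal.zero)
  from free_eval_two_sided_ideal[OF this, of \<phi>] show ?thesis
    using assms by (simp add: S14_hom_def free_eval_diff respects_relators_def)
qed

lemma S14_hom:
  assumes "respects_relators \<phi>"
  shows "clinear (S14_hom \<phi>)" "S14_hom \<phi> (x * y) = S14_hom \<phi> x * S14_hom \<phi> y"
    "S14_hom \<phi> 1 = 1" "S14_hom \<phi> (S14_of g) = \<phi> g"
proof -
  have rep: "\<exists>p. z = abs_S14 p" for z
    by (metis Quotient3_abs_rep[OF Quotient3_S14])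
  show "clinear (S14_hom \<phi>)"
  proof (rule clinearI)
    fix x y c
    from rep[of x] rep[of y] obtain p q where "x = abs_S14 p" "y = abs_S14 q" by blast
    then show "S14_hom \<phi> (x + y) = S14_hom \<phi> x + S14_hom \<phi> y"
      "S14_hom \<phi> (c *\<^sub>C x) = c *\<^sub>C S14_hom \<phi> x"
      by (simp_all add: plus_S14.abs_eq scaleC_S14.abs_eq S14_hom_abs assms free_eval_add
          free_eval_fscale)
  qed
  from rep[of x] rep[of y] obtain p q where "x = abs_S14 p" "y = abs_S14 q" by blast
  then show "S14_hom \<phi> (x * y) = S14_hom \<phi> x * S14_hom \<phi> y"
    by (simp add: times_S14.abs_eq S14_hom_abs assms free_eval_mult)
  show "S14_hom \<phi> 1 = 1" "S14_hom \<phi> (S14_of g) = \<phi> g"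
    by (simp_all add: one_S14.abs_eq S14_of.abs_eq S14_hom_abs assms)
qed

lemma S14_hom_power: "respects_relators \<phi> \<Longrightarrow> S14_hom \<phi> (x ^ k) = S14_hom \<phi> x ^ k"
  by (induction k) (simp_all add: S14_hom)

lemma respects_relatorsI:
  assumes "\<phi> Gb * \<phi> Gc + \<phi> Gc * \<phi> Gb = 0" "\<phi> Ga * \<phi> Gd + \<phi> Gd * \<phi> Ga = 0"
    "\<phi> Ga * \<phi> Gb = 0" "\<phi> Gb * \<phi> Ga = 0" "\<phi> Ga * \<phi> Gc = 0" "\<phi> Gc * \<phi> Ga = 0"
    "\<phi> Gb * \<phi> Gd = 0" "\<phi> Gd * \<phi> Gb = 0" "\<phi> Gc * \<phi> Gd = 0" "\<phi> Gd * \<phi> Gc = 0"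
  shows "respects_relators \<phi>"
  using assms by (auto simp: respects_relators_def S14_relators_def Let_def free_eval_add
      free_eval_mult)

text \<open>The signs are forced by \<open>tD\<close>: it sends a to d but b to -c, so a map that
  takes a to b and commutes with \<open>tD\<close> must take d to -c.\<close>

primrec flip_gen :: "S14_gen \<Rightarrow> S14" where
  "flip_gen Ga = Sb" | "flip_gen Gb = Sa" | "flip_gen Gc = - Sd" | "flip_gen Gd = - Sc"

text \<open>This map and \<open>proj_gen\<close> serve as operators with distinct eigenvalues on the
  summands. The present one acts by 1 on a + d, b + c and by -1 on b - c, a - d;
  \<open>proj_gen\<close> acts by 1 on the monomials in a, d and by 0 on those in b, c, in positive
  degree.\<close>

primrec swap_gen :: "S14_gen \<Rightarrow> S14" where
  "swap_gen Ga = Sd" | "swap_gen Gb = Sc" | "swap_gen Gc = Sb" | "swap_gen Gd = Sa"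

primrec proj_gen :: "S14_gen \<Rightarrow> S14" where
  "proj_gen Ga = Sa" | "proj_gen Gb = 0" | "proj_gen Gc = 0" | "proj_gen Gd = Sd"

lemma respects_relators:
  "respects_relators flip_gen" "respects_relators swap_gen" "respects_relators proj_gen"
proof -
  have swap: "Sc * Sb = - (Sb * Sc)" "Sd * Sa = - (Sa * Sd)"
    by (simp_all add: S14_swap scaleC_one)
  show "respects_relators flip_gen" "respects_relators swap_gen" "respects_relators proj_gen"
    by (rule respects_relatorsI; simp add: S14_relations(3-) swap)+
qed

abbreviation flip :: "S14 \<Rightarrow> S14" where "flip \<equiv> S14_hom flip_gen"

lemmas flip_hom [simp] = S14_hom(2-)[OF respects_relators(1)]
lemmas flip_linear = S14_hom(1)[OF respects_relators(1)]
lemmas flip_simps [simp] = clinear_simps[OF flip_linear]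

lemma flip_flip [simp]: "flip (flip f) = f"
proof -
  have "flip (flip (word w)) = word w" for w
  proof (induction w rule: rev_induct)
    case (snoc g w)
    then show ?case by (cases g) simp_all
  qed simp
  then have "(\<lambda>f. flip (flip f)) = (\<lambda>f. f)"
    by (intro clinear_word_eqI clinearI) simp_all
  then show ?thesis by metis
qed

lemma flip_commute_generator:
  assumes "Z \<in> {tA, tB, tD, tE, tK}"
  shows "piR Z (flip f) = flip (piR Z f)"
proof -
  note lin = clinear_functionals[THEN clinear_piR, THEN clinear_neg]
  \<comment> \<open>The claims are proved together because the rule for \<open>tB\<close> refers to
    \<open>tE\<close>.\<close>
  have "piR tA (flip (word w)) = flip (piR tA (word w)) \<and>
    piR tB (flip (word w)) = flip (piR tB (word w)) \<and>
    piR tD (flip (word w)) = flip (piR tD (word w)) \<and>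
    piR tE (flip (word w)) = flip (piR tE (word w)) \<and>
    piR tK (flip (word w)) = flip (piR tK (word w))" for w
  proof (induction w rule: rev_induct)
    case (snoc g w)
    then show ?case
      by (cases g) (simp_all add: piR_tA_mult_gen piR_tB_mult_gen piR_tD_mult_gen piR_tE_mult_gen
          piR_tK_mult_gen lin)
  qed simp
  then have *: "piR Z (flip (word w)) = flip (piR Z (word w))" for w
    using assms by auto
  have "clinear Z" using assms clinear_functionals by auto
  then have "(\<lambda>f. piR Z (flip f)) = (\<lambda>f. flip (piR Z f))"
    by (intro clinear_word_eqI clinearI) (simp_all add: clinear_simps[OF clinear_piR] *)
  then show ?thesis by metis
qed

section \<open>Functional algebras\<close>

lemma clinear_functional_algebra:
  assumes "Z \<in> functional_algebra G" "\<And>Z. Z \<in> G \<Longrightarrow> clinear Z"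
  shows "clinear Z"
  using assms(1)
  by induction (auto intro: clinear_conv clinear_counit clinear_fun_intros assms(2))

lemma functional_algebra_mono:
  assumes "G \<subseteq> functional_algebra H"
  shows "functional_algebra G \<subseteq> functional_algebra H"
proof
  fix Z assume "Z \<in> functional_algebra G"
  then show "Z \<in> functional_algebra H"
    by induction (use assms in \<open>auto intro: functional_algebra.intros\<close>)
qed

text \<open>By \<open>piR_conv\<close> and \<open>piR_counit\<close> the functional algebra acts as
  an algebra of operators, so invariance passes from the generators to everything built from
  them.\<close>

lemma subrep_functional_algebra:
  assumes G: "\<And>Z. Z \<in> G \<Longrightarrow> clinear Z" and V: "cvs.subspace V"
    and inv: "\<And>Z f. Z \<in> G \<Longrightarrow> f \<in> V \<Longrightarrow> piR Z f \<in> V"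
  shows "subrep (functional_algebra G) V"
proof -
  have "\<forall>f\<in>V. piR Z f \<in> V" if "Z \<in> functional_algebra G" for Z
    using that
  proof induction
    case (conv u v)
    then show ?case using clinear_functional_algebra[OF _ G] by (simp add: piR_conv)
  qed (simp_all add: inv piR_counit piR_fun_add piR_fun_scale cvs.subspace_add[OF V]
        cvs.subspace_scale[OF V])
  with V show ?thesis by (simp add: subrep_def)
qed

lemma commute_functional_algebra:
  assumes G: "\<And>Z. Z \<in> G \<Longrightarrow> clinear Z" and \<phi>: "clinear \<phi>"
    and comm: "\<And>Z f. Z \<in> G \<Longrightarrow> \<phi> (piR Z f) = piR Z (\<phi> f)"
    and Z: "Z \<in> functional_algebra G"
  shows "\<phi> (piR Z f) = piR Z (\<phi> f)"
  using Z
proof (induction arbitrary: f)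
  case (conv u v)
  then show ?case using clinear_functional_algebra[OF _ G] by (simp add: piR_conv)
qed (simp_all add: comm piR_counit piR_fun_add piR_fun_scale clinear_simps[OF \<phi>])

lemma s14_eq: "s14 = functional_algebra {tA, tB, tD, tE, tK}"
proof -
  have "{tA, tB, tC, tD, tE, tK} \<subseteq> functional_algebra {tA, tB, tD, tE, tK}"
    by (auto simp: tC_def intro: functional_algebra.intros)
  then show ?thesis unfolding s14_def
    by (intro antisym functional_algebra_mono) (auto intro: functional_algebra.gen)
qed

lemma s14_ABD_subset: "s14_ABD \<subseteq> s14"
  unfolding s14_ABD_def s14_eq
  by (intro functional_algebra_mono) (auto intro: functional_algebra.gen)

lemma subrep_s14I:
  assumes "cvs.subspace V" "\<And>Z f. Z \<in> {tA, tB, tD, tE, tK} \<Longrightarrow> f \<in> V \<Longrightarrow> piR Z f \<in> V"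
  shows "subrep s14 V"
  unfolding s14_eq
  by (rule subrep_functional_algebra) (use assms clinear_functionals in auto)

lemma subrep_span_s14I:
  assumes "\<And>Z b. Z \<in> {tA, tB, tD, tE, tK} \<Longrightarrow> b \<in> B \<Longrightarrow> piR Z b \<in> cvs.span B"
  shows "subrep s14 (cvs.span B)"
proof (rule subrep_s14I)
  fix Z f assume Z: "Z \<in> {tA, tB, tD, tE, tK}" and f: "f \<in> cvs.span B"
  have "clinear (piR Z)" using Z clinear_functionals clinear_piR by auto
  note lin = clinear_simps[OF this]
  from f show "piR Z f \<in> cvs.span B"
    by (induction rule: cvs.span_induct_alt)
      (auto simp: lin cvs.span_zero intro!: cvs.span_add cvs.span_scale assms[OF Z])
qed (rule cvs.subspace_span)

lemma subrep_mono: "subrep \<A> V \<Longrightarrow> \<B> \<subseteq> \<A> \<Longrightarrow> subrep \<B> V"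
  by (auto simp: subrep_def)

lemma flip_commute: "Z \<in> s14 \<Longrightarrow> flip (piR Z f) = piR Z (flip f)"
  unfolding s14_eq
  by (rule commute_functional_algebra[OF _ flip_linear])
    (use clinear_functionals in \<open>auto simp: flip_commute_generator\<close>)

lemma isomorphic_reps_flip:
  assumes "subrep s14 (cvs.span B)" "subrep s14 (cvs.span (flip ` B))" "\<A> \<subseteq> s14"
  shows "isomorphic_reps \<A> (cvs.span B) (cvs.span (flip ` B))"
proof -
  have "flip f \<in> cvs.span (flip ` C)" if "f \<in> cvs.span C" for f C
    using that by (induction rule: cvs.span_induct_alt)
      (auto simp: cvs.span_zero intro!: cvs.span_add cvs.span_scale intro: cvs.span_base)
  from this[of _ B] this[of _ "flip ` B"]
  have "bij_betw flip (cvs.span B) (cvs.span (flip ` B))"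
    by (intro bij_betw_byWitness[of _ flip]) (auto simp: image_image)
  then show ?thesis
    unfolding isomorphic_reps_def using assms
    by (intro conjI exI[of _ flip]) (auto simp: flip_commute intro: subrep_mono)
qed

section \<open>The homogeneous components\<close>

lemma W_mult_gen: "f \<in> W N \<Longrightarrow> f * S14_of g \<in> W (Suc N)"
  unfolding W_def
proof (induction rule: cvs.span_induct_alt)
  case (step c x y)
  have mon: "Sa ^ k * Sd ^ l \<in> W (k + l)" "Sb ^ k * Sc ^ l \<in> W (k + l)" for k l
    unfolding W_def by (auto intro!: cvs.span_base)
  then have mon': "k + l = Suc N \<Longrightarrow> Sa ^ k * Sd ^ l \<in> W (Suc N)"
    "k + l = Suc N \<Longrightarrow> Sb ^ k * Sc ^ l \<in> W (Suc N)" for k l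
    by metis+
  have sc: "c *\<^sub>C f \<in> W M" if "f \<in> W M" for c f M
    using that unfolding W_def by (rule cvs.span_scale)
  have zero: "0 \<in> W M" for M unfolding W_def by (rule cvs.span_zero)
  \<comment> \<open>Needed for N = 0, where the monomial is the unit and the mixed products do not
    vanish.\<close>
  have gen: "S14_of g \<in> W (Suc 0)" for g
    using mon(1)[of 1 0] mon(1)[of 0 1] mon(2)[of 1 0] mon(2)[of 0 1] by (cases g) simp_all
  have "x * S14_of g \<in> W (Suc N)"
    using step(1) gen mon'
    by (cases g) (auto simp: S14_monomial_mult zero simp del: power_Suc intro!: sc)
  with step(2) show ?case
    by (auto simp: distrib_right mult_scaleC_left W_def intro!: cvs.span_add cvs.span_scale)
qed (simp add: cvs.span_zero)

lemma word_in_W: "word w \<in> W (length w)"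
proof (induction w rule: rev_induct)
  case Nil
  show ?case unfolding W_def by (auto intro!: cvs.span_base exI[of _ 0])
qed (simp add: W_mult_gen)

text \<open>The relators are homogeneous, so degree is word length. Statements about
  \<open>W N\<close> thereby reduce to words, on which the multiplication rules work.\<close>

lemma W_eq_span_words: "W N = cvs.span (word ` {w. length w = N})"
proof
  show "W N \<subseteq> cvs.span (word ` {w. length w = N})"
    unfolding W_def
    by (rule cvs.span_mono) (auto simp: S14_monomial_words)
  show "cvs.span (word ` {w. length w = N}) \<subseteq> W N"
    by (rule cvs.span_minimal) (auto simp: word_in_W, simp add: W_def)
qed

lemma piR_word_scalars:
  "piR tA (word w) = of_nat (length w) *\<^sub>C word w"
  "piR tK (word w) = (-1) ^ length w *\<^sub>C word w"
  by (induction w rule: rev_induct)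
    (simp_all add: piR_tA_mult_gen piR_tK_mult_gen scaleC_add_left scaleC_one mult_scaleC_left
      add.commute)

lemma piR_word_zero:
  "length w \<ge> 1 \<Longrightarrow> piR tE (word w) = 0" "length w \<ge> 2 \<Longrightarrow> piR tB (word w) = 0"
proof -
  show E: "piR tE (word w) = 0" if "length w \<ge> 1" for w
    using that by (cases w rule: rev_cases) (simp_all add: piR_tE_mult_gen)
  show "piR tB (word w) = 0" if "length w \<ge> 2"
    using that by (cases w rule: rev_cases) (simp_all add: piR_tB_mult_gen E)
qed

lemma piR_W:
  assumes "f \<in> W N"
  shows "piR tA f = of_nat N *\<^sub>C f" "piR tK f = (-1) ^ N *\<^sub>C f"
    "N \<ge> 1 \<Longrightarrow> piR tE f = 0" "N \<ge> 2 \<Longrightarrow> piR tB f = 0"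
proof -
  have scale: "clinear (\<lambda>f::S14. c *\<^sub>C f)" for c
    by (rule clinearI) (simp_all add: scaleC_add_right scaleC_scaleC mult.commute)
  have f: "f \<in> cvs.span (word ` {w. length w = N})" using assms by (simp add: W_eq_span_words)
  show "piR tA f = of_nat N *\<^sub>C f" "piR tK f = (-1) ^ N *\<^sub>C f"
    by (rule clinear_eq_on_span[OF clinear_piR scale _ f],
      auto simp: clinear_functionals piR_word_scalars)+
  show "piR tE f = 0" if "N \<ge> 1"
  proof -
    have "piR tE f = 0 *\<^sub>C f"
      by (rule clinear_eq_on_span[OF clinear_piR scale _ f])
        (use that in \<open>auto simp: piR_word_zero clinear_functionals\<close>)
    then show ?thesis by simp
  qed
  show "piR tB f = 0" if "N \<ge> 2"
  proof -
    have "piR tB f = 0 *\<^sub>C f"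
      by (rule clinear_eq_on_span[OF clinear_piR scale _ f])
        (use that in \<open>auto simp: piR_word_zero clinear_functionals\<close>)
    then show ?thesis by simp
  qed
qed

text \<open>The reason is that the coproduct respects the degree.\<close>

lemma piR_word_in_W: "clinear Z \<Longrightarrow> piR Z (word w) \<in> W (length w)"
proof (induction w arbitrary: Z rule: rev_induct)
  case Nil
  then show ?case
    using word_in_W[of "[]"] by (simp add: piR_one) (simp add: W_def cvs.span_scale)
next
  case (snoc g w)
  have "piR (\<lambda>y. Z (y * x)) (word w) * S14_of h \<in> W (Suc (length w))" for x h
    by (rule W_mult_gen[OF snoc.IH[OF clinear_rmul[OF snoc.prems]]])
  then show ?case
    by (cases g) (auto simp: piR_mult_gen snoc.prems W_def intro!: cvs.span_add cvs.span_diff)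
qed

lemma subrep_W: "subrep s14 (W N)"
  unfolding W_eq_span_words
proof (rule subrep_span_s14I)
  fix Z b assume Z: "Z \<in> {tA, tB, tD, tE, tK}" and b: "b \<in> word ` {w. length w = N}"
  have "clinear Z" using Z clinear_functionals by auto
  with b show "piR Z b \<in> cvs.span (word ` {w. length w = N})"
    using piR_word_in_W by (auto simp flip: W_eq_span_words)
qed

section \<open>Linear algebra\<close>

lemma independentI_functionals:
  fixes B :: "'a::complex_vector set"
  assumes "\<And>b. b \<in> B \<Longrightarrow> \<exists>u::'a \<Rightarrow> complex. clinear u \<and> u b \<noteq> 0 \<and> (\<forall>b'\<in>B - {b}. u b' = 0)"
  shows "cvs.independent B"
proof
  assume "cvs.dependent B"
  then obtain S r b where S: "finite S" "S \<subseteq> B" "b \<in> S" "r b \<noteq> 0" "(\<Sum>v\<in>S. r v *\<^sub>C v) = 0"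
    unfolding cvs.dependent_explicit by blast
  then obtain u :: "'a \<Rightarrow> complex" where u: "clinear u" "u b \<noteq> 0" "\<forall>b'\<in>B - {b}. u b' = 0"
    using assms by blast
  have "0 = u (\<Sum>v\<in>S. r v *\<^sub>C v)" by (simp add: S clinear_zero u)
  also have "\<dots> = (\<Sum>v\<in>S. r v * u v)"
    by (simp add: clinear_sum[OF u(1)] clinear_scale[OF u(1)] scaleC_complex_def)
  also have "\<dots> = (\<Sum>v\<in>S. if v = b then r b * u b else 0)"
    by (rule sum.cong) (use u S in auto)
  finally show False using S u by simp
qed

lemma has_basisI_functionals:
  fixes u :: "'i \<Rightarrow> S14 \<Rightarrow> complex"
  assumes "\<And>i. i \<in> I \<Longrightarrow> clinear (u i)"
    and "\<And>i j. i \<in> I \<Longrightarrow> j \<in> I \<Longrightarrow> u i (v j) = (if i = j then 1 else 0)"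
    and "cvs.span (v ` I) = V"
  shows "has_basis V I v"
proof -
  have "inj_on v I"
  proof (rule inj_onI)
    fix i j assume ij: "i \<in> I" "j \<in> I" "v i = v j"
    with assms(2)[of i i] assms(2)[of i j] show "i = j" by (simp split: if_splits)
  qed
  moreover have "cvs.independent (v ` I)"
  proof (rule independentI_functionals)
    fix b assume "b \<in> v ` I"
    then obtain i where i: "i \<in> I" "b = v i" by blast
    then have "u i b = 1" and "\<forall>b'\<in>v ` I - {b}. u i b' = 0"
      by (auto simp: assms(2) split: if_splits)
    with assms(1)[OF i(1)]
    show "\<exists>w::S14 \<Rightarrow> complex. clinear w \<and> w b \<noteq> 0 \<and> (\<forall>b'\<in>v ` I - {b}. w b' = 0)"
      by (intro exI[of _ "u i"]) simp
  qed
  ultimately show ?thesis using assms(3) by (simp add: has_basis_def)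
qed

lemma has_basis_dim: "has_basis V I v \<Longrightarrow> cvs.dim V = card I"
  unfolding has_basis_def by (metis card_image cvs.dim_eq_card cvs.span_span)

text \<open>Applying \<open>T\<close> to the relation and subtracting \<open>\<mu> j\<close> times
  the relation removes one summand. The \<open>x i\<close> may vanish, so this is directness of a
  sum of eigenspaces of any dimension.\<close>

lemma eigenvector_sum_eq_0:
  fixes T :: "'a::complex_vector \<Rightarrow> 'a"
  assumes T: "clinear T" and "finite I" "inj_on \<mu> I"
    and "\<And>i. i \<in> I \<Longrightarrow> T (x i) = \<mu> i *\<^sub>C x i" "(\<Sum>i\<in>I. x i) = 0"
  shows "\<forall>i\<in>I. x i = 0"
  using assms(2-)
proof (induction I arbitrary: x rule: finite_induct)
  case (insert j F)
  have "(\<Sum>i\<in>insert j F. \<mu> i *\<^sub>C x i) = T (\<Sum>i\<in>insert j F. x i)"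
    unfolding clinear_sum[OF T] by (rule sum.cong) (simp_all add: insert.prems)
  moreover have "(\<Sum>i\<in>insert j F. \<mu> j *\<^sub>C x i) = 0"
    by (simp only: insert.prems cvs.scale_zero_right flip: cvs.scale_sum_right)
  ultimately have "0 = (\<Sum>i\<in>insert j F. \<mu> i *\<^sub>C x i) - (\<Sum>i\<in>insert j F. \<mu> j *\<^sub>C x i)"
    by (simp add: insert.prems clinear_zero[OF T])
  also have "\<dots> = (\<Sum>i\<in>F. (\<mu> i - \<mu> j) *\<^sub>C x i)"
    using insert.hyps by (simp add: sum_subtractf cvs.scale_left_diff_distrib)
  finally have "(\<Sum>i\<in>F. (\<mu> i - \<mu> j) *\<^sub>C x i) = 0" by simp
  with insert.prems have "\<forall>i\<in>F. (\<mu> i - \<mu> j) *\<^sub>C x i = 0"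
    by (intro insert.IH) (auto simp: clinear_scale[OF T] scaleC_scaleC mult.commute)
  with insert.prems insert.hyps have "\<forall>i\<in>F. x i = 0" by (auto simp: inj_on_def)
  with insert.prems insert.hyps show ?case by simp
qed simp

text \<open>Brings the span of a union into the form of the sums in
  \<open>rep_direct_sum\<close>.\<close>

lemma span_UN_eq_sums:
  fixes B :: "'i \<Rightarrow> 'a::complex_vector set"
  assumes "finite I"
  shows "cvs.span (\<Union>i\<in>I. B i) = {\<Sum>i\<in>I. x i | x. \<forall>i\<in>I. x i \<in> cvs.span (B i)}" (is "_ = ?S")
proof
  have "cvs.subspace ?S"
  proof (rule cvs.subspaceI)
    show "0 \<in> ?S" by (intro CollectI exI[of _ "\<lambda>_. 0"]) (simp add: cvs.span_zero)
    show "f + g \<in> ?S" if "f \<in> ?S" "g \<in> ?S" for f g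
    proof -
      from that obtain x y where "f = (\<Sum>i\<in>I. x i)" "\<forall>i\<in>I. x i \<in> cvs.span (B i)"
        "g = (\<Sum>i\<in>I. y i)" "\<forall>i\<in>I. y i \<in> cvs.span (B i)" by blast
      then show ?thesis
        by (intro CollectI exI[of _ "\<lambda>i. x i + y i"]) (simp add: sum.distrib cvs.span_add)
    qed
    show "c *\<^sub>C f \<in> ?S" if "f \<in> ?S" for c f
    proof -
      from that obtain x where "f = (\<Sum>i\<in>I. x i)" "\<forall>i\<in>I. x i \<in> cvs.span (B i)" by blast
      then show ?thesis
        by (intro CollectI exI[of _ "\<lambda>i. c *\<^sub>C x i"])
          (simp add: cvs.scale_sum_right cvs.span_scale)
    qed
  qed
  moreover have "(\<Union>i\<in>I. B i) \<subseteq> ?S"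
  proof safe
    fix i b assume "i \<in> I" "b \<in> B i"
    then show "\<exists>x. b = (\<Sum>i\<in>I. x i) \<and> (\<forall>i\<in>I. x i \<in> cvs.span (B i))"
      using assms
      by (intro exI[of _ "\<lambda>j. if j = i then b else 0"])
        (auto simp: cvs.span_zero intro: cvs.span_base)
  qed
  ultimately show "cvs.span (\<Union>i\<in>I. B i) \<subseteq> ?S" by (rule cvs.span_minimal[rotated])
  have "cvs.span (B i) \<subseteq> cvs.span (\<Union>i\<in>I. B i)" if "i \<in> I" for i
    using that by (intro cvs.span_mono) auto
  then show "?S \<subseteq> cvs.span (\<Union>i\<in>I. B i)" by (auto intro!: cvs.span_sum)
qed

text \<open>\<open>T\<close> only has to tell the summands apart; their invariance is a separate
  hypothesis, so \<open>T\<close> can be any linear map that takes distinct eigenvalues on them. It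
  will be an algebra map or \<open>piR tD\<close>.\<close>

lemma rep_direct_sum_eigenspaces:
  assumes "finite I" "\<And>i. i \<in> I \<Longrightarrow> subrep \<A> (cvs.span (B i))"
    and X: "X = cvs.span (\<Union>i\<in>I. B i)"
    and T: "clinear T" "inj_on \<mu> I" "\<And>i b. i \<in> I \<Longrightarrow> b \<in> B i \<Longrightarrow> T b = \<mu> i *\<^sub>C b"
  shows "rep_direct_sum \<A> I (\<lambda>i. cvs.span (B i)) X"
proof -
  have scale: "clinear (\<lambda>f::S14. c *\<^sub>C f)" for c
    by (rule clinearI) (simp_all add: scaleC_add_right scaleC_scaleC mult.commute)
  have "T f = \<mu> i *\<^sub>C f" if "i \<in> I" "f \<in> cvs.span (B i)" for i f
    by (rule clinear_eq_on_span[OF T(1) scale T(3)[OF that(1)] that(2)])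
  then have "\<forall>i\<in>I. x i = 0" if "\<forall>i\<in>I. x i \<in> cvs.span (B i)" "(\<Sum>i\<in>I. x i) = 0" for x
    using that by (intro eigenvector_sum_eq_0[OF T(1) assms(1) T(2)]) auto
  with assms(1,2) show ?thesis
    unfolding rep_direct_sum_def X span_UN_eq_sums[OF assms(1)] by blast
qed

lemma independent_eigenvectors:
  fixes T :: "'a::complex_vector \<Rightarrow> 'a"
  assumes "clinear T" "inj_on \<mu> B" "\<And>b. b \<in> B \<Longrightarrow> T b = \<mu> b *\<^sub>C b" "0 \<notin> B"
  shows "cvs.independent B"
proof
  assume "cvs.dependent B"
  then obtain S r b where S: "finite S" "S \<subseteq> B" "b \<in> S" "r b \<noteq> 0" "(\<Sum>v\<in>S. r v *\<^sub>C v) = 0"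
    unfolding cvs.dependent_explicit by blast
  have "\<forall>v\<in>S. r v *\<^sub>C v = 0"
    by (rule eigenvector_sum_eq_0[OF assms(1) S(1) inj_on_subset[OF assms(2) S(2)] _ S(5)])
      (use assms S in \<open>auto simp: clinear_scale scaleC_scaleC mult.commute\<close>)
  with S assms show False by auto
qed

text \<open>A vector of \<open>cvs.span C\<close> outside \<open>cvs.span B\<close> would extend
  \<open>B\<close> to an independent set with more elements than the spanning set
  \<open>C\<close>.\<close>

lemma span_eq_if_card_ge:
  fixes B C :: "'a::complex_vector set"
  assumes "finite C" "cvs.independent B" "B \<subseteq> cvs.span C" "card C \<le> card B"
  shows "cvs.span B = cvs.span C"
proof
  show "cvs.span B \<subseteq> cvs.span C" using assms(3) cvs.span_minimal cvs.subspace_span by blast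
  have fB: "finite B" using cvs.independent_span_bound[OF assms(1-3)] by blast
  have "f \<in> cvs.span B" if f: "f \<in> cvs.span C" for f
  proof (rule ccontr)
    assume nf: "f \<notin> cvs.span B"
    then have "cvs.independent (insert f B)" using assms(2) by (simp add: cvs.independent_insert)
    from cvs.independent_span_bound[OF assms(1) this] f assms(3)
    have "card (insert f B) \<le> card C" by blast
    moreover have "f \<notin> B" using nf cvs.span_base by blast
    ultimately show False using assms(4) fB by simp
  qed
  then show "cvs.span C \<subseteq> cvs.span B" by blast
qed

lemma dim_span_singleton:
  fixes x :: "'a::complex_vector"
  assumes "x \<noteq> 0"
  shows "cvs.dim (cvs.span {x}) = 1"
proof -
  have "cvs.independent {x}" using assms by (simp add: cvs.independent_insert cvs.independent_empty)
  from cvs.dim_eq_card[OF refl this] show ?thesis by (simp add: cvs.dim_span)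
qed

section \<open>Monomial bases\<close>

text \<open>The second family is nonzero only for the coordinate of the unit:
  \<open>basis_functional\<close> requires both families to agree there.\<close>

definition coord_ad :: "nat \<Rightarrow> nat \<Rightarrow> S14 \<Rightarrow> complex" where
  "coord_ad k l = basis_functional (\<lambda>k' l'. if k' = k \<and> l' = l then 1 else 0)
    (\<lambda>k' l'. if k = 0 \<and> l = 0 \<and> k' = 0 \<and> l' = 0 then 1 else 0)"

definition coord_bc :: "nat \<Rightarrow> nat \<Rightarrow> S14 \<Rightarrow> complex" where
  "coord_bc k l = basis_functional (\<lambda>k' l'. if k = 0 \<and> l = 0 \<and> k' = 0 \<and> l' = 0 then 1 else 0)
    (\<lambda>k' l'. if k' = k \<and> l' = l then 1 else 0)"

lemma coord_ad:
  "clinear (coord_ad k l)"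
  "coord_ad k l (Sa ^ k' * Sd ^ l') = (if k' = k \<and> l' = l then 1 else 0)"
  "coord_ad k l (Sb ^ k' * Sc ^ l') = (if k = 0 \<and> l = 0 \<and> k' = 0 \<and> l' = 0 then 1 else 0)"
  unfolding coord_ad_def by (rule basis_functional; simp)+

lemma coord_bc:
  "clinear (coord_bc k l)"
  "coord_bc k l (Sa ^ k' * Sd ^ l') = (if k = 0 \<and> l = 0 \<and> k' = 0 \<and> l' = 0 then 1 else 0)"
  "coord_bc k l (Sb ^ k' * Sc ^ l') = (if k' = k \<and> l' = l then 1 else 0)"
  unfolding coord_bc_def by (rule basis_functional; simp)+

lemma monomials_image:
  "{f k l | k l. k + l = N} = (\<lambda>l. f (N - l) l) ` {0..N::nat}"
proof (intro equalityI subsetI)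
  fix x assume "x \<in> {f k l | k l. k + l = N}"
  then obtain k l where "x = f k l" "k + l = N" by blast
  then show "x \<in> (\<lambda>l. f (N - l) l) ` {0..N}" by (intro image_eqI[of _ _ l]) auto
next
  fix x assume "x \<in> (\<lambda>l. f (N - l) l) ` {0..N}"
  then obtain l where "x = f (N - l) l" "l \<le> N" by auto
  then show "x \<in> {f k l | k l. k + l = N}"
    by (intro CollectI exI[of _ "N - l"] exI[of _ l]) auto
qed

lemma W_ad_basis: "has_basis (W_ad N) {0..N} (\<lambda>l. Sa ^ (N - l) * Sd ^ l)"
  by (rule has_basisI_functionals[where u = "\<lambda>l. coord_ad (N - l) l"])
    (auto simp: coord_ad W_ad_def monomials_image)

lemma W_bc_basis: "has_basis (W_bc N) {0..N} (\<lambda>l. Sb ^ (N - l) * Sc ^ l)"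
  by (rule has_basisI_functionals[where u = "\<lambda>l. coord_bc (N - l) l"])
    (auto simp: coord_bc W_bc_def monomials_image)

text \<open>In positive degree neither family contains the unit, so the coordinate functionals of
  one family vanish on the other and together they form a dual family.\<close>

lemma W_basis:
  assumes "N \<ge> 1"
  shows "has_basis (W N) ({0..N} <+> {0..N})
    (case_sum (\<lambda>l. Sa ^ (N - l) * Sd ^ l) (\<lambda>l. Sb ^ (N - l) * Sc ^ l))"
proof (rule has_basisI_functionals
    [where u = "case_sum (\<lambda>l. coord_ad (N - l) l) (\<lambda>l. coord_bc (N - l) l)"])
  show "cvs.span (case_sum (\<lambda>l. Sa ^ (N - l) * Sd ^ l) (\<lambda>l. Sb ^ (N - l) * Sc ^ l) `
      ({0..N} <+> {0..N})) = W N"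
    by (simp add: W_def monomials_image Plus_def image_Un image_image)
qed (use assms in \<open>auto simp: coord_ad coord_bc split: if_splits\<close>)

lemma dim_W: "N \<ge> 1 \<Longrightarrow> cvs.dim (W N) = 2 * (N + 1)"
  by (drule W_basis, drule has_basis_dim) (simp add: card_Plus)

lemma W_0: "W 0 = cvs.span {1}"
  by (simp add: W_def)

lemma S14_one_neq_0: "(1::S14) \<noteq> 0"
  using counit_hom(3) clinear_zero[OF clinear_counit] by auto

section \<open>The action of \<open>tD\<close> on monomials and the splitting in degrees at least
  two\<close>

lemma W_ad_subset: "W_ad N \<subseteq> W N"
  unfolding W_ad_def W_def by (rule cvs.span_mono) blast

text \<open>The minus sign in the rule for \<open>tD\<close> is cancelled by da = -ad, so the terms
  add up as for an ordinary derivation.\<close>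

lemma piR_tD_Sa_power: "piR tD (Sa ^ k) = of_nat k *\<^sub>C (Sa ^ (k - 1) * Sd)"
proof (induction k)
  case (Suc k)
  have "piR tD (Sa ^ Suc k) = Sa ^ k * Sd - piR tD (Sa ^ k) * Sa"
    using piR_tD_mult_gen[of "Sa ^ k" Ga] by (simp add: power_commutes)
  also have "\<dots> = Sa ^ k * Sd - of_nat k *\<^sub>C (Sa ^ (k - 1) * Sd ^ 1 * Sa)"
    by (simp add: Suc mult_scaleC_left)
  also have "\<dots> = 1 *\<^sub>C (Sa ^ k * Sd) + of_nat k *\<^sub>C (Sa ^ k * Sd)"
    unfolding S14_monomial_mult by (cases k) (simp_all add: scaleC_one)
  also have "\<dots> = of_nat (Suc k) *\<^sub>C (Sa ^ k * Sd)"
    by (simp only: of_nat_Suc scaleC_add_left)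
  finally show ?case by simp
qed simp

text \<open>Appending d negates the earlier terms, and the new term carries \<open>(-1) ^ l\<close>
  from moving a past the power of d; the two signs agree. The truncated exponents
  \<open>k - 1\<close> and \<open>l - 1\<close> are harmless because their coefficients k and l
  vanish at zero.\<close>

lemma piR_tD_monomial:
  "piR tD (Sa ^ k * Sd ^ l) = (-1) ^ l *\<^sub>C
    (of_nat k *\<^sub>C (Sa ^ (k - 1) * Sd ^ (l + 1)) - of_nat l *\<^sub>C (Sa ^ (k + 1) * Sd ^ (l - 1)))"
proof (induction l)
  case (Suc l)
  have "piR tD (Sa ^ k * Sd ^ Suc l) = Sa ^ k * Sd ^ l * Sa - piR tD (Sa ^ k * Sd ^ l) * Sd"
    using piR_tD_mult_gen[of "Sa ^ k * Sd ^ l" Gd] by (simp add: power_commutes mult.assoc)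
  also have "\<dots> = (-1) ^ l *\<^sub>C (Sa ^ Suc k * Sd ^ l) - (-1) ^ l *\<^sub>C
      (of_nat k *\<^sub>C (Sa ^ (k - 1) * Sd ^ (l + 2)) - of_nat l *\<^sub>C (Sa ^ (k + 1) * Sd ^ l))"
    unfolding Suc
    by (cases l) (simp_all add: S14_monomial_mult left_diff_distrib mult_scaleC_left
        del: power_Suc, simp add: mult.assoc power_commutes)
  finally show ?case
    by (simp add: algebra_simps scaleC_add_left scaleC_one cvs.scale_right_diff_distrib
        scaleC_add_right)
qed (simp add: piR_tD_Sa_power scaleC_one)

lemma subrep_span_flip:
  assumes "subrep s14 (cvs.span B)"
  shows "subrep s14 (cvs.span (flip ` B))"
proof (rule subrep_span_s14I)
  fix Z b assume Z: "Z \<in> {tA, tB, tD, tE, tK}" and "b \<in> flip ` B"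
  then obtain b' where b': "b' \<in> B" "b = flip b'" by blast
  have "Z \<in> s14" using Z by (auto simp: s14_eq intro: functional_algebra.gen)
  with b' assms have "piR Z b' \<in> cvs.span B"
    using cvs.span_base by (auto simp: subrep_def)
  then have "flip (piR Z b') \<in> cvs.span (flip ` B)"
    by (induction rule: cvs.span_induct_alt)
      (auto simp: cvs.span_zero intro!: cvs.span_add cvs.span_scale intro: cvs.span_base)
  then show "piR Z b \<in> cvs.span (flip ` B)"
    using b' Z flip_commute_generator by simp
qed

text \<open>From degree two on these generators act by scalars, so a subspace of \<open>W N\<close>
  is a subrepresentation as soon as \<open>tD\<close> preserves it.\<close>

lemma piR_homogeneous_in_span:
  assumes "f \<in> W N" "N \<ge> 2" "Z \<in> {tA, tB, tE, tK}"
  shows "piR Z f \<in> cvs.span {f}"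
proof -
  have "c *\<^sub>C f \<in> cvs.span {f}" for c by (intro cvs.span_scale cvs.span_base) simp
  then show ?thesis using assms piR_W[OF assms(1)] by (auto simp: cvs.span_zero)
qed

lemma subrep_W_ad:
  assumes "N \<ge> 2"
  shows "subrep s14 (W_ad N)"
  unfolding W_ad_def
proof (rule subrep_span_s14I)
  let ?M = "{Sa ^ k * Sd ^ l | k l. k + l = N}"
  fix Z b assume Z: "Z \<in> {tA, tB, tD, tE, tK}" and b: "b \<in> ?M"
  then obtain k l where kl: "b = Sa ^ k * Sd ^ l" "k + l = N" by blast
  \<comment> \<open>The alternative c = 0 covers the monomials whose truncated exponents have the
    wrong degree.\<close>
  have mon: "c *\<^sub>C (Sa ^ k' * Sd ^ l') \<in> cvs.span ?M" if "k' + l' = N \<or> c = 0" for c k' l'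
  proof (cases "c = 0")
    case False
    with that show ?thesis by (intro cvs.span_scale cvs.span_base) blast
  qed (simp add: cvs.span_zero)
  show "piR Z b \<in> cvs.span ?M"
  proof (cases "Z = tD")
    case True
    then show ?thesis unfolding kl True piR_tD_monomial
      by (intro cvs.span_scale cvs.span_diff mon) (use kl in auto)
  next
    case False
    have "b \<in> W N" using b unfolding W_def by (auto intro!: cvs.span_base)
    with False Z assms have "piR Z b \<in> cvs.span {b}" by (intro piR_homogeneous_in_span) auto
    then show ?thesis using b cvs.span_mono[of "{b}" ?M] by blast
  qed
qed

lemma uminus_power_scaleC: "(- x) ^ l = (-1) ^ l *\<^sub>C x ^ l" for x :: S14
  by (induction l) (simp_all add: scaleC_one mult_scaleC_right)

text \<open>\<open>flip\<close> takes the monomials in a, d to those in b, c up to the sign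
  \<open>(-1) ^ l\<close>, which the span does not see.\<close>

lemma W_bc_eq_span_flip: "W_bc N = cvs.span (flip ` {Sa ^ k * Sd ^ l | k l. k + l = N})"
proof -
  have flip: "flip (Sa ^ k * Sd ^ l) = (-1) ^ l *\<^sub>C (Sb ^ k * Sc ^ l)" for k l
    by (simp add: S14_hom_power respects_relators uminus_power_scaleC mult_scaleC_right)
  have bc: "Sb ^ k * Sc ^ l = (-1) ^ l *\<^sub>C flip (Sa ^ k * Sd ^ l)" for k l
    by (simp only: flip scaleC_scaleC) (simp add: scaleC_one flip: power_mult_distrib)
  have "Sb ^ k * Sc ^ l \<in> cvs.span (flip ` {Sa ^ k * Sd ^ l | k l. k + l = N})"
    if "k + l = N" for k l
    using that by (subst bc) (intro cvs.span_scale cvs.span_base imageI; blast)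
  moreover have "flip (Sa ^ k * Sd ^ l) \<in> W_bc (k + l)" for k l
    unfolding flip W_bc_def by (intro cvs.span_scale cvs.span_base) blast
  ultimately show ?thesis
    unfolding W_bc_def
    by (intro antisym cvs.span_minimal) (auto simp del: flip_hom)
qed

lemma subrep_W_bc: "N \<ge> 2 \<Longrightarrow> subrep s14 (W_bc N)"
  unfolding W_bc_eq_span_flip by (rule subrep_span_flip) (fold W_ad_def, rule subrep_W_ad)

lemma isomorphic_W_ad_W_bc: "N \<ge> 2 \<Longrightarrow> isomorphic_reps s14_ABD (W_ad N) (W_bc N)"
  unfolding W_bc_eq_span_flip W_ad_def
  by (intro isomorphic_reps_flip s14_ABD_subset)
    (use subrep_W_ad subrep_W_bc in \<open>auto simp: W_bc_eq_span_flip W_ad_def\<close>)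

lemma W_direct_sum_ad_bc:
  assumes "N \<ge> 2"
  shows "rep_direct_sum s14 {1, 2::nat} (\<lambda>i. if i = 1 then W_ad N else W_bc N) (W N)"
proof -
  let ?B = "\<lambda>i::nat. if i = 1 then {Sa ^ k * Sd ^ l | k l. k + l = N}
    else {Sb ^ k * Sc ^ l | k l. k + l = N}"
  have zero: "(0::S14) ^ k * 0 ^ l = 0" if "k + l \<ge> 1" for k l
    using that by (cases k; cases l) simp_all
  have "rep_direct_sum s14 {1, 2::nat} (\<lambda>i. cvs.span (?B i)) (W N)"
  proof (rule rep_direct_sum_eigenspaces
      [where T = "S14_hom proj_gen" and \<mu> = "\<lambda>i. if i = 1 then 1 else 0"])
    show "subrep s14 (cvs.span (?B i))" if "i \<in> {1, 2}" for i
      using subrep_W_ad[OF assms] subrep_W_bc[OF assms] by (simp add: W_ad_def W_bc_def)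
    show "S14_hom proj_gen b = (if i = 1 then 1 else 0) *\<^sub>C b"
      if "i \<in> {1, 2}" "b \<in> ?B i" for i b
      using that assms
      by (auto simp: S14_hom respects_relators S14_hom_power scaleC_one zero
          split: if_splits)
  qed (auto simp: W_def S14_hom respects_relators inj_on_def Un_commute)
  moreover have "(\<lambda>i. cvs.span (?B i)) = (\<lambda>i::nat. if i = 1 then W_ad N else W_bc N)"
    by (rule ext) (simp add: W_ad_def W_bc_def)
  ultimately show ?thesis by simp
qed

section \<open>Degree one\<close>

text \<open>As \<open>tD\<close> has the eigenvalues 1 and -1, adding \<open>piR tD f\<close> to f
  or subtracting it isolates the two components of a nonzero f. One of them puts \<open>v0\<close>
  or \<open>v1\<close> into the subrepresentation, and \<open>tB\<close> carries it to the
  other.\<close>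

lemma irreducible_repI:
  assumes sub: "subrep \<A> (cvs.span {v0, v1})" and nz: "v0 \<noteq> 0" and mem: "tB \<in> \<A>" "tD \<in> \<A>"
    and v: "piR tB v0 = v1" "piR tB v1 = v0" "piR tD v0 = v0" "piR tD v1 = - v1"
  shows "irreducible_rep \<A> (cvs.span {v0, v1})"
proof -
  have "U = cvs.span {v0, v1}"
    if U: "subrep \<A> U" "U \<subseteq> cvs.span {v0, v1}" and "U \<noteq> {0}" for U
  proof -
    have subsp: "cvs.subspace U" and inv: "f \<in> U \<Longrightarrow> piR tB f \<in> U" "f \<in> U \<Longrightarrow> piR tD f \<in> U" for f
      using U(1) mem by (auto simp: subrep_def)
    obtain f where f: "f \<in> U" "f \<noteq> 0" using \<open>U \<noteq> {0}\<close> cvs.subspace_0[OF subsp] by blast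
    then have "f \<in> cvs.span {v0, v1}" using U(2) by blast
    then obtain p where "f - p *\<^sub>C v0 \<in> cvs.span {v1}"
      unfolding cvs.span_insert[of v0] by blast
    then obtain q where "f - p *\<^sub>C v0 = q *\<^sub>C v1" unfolding cvs.span_singleton by blast
    then have pq: "f = p *\<^sub>C v0 + q *\<^sub>C v1" by (simp add: diff_eq_eq add.commute)
    have Df: "piR tD f = p *\<^sub>C v0 - q *\<^sub>C v1"
      by (simp add: pq clinear_add[OF clinear_piR] clinear_scale[OF clinear_piR] tD_basis(1) v(3,4))
    have "f + piR tD f = (2 * p) *\<^sub>C v0" "f - piR tD f = (2 * q) *\<^sub>C v1"
      unfolding Df unfolding mult_2 scaleC_add_left pq by (simp_all add: algebra_simps)
    then have mems: "(2 * p) *\<^sub>C v0 \<in> U" "(2 * q) *\<^sub>C v1 \<in> U"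
      using f inv cvs.subspace_add[OF subsp, of f "piR tD f"]
        cvs.subspace_diff[OF subsp, of f "piR tD f"] by auto
    have "v0 \<in> U \<or> v1 \<in> U"
    proof (cases "p = 0")
      case True
      with f pq have "q \<noteq> 0" by auto
      with cvs.subspace_scale[OF subsp mems(2), of "1 / (2 * q)"]
      show ?thesis by (simp add: scaleC_scaleC scaleC_one)
    next
      case False
      with cvs.subspace_scale[OF subsp mems(1), of "1 / (2 * p)"]
      show ?thesis by (simp add: scaleC_scaleC scaleC_one)
    qed
    then have "v0 \<in> U" "v1 \<in> U" using inv(1) v by metis+
    then have "cvs.span {v0, v1} \<subseteq> U" by (intro cvs.span_minimal subsp) auto
    with U(2) show ?thesis by blast
  qed
  moreover have "v0 \<in> cvs.span {v0, v1}" by (intro cvs.span_base) simp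
  with nz have "cvs.span {v0, v1} \<noteq> {0}" by blast
  ultimately show ?thesis using sub by (auto simp: irreducible_rep_def)
qed

lemma coord_gens:
  "coord_ad 1 0 Sa = 1" "coord_ad 1 0 Sd = 0" "coord_ad 1 0 Sb = 0" "coord_ad 1 0 Sc = 0"
  "coord_bc 1 0 Sa = 0" "coord_bc 1 0 Sd = 0" "coord_bc 1 0 Sb = 1" "coord_bc 1 0 Sc = 0"
  using coord_ad(2)[of 1 0 1 0] coord_ad(2)[of 1 0 0 1] coord_ad(3)[of 1 0 1 0]
    coord_ad(3)[of 1 0 0 1] coord_bc(2)[of 1 0 1 0] coord_bc(2)[of 1 0 0 1]
    coord_bc(3)[of 1 0 1 0] coord_bc(3)[of 1 0 0 1] by simp_all

lemmas piR_lin = clinear_functionals[THEN clinear_piR, THEN clinear_add]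
  clinear_functionals[THEN clinear_piR, THEN clinear_diff]
  clinear_functionals[THEN clinear_piR, THEN clinear_neg]

lemma degree_one_action:
  "piR tB (Sa + Sd) = Sb + Sc" "piR tB (Sb + Sc) = Sa + Sd"
  "piR tB (Sb - Sc) = Sa - Sd" "piR tB (Sa - Sd) = Sb - Sc"
  "piR tD (Sa + Sd) = Sa + Sd" "piR tD (Sb + Sc) = - (Sb + Sc)"
  "piR tD (Sb - Sc) = Sb - Sc" "piR tD (Sa - Sd) = - (Sa - Sd)"
  by (simp_all add: piR_lin piR_gen add.commute)

lemma has_basis_V1: "has_basis (cvs.span {Sa + Sd, Sb + Sc}) {0, 1::nat}
    (\<lambda>i. if i = 0 then Sa + Sd else Sb + Sc)"
  by (rule has_basisI_functionals[where u = "\<lambda>i. if i = 0 then coord_ad 1 0 else coord_bc 1 0"])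
    (auto simp: coord_ad(1) coord_bc(1) clinear_simps[OF coord_ad(1)]
      clinear_simps[OF coord_bc(1)] coord_gens[simplified] insert_commute)

lemma has_basis_V2: "has_basis (cvs.span {Sb - Sc, Sa - Sd}) {0, 1::nat}
    (\<lambda>i. if i = 0 then Sb - Sc else Sa - Sd)"
  by (rule has_basisI_functionals[where u = "\<lambda>i. if i = 0 then coord_bc 1 0 else coord_ad 1 0"])
    (auto simp: coord_ad(1) coord_bc(1) clinear_simps[OF coord_ad(1)]
      clinear_simps[OF coord_bc(1)] coord_gens[simplified] insert_commute)

lemma dim_V1: "cvs.dim (cvs.span {Sa + Sd, Sb + Sc}) = 2"
  and dim_V2: "cvs.dim (cvs.span {Sb - Sc, Sa - Sd}) = 2"
  using has_basis_dim[OF has_basis_V1] has_basis_dim[OF has_basis_V2] by simp_all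

lemma V2_eq_span_flip: "{Sb - Sc, Sa - Sd} = flip ` {Sa + Sd, Sb + Sc}"
  by (simp add: insert_commute)

lemma subrep_V1: "subrep s14 (cvs.span {Sa + Sd, Sb + Sc})"
proof (rule subrep_span_s14I)
  fix Z b assume "Z \<in> {tA, tB, tD, tE, tK}" "b \<in> {Sa + Sd, Sb + Sc}"
  then have "piR Z b \<in> {b, - b, 0, Sa + Sd, Sb + Sc}"
    by (auto simp: degree_one_action) (auto simp: piR_lin piR_gen)
  moreover have "b \<in> cvs.span {Sa + Sd, Sb + Sc}"
    using \<open>b \<in> _\<close> by (rule cvs.span_base)
  moreover from cvs.span_neg[OF this] have "- b \<in> cvs.span {Sa + Sd, Sb + Sc}" .
  moreover have "0 \<in> cvs.span {Sa + Sd, Sb + Sc}" "Sa + Sd \<in> cvs.span {Sa + Sd, Sb + Sc}"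
    "Sb + Sc \<in> cvs.span {Sa + Sd, Sb + Sc}"
    by (simp_all add: cvs.span_zero cvs.span_base)
  ultimately show "piR Z b \<in> cvs.span {Sa + Sd, Sb + Sc}" by (elim insertE) simp_all
qed

lemma subrep_V2: "subrep s14 (cvs.span {Sb - Sc, Sa - Sd})"
  unfolding V2_eq_span_flip by (rule subrep_span_flip[OF subrep_V1])

lemma W_1: "W 1 = cvs.span {Sa, Sb, Sc, Sd}"
proof -
  have "{w. length w = 1} = range (\<lambda>g. [g])" by (auto simp: length_Suc_conv)
  then have "word ` {w. length w = 1} = word ` range (\<lambda>g. [g])" by (rule arg_cong)
  also have "\<dots> = range S14_of" by (simp add: image_image word_def)
  also have "UNIV = {Ga, Gb, Gc, Gd}" using S14_gen.exhaust by auto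
  finally show ?thesis by (simp add: W_eq_span_words)
qed

lemma W_1_direct_sum:
  "rep_direct_sum s14 {1, 2::nat}
    (\<lambda>i. if i = 1 then cvs.span {Sa + Sd, Sb + Sc} else cvs.span {Sb - Sc, Sa - Sd}) (W 1)"
proof -
  let ?B = "\<lambda>i::nat. if i = 1 then {Sa + Sd, Sb + Sc} else {Sb - Sc, Sa - Sd}"
  let ?V = "{Sa + Sd, Sb + Sc} \<union> {Sb - Sc, Sa - Sd}"
  have half: "f = (1/2) *\<^sub>C ((f + g) + (f - g))" "g = (1/2) *\<^sub>C ((f + g) - (f - g))" for f g :: S14
    by (simp_all add: scaleC_one flip: scaleC_add_right scaleC_add_left)
      (simp_all add: scaleC_add_right scaleC_one flip: scaleC_add_left)
  have V: "{Sa, Sb, Sc, Sd} \<subseteq> cvs.span ?V"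
  proof -
    have "f \<in> cvs.span ?V \<and> g \<in> cvs.span ?V"
      if "f + g \<in> cvs.span ?V" "f - g \<in> cvs.span ?V" for f g
      using cvs.span_scale[OF cvs.span_add[OF that], of "1/2"]
        cvs.span_scale[OF cvs.span_diff[OF that], of "1/2"] by (simp only: half[symmetric])
    from this[of Sa Sd] this[of Sb Sc] show ?thesis by (auto intro: cvs.span_base)
  qed
  have W: "W 1 = cvs.span ?V"
    unfolding W_1
    by (intro antisym cvs.span_minimal V cvs.subspace_span)
      (auto intro!: cvs.span_add cvs.span_diff intro: cvs.span_base)
  have "rep_direct_sum s14 {1, 2::nat} (\<lambda>i. cvs.span (?B i)) (W 1)"
  proof (rule rep_direct_sum_eigenspaces
      [where T = "S14_hom swap_gen" and \<mu> = "\<lambda>i. if i = 1 then 1 else - 1"])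
    show "subrep s14 (cvs.span (?B i))" if "i \<in> {1, 2}" for i
      using subrep_V1 subrep_V2 by simp
    show "S14_hom swap_gen b = (if i = 1 then 1 else - 1) *\<^sub>C b"
      if "i \<in> {1, 2}" "b \<in> ?B i" for i b
      using that
      by (auto simp: S14_hom respects_relators clinear_simps[OF S14_hom(1)] scaleC_one
          split: if_splits)
    have "(\<Union>i\<in>{1, 2}. ?B i) = ?V" by auto
    then show "W 1 = cvs.span (\<Union>i\<in>{1, 2}. ?B i)" by (simp only: W)
  qed (simp_all add: S14_hom respects_relators inj_on_def)
  moreover have "(\<lambda>i. cvs.span (?B i)) =
    (\<lambda>i::nat. if i = 1 then cvs.span {Sa + Sd, Sb + Sc} else cvs.span {Sb - Sc, Sa - Sd})"
    by (rule ext) simp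
  ultimately show ?thesis by simp
qed

lemma W_1_squares:
  assumes "f \<in> W 1"
  shows "piR (conv tB tB) f = f" "piR (conv tD tD) f = f"
proof -
  have id: "clinear (\<lambda>f::S14. f)" by (rule clinearI) simp_all
  have "clinear (\<lambda>f. piR tB (piR tB f))" "clinear (\<lambda>f. piR tD (piR tD f))"
    by (rule clinearI; simp add: clinear_simps[OF clinear_piR] clinear_functionals)+
  note lin = this[THEN clinear_eq_on_span, OF id _ assms[unfolded W_1]]
  have "piR tB (piR tB f) = f" "piR tD (piR tD f) = f"
    by (rule lin; auto simp: piR_lin piR_gen)+
  then show "piR (conv tB tB) f = f" "piR (conv tD tD) f = f"
    by (simp_all add: piR_conv clinear_functionals)
qed

section \<open>The coefficient recursions\<close>

text \<open>This is L on coefficient sequences. Working with sequences lets the same operator act on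
  the coefficients of \<open>eigen_poly\<close> and on arbitrary solutions of the recursions. The
  factor N - l + 1 is formed in the complex numbers, hence never truncated.\<close>

definition rec_op :: "nat \<Rightarrow> (nat \<Rightarrow> complex) \<Rightarrow> nat \<Rightarrow> complex" where
  "rec_op N x l = of_nat (l + 1) * x (l + 1) -
    (if l = 0 then 0 else (of_nat N - of_nat l + 1) * x (l - 1))"

definition poly_op :: "nat \<Rightarrow> complex poly \<Rightarrow> complex poly" where
  "poly_op N p = [:1, 0, 1:] * pderiv p - smult (of_nat N) ([:0, 1:] * p)"

lemma coeff_poly_op: "coeff (poly_op N p) l = rec_op N (coeff p) l"
proof (cases l)
  case (Suc m)
  then show ?thesis
    by (cases m) (simp_all add: poly_op_def rec_op_def coeff_pderiv algebra_simps)
qed (simp add: poly_op_def rec_op_def coeff_pderiv)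

lemma poly_op_linear:
  "poly_op N (p + q) = poly_op N p + poly_op N q"
  "poly_op N (p - q) = poly_op N p - poly_op N q"
  "poly_op N (smult c p) = smult c (poly_op N p)"
  by (simp_all add: poly_op_def pderiv_add pderiv_diff pderiv_smult algebra_simps smult_diff_right
      smult_add_right)

lemma pderiv_linear_power:
  fixes c :: complex
  shows "pderiv ([:1, c:] ^ k) * [:1, c:] = smult (of_nat k * c) ([:1, c:] ^ k)"
proof (cases k)
  case (Suc m)
  have "pderiv [:1, c:] = smult c 1" by (simp add: pderiv_pCons)
  then show ?thesis
    unfolding Suc pderiv_power_Suc
    by (simp only: mult_smult_left mult_smult_right mult_1_right smult_smult power_Suc2
        mult.commute[of c])
qed simp

text \<open>In the variable $t = d/a$, the eigenfunctions of \<open>poly_op\<close> are $(1 + it)^j (1 - it)^k$.\<close>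

definition eigen_poly :: "nat \<Rightarrow> nat \<Rightarrow> complex poly" where
  "eigen_poly j k = [:1, \<i>:] ^ j * [:1, - \<i>:] ^ k"

text \<open>As 1 + t^2 = (1 + it)(1 - it), multiplying the logarithmic derivative ij/(1 + it) -
  ik/(1 - it) by 1 + t^2 gives ij(1 - it) - ik(1 + it) = i(j - k) + (j + k)t, and the last summand
  is what \<open>poly_op (j + k)\<close> subtracts.\<close>

lemma poly_op_eigen_poly:
  "poly_op (j + k) (eigen_poly j k) = smult (\<i> * (of_nat j - of_nat k)) (eigen_poly j k)"
proof -
  let ?P = "[:1, \<i>:]" and ?Q = "[:1, - \<i>:]"
  have "[:1, 0, 1:] = ?P * ?Q" by simp
  then have "[:1, 0, 1:] * pderiv (eigen_poly j k) =
      (pderiv (?P ^ j) * ?P) * ?Q ^ k * ?Q + ?P ^ j * (pderiv (?Q ^ k) * ?Q) * ?P"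
    by (simp only: eigen_poly_def pderiv_mult algebra_simps)
  also have "\<dots> = eigen_poly j k * (smult (of_nat j * \<i>) ?Q + smult (of_nat k * - \<i>) ?P)"
  proof -
    have "smult a A * B * Q + A * smult b B * P = A * B * (smult a Q + smult b P)"
      for a b and A B P Q :: "complex poly"
      by (simp add: algebra_simps)
    then show ?thesis unfolding pderiv_linear_power eigen_poly_def .
  qed
  finally have "poly_op (j + k) (eigen_poly j k) = eigen_poly j k *
      (smult (of_nat j * \<i>) ?Q + smult (of_nat k * - \<i>) ?P - smult (of_nat (j + k)) [:0, 1:])"
    unfolding poly_op_def by (simp only: right_diff_distrib mult_smult_right mult.commute)
  also have "smult (of_nat j * \<i>) ?Q + smult (of_nat k * - \<i>) ?P - smult (of_nat (j + k)) [:0, 1:]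
      = [:\<i> * (of_nat j - of_nat k):]"
    by (simp add: algebra_simps)
  finally show ?thesis by simp
qed

lemma degree_eigen_poly: "degree (eigen_poly j k) \<le> j + k"
  unfolding eigen_poly_def
  by (rule order.trans[OF degree_mult_le add_mono]; rule order.trans[OF degree_power_le]; simp)

lemma coeff_0_eigen_poly: "coeff (eigen_poly j k) 0 = 1"
  by (simp add: eigen_poly_def coeff_mult_0 coeff_0_power)

text \<open>Replacing t by -t exchanges \<open>eigen_poly j k\<close> and
  \<open>eigen_poly k j\<close> and negates the eigenvalue; in the half-sum and in -i times the
  half-difference the factor i cancels. The conclusion is silent on parity: \<open>rec_op\<close>
  couples only indices of opposite parity, and the existence proofs read x at even and y at odd
  indices.\<close>

lemma recursion_solution:
  fixes j k :: nat
  defines "\<tau> \<equiv> of_nat j - of_nat k"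
  obtains x y :: "nat \<Rightarrow> complex" where "x 0 = 1" "\<And>l. l > j + k \<Longrightarrow> x l = 0"
    "\<And>l. l > j + k \<Longrightarrow> y l = 0" "\<And>l. rec_op (j + k) x l = - \<tau> * y l"
    "\<And>l. rec_op (j + k) y l = \<tau> * x l"
proof
  let ?e = "smult (1/2) (eigen_poly j k + eigen_poly k j)"
  let ?o = "smult (- \<i> / 2) (eigen_poly j k - eigen_poly k j)"
  note op = poly_op_eigen_poly[of j k] poly_op_eigen_poly[of k j, unfolded add.commute[of k j]]
  have "poly_op (j + k) ?e = smult (- \<tau>) ?o" "poly_op (j + k) ?o = smult \<tau> ?e"
    unfolding poly_op_linear op \<tau>_def
    by (rule poly_eqI; simp add: field_simps)+
  from this[THEN arg_cong[of _ _ coeff], THEN fun_cong]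
  show "rec_op (j + k) (coeff ?e) l = - \<tau> * coeff ?o l"
    "rec_op (j + k) (coeff ?o) l = \<tau> * coeff ?e l" for l
    by (simp_all only: coeff_poly_op coeff_smult)
  show "coeff ?e 0 = 1" by (simp add: coeff_0_eigen_poly)
  have "coeff (eigen_poly j k) l = 0" "coeff (eigen_poly k j) l = 0" if "l > j + k" for l
    using degree_eigen_poly[of j k] degree_eigen_poly[of k j] that by (simp_all add: coeff_eq_0)
  then show "coeff ?e l = 0" "coeff ?o l = 0" if "l > j + k" for l
    using that by simp_all
qed

section \<open>Existence and uniqueness of the coefficients\<close>

lemma even_coeffs_exist:
  assumes "even \<tau>" "2 \<le> \<tau>" "\<tau> \<le> 2 * n"
  shows "\<exists>c. even_coeffs n \<tau> (fst c) (snd c)"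
proof -
  from assms obtain m where m: "\<tau> = 2 * m" "1 \<le> m" "m \<le> n" by (auto elim!: evenE)
  \<comment> \<open>Solving j + k = 2n and j - k = \<tau> = 2m gives j = n + m and k = n -
    m.\<close>
  have N: "(n + m) + (n - m) = 2 * n" and
    t: "of_nat (n + m) - of_nat (n - m) = (of_nat \<tau> :: complex)"
    using m by (simp_all add: of_nat_diff)
  from recursion_solution[of "n + m" "n - m", unfolded N t]
  obtain x y :: "nat \<Rightarrow> complex" where x0: "x 0 = 1"
    and out: "\<And>l. l > 2 * n \<Longrightarrow> x l = 0" "\<And>l. l > 2 * n \<Longrightarrow> y l = 0"
    and rx: "\<And>l. rec_op (2 * n) x l = - of_nat \<tau> * y l"
    and ry: "\<And>l. rec_op (2 * n) y l = of_nat \<tau> * x l" by blast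
  define \<alpha> :: "int \<Rightarrow> complex" where "\<alpha> k = (if 0 \<le> k \<and> k \<le> int n then x (nat (2 * k)) else 0)" for k
  define \<beta> :: "int \<Rightarrow> complex" where
    "\<beta> k = (if 0 \<le> k \<and> k < int n then y (nat (2 * k + 1)) / of_nat \<tau> else 0)" for k
  have \<tau>0: "of_nat \<tau> \<noteq> (0::complex)" using assms by simp
  have a: "\<alpha> (int k) = x (2 * k)" if "k \<le> n" for k
    using that by (simp add: \<alpha>_def nat_mult_distrib)
  \<comment> \<open>At k = n the left side is zero by the convention for \<beta>, the right side
    because 2n + 1 exceeds the degree.\<close>
  have b: "\<tau> * \<beta> (int k) = y (2 * k + 1)" if "k \<le> n" for k
    using that \<tau>0 out(2)[of "2 * k + 1"]
    by (cases "k = n") (simp_all add: \<beta>_def nat_add_distrib nat_mult_distrib)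
  have eq1: "of_nat \<tau> ^ 2 * \<beta> (int k) = of_int (2 * (int n - int k)) * \<alpha> (int k)
      - of_int (2 * (int k + 1)) * \<alpha> (int k + 1)" if "k < n" for k
  proof -
    have "of_nat \<tau> ^ 2 * \<beta> (int k) = - rec_op (2 * n) x (2 * k + 1)"
      using b[of k] that by (simp add: rx power2_eq_square)
    also have "\<dots> = of_int (2 * (int n - int k)) * \<alpha> (int k)
      - of_int (2 * (int k + 1)) * \<alpha> (int k + 1)"
      using a[of k] a[of "Suc k"] that by (simp add: rec_op_def algebra_simps)
    finally show ?thesis .
  qed
  have eq2: "\<alpha> (int k) = of_int (2 * int k + 1) * \<beta> (int k)
      - of_int (2 * int n - 2 * int k + 1) * \<beta> (int k - 1)" if "k \<le> n" for k
  proof -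
    have "of_nat \<tau> * \<alpha> (int k) = rec_op (2 * n) y (2 * k)" using a that by (simp add: ry)
    also have "\<dots> = of_nat \<tau> * (of_int (2 * int k + 1) * \<beta> (int k)
      - of_int (2 * int n - 2 * int k + 1) * \<beta> (int k - 1))"
    proof (cases k)
      case 0
      then show ?thesis using b[of 0] by (simp add: rec_op_def \<beta>_def)
    next
      case (Suc k')
      then show ?thesis using b[of k, symmetric] b[of k', symmetric] that
        by (simp add: rec_op_def algebra_simps)
    qed
    finally show ?thesis using \<tau>0 by simp
  qed
  have "\<alpha> 0 = 1" using a[of 0] x0 by simp
  \<comment> \<open>The recursion itself normalises \<beta>: at k = 0 it reads \<alpha> 0 = \<beta>
    0, as \<beta> (-1) = 0.\<close>
  moreover from eq2[of 0] this have "\<beta> 0 = 1" by (simp add: \<beta>_def)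
  moreover have "\<forall>k\<in>{0..int n - 1}. of_nat \<tau> ^ 2 * \<beta> k =
      of_int (2 * (int n - k)) * \<alpha> k - of_int (2 * (k + 1)) * \<alpha> (k + 1)"
  proof
    fix k assume "k \<in> {0..int n - 1}"
    moreover from this obtain k' where "k = int k'" by (auto elim: nonneg_int_cases)
    ultimately show "of_nat \<tau> ^ 2 * \<beta> k =
      of_int (2 * (int n - k)) * \<alpha> k - of_int (2 * (k + 1)) * \<alpha> (k + 1)"
      using eq1[of k'] by simp
  qed
  moreover have "\<forall>k\<in>{0..int n}. \<alpha> k =
      of_int (2 * k + 1) * \<beta> k - of_int (2 * int n - 2 * k + 1) * \<beta> (k - 1)"
  proof
    fix k assume "k \<in> {0..int n}"
    moreover from this obtain k' where "k = int k'" by (auto elim: nonneg_int_cases)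
    ultimately show "\<alpha> k = of_int (2 * k + 1) * \<beta> k - of_int (2 * int n - 2 * k + 1) * \<beta> (k - 1)"
      using eq2[of k'] by simp
  qed
  ultimately have "even_coeffs n \<tau> \<alpha> \<beta>" by (simp add: even_coeffs_def \<alpha>_def \<beta>_def)
  then show ?thesis by (intro exI[of _ "(\<alpha>, \<beta>)"]) simp
qed

lemma odd_coeffs_exist:
  assumes "odd \<tau>" "\<tau> \<le> 2 * n + 1"
  shows "\<exists>c. odd_coeffs n \<tau> (fst c) (snd c)"
proof -
  from assms obtain m where m: "\<tau> = 2 * m + 1" "m \<le> n" by (auto elim!: oddE)
  have N: "(n + m + 1) + (n - m) = Suc (2 * n)" and
    t: "of_nat (n + m + 1) - of_nat (n - m) = (of_nat \<tau> :: complex)"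
    using m by (simp_all add: of_nat_diff)
  from recursion_solution[of "n + m + 1" "n - m", unfolded N t]
  obtain x y :: "nat \<Rightarrow> complex" where x0: "x 0 = 1"
    and out: "\<And>l. l > Suc (2 * n) \<Longrightarrow> x l = 0" "\<And>l. l > Suc (2 * n) \<Longrightarrow> y l = 0"
    and rx: "\<And>l. rec_op (Suc (2 * n)) x l = - of_nat \<tau> * y l"
    and ry: "\<And>l. rec_op (Suc (2 * n)) y l = of_nat \<tau> * x l" by blast
  define \<alpha> :: "int \<Rightarrow> complex" where "\<alpha> k = (if 0 \<le> k \<and> k \<le> int n then x (nat (2 * k)) else 0)" for k
  define \<beta> :: "int \<Rightarrow> complex" where
    "\<beta> k = (if 0 \<le> k \<and> k \<le> int n then y (nat (2 * k + 1)) / of_nat \<tau> else 0)" for k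
  have \<tau>0: "of_nat \<tau> \<noteq> (0::complex)" using m by (simp del: of_nat_add of_nat_mult of_nat_Suc)
  \<comment> \<open>Unlike in the even case, the recursion at k = n refers to \<alpha> (n + 1). It
    is zero by convention, and x (2n + 2) is zero because the degree is at most 2n + 1.\<close>
  have a: "\<alpha> (int k) = x (2 * k)" if "k \<le> n + 1" for k
    using that out(1)[of "2 * k"]
    by (cases "k = n + 1") (simp_all add: \<alpha>_def nat_mult_distrib)
  have b: "\<tau> * \<beta> (int k) = y (2 * k + 1)" if "k \<le> n" for k
    using that \<tau>0 by (simp add: \<beta>_def nat_add_distrib nat_mult_distrib)
  have eq1: "of_nat \<tau> ^ 2 * \<beta> (int k) = of_int (2 * int n - 2 * int k + 1) * \<alpha> (int k)
      - of_int (2 * (int k + 1)) * \<alpha> (int k + 1)" if "k \<le> n" for k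
  proof -
    have "of_nat \<tau> ^ 2 * \<beta> (int k) = - rec_op (Suc (2 * n)) x (2 * k + 1)"
      using b[of k] that by (simp add: rx power2_eq_square)
    also have "\<dots> = of_int (2 * int n - 2 * int k + 1) * \<alpha> (int k)
      - of_int (2 * (int k + 1)) * \<alpha> (int k + 1)"
      using a[of k] a[of "Suc k"] that by (simp add: rec_op_def algebra_simps)
    finally show ?thesis .
  qed
  have eq2: "\<alpha> (int k) = of_int (2 * int k + 1) * \<beta> (int k)
      - of_int (2 * (int n - int k + 1)) * \<beta> (int k - 1)" if "k \<le> n" for k
  proof -
    have "of_nat \<tau> * \<alpha> (int k) = rec_op (Suc (2 * n)) y (2 * k)" using a that by (simp add: ry)
    also have "\<dots> = of_nat \<tau> * (of_int (2 * int k + 1) * \<beta> (int k)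
      - of_int (2 * (int n - int k + 1)) * \<beta> (int k - 1))"
    proof (cases k)
      case 0
      then show ?thesis using b[of 0] by (simp add: rec_op_def \<beta>_def)
    next
      case (Suc k')
      then show ?thesis using b[of k, symmetric] b[of k', symmetric] that
        by (simp add: rec_op_def algebra_simps)
    qed
    finally show ?thesis using \<tau>0 by simp
  qed
  have "\<alpha> 0 = 1" using a[of 0] x0 by simp
  moreover from eq2[of 0] this have "\<beta> 0 = 1" by (simp add: \<beta>_def)
  moreover have "\<forall>k\<in>{0..int n}. of_nat \<tau> ^ 2 * \<beta> k =
      of_int (2 * int n - 2 * k + 1) * \<alpha> k - of_int (2 * (k + 1)) * \<alpha> (k + 1)"
  proof
    fix k assume "k \<in> {0..int n}"
    moreover from this obtain k' where "k = int k'" by (auto elim: nonneg_int_cases)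
    ultimately show "of_nat \<tau> ^ 2 * \<beta> k =
      of_int (2 * int n - 2 * k + 1) * \<alpha> k - of_int (2 * (k + 1)) * \<alpha> (k + 1)"
      using eq1[of k'] by simp
  qed
  moreover have "\<forall>k\<in>{0..int n}. \<alpha> k =
      of_int (2 * k + 1) * \<beta> k - of_int (2 * (int n - k + 1)) * \<beta> (k - 1)"
  proof
    fix k assume "k \<in> {0..int n}"
    moreover from this obtain k' where "k = int k'" by (auto elim: nonneg_int_cases)
    ultimately show "\<alpha> k = of_int (2 * k + 1) * \<beta> k - of_int (2 * (int n - k + 1)) * \<beta> (k - 1)"
      using eq2[of k'] by simp
  qed
  ultimately have "odd_coeffs n \<tau> \<alpha> \<beta>" by (simp add: odd_coeffs_def \<alpha>_def \<beta>_def)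
  then show ?thesis by (intro exI[of _ "(\<alpha>, \<beta>)"]) simp
qed

text \<open>The recursions determine the families alternately: the first at k yields \<alpha> (k +
  1), with the nonzero factor 2(k + 1), and the second at k + 1 then yields \<beta> (k + 1), with
  the nonzero factor 2k + 3. Outside the range both families vanish by definition, so they agree as
  functions on all integers.\<close>

lemma even_coeffs_unique:
  assumes c: "even_coeffs n \<tau> \<alpha> \<beta>" and c': "even_coeffs n \<tau> \<alpha>' \<beta>'"
  shows "\<alpha> = \<alpha>'" "\<beta> = \<beta>'"
proof -
  have nat: "\<alpha> (int k) = \<alpha>' (int k) \<and> \<beta> (int k) = \<beta>' (int k)" for k
  proof (induction k)
    case 0
    then show ?case using c c' by (simp add: even_coeffs_def)
  next
    case (Suc k)
    have a: "\<alpha> (int (Suc k)) = \<alpha>' (int (Suc k))"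
    proof (cases "Suc k \<le> n")
      case True
      then have k: "int k \<in> {0..int n - 1}" by simp
      have "of_int (2 * (int k + 1)) * \<alpha> (int k + 1) = of_int (2 * (int k + 1)) * \<alpha>' (int k + 1)"
        using c c' k Suc unfolding even_coeffs_def by (metis diff_eq_eq add_diff_cancel_left')
      then show ?thesis by (simp add: add.commute del: of_int_add of_int_mult)
    qed (use c c' in \<open>simp add: even_coeffs_def\<close>)
    have "\<beta> (int (Suc k)) = \<beta>' (int (Suc k))"
    proof (cases "Suc k \<le> n")
      case True
      then have k: "int (Suc k) \<in> {0..int n}" by simp
      have k': "int (Suc k) - 1 = int k" by simp
      have "of_int (2 * int (Suc k) + 1) * \<beta> (int (Suc k)) =
          of_int (2 * int (Suc k) + 1) * \<beta>' (int (Suc k))"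
        using c c' k Suc a unfolding even_coeffs_def by (metis diff_eq_eq k')
      then show ?thesis by (simp del: of_int_add of_int_mult)
    qed (use c c' in \<open>simp add: even_coeffs_def\<close>)
    with a show ?case by simp
  qed
  have "\<alpha> k = \<alpha>' k \<and> \<beta> k = \<beta>' k" for k
  proof (cases "k \<ge> 0")
    case True
    then show ?thesis using nat[of "nat k"] by simp
  qed (use c c' in \<open>simp add: even_coeffs_def\<close>)
  then show "\<alpha> = \<alpha>'" "\<beta> = \<beta>'" by auto
qed

lemma odd_coeffs_unique:
  assumes c: "odd_coeffs n \<tau> \<alpha> \<beta>" and c': "odd_coeffs n \<tau> \<alpha>' \<beta>'"
  shows "\<alpha> = \<alpha>'" "\<beta> = \<beta>'"
proof -
  have nat: "\<alpha> (int k) = \<alpha>' (int k) \<and> \<beta> (int k) = \<beta>' (int k)" for k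
  proof (induction k)
    case 0
    then show ?case using c c' by (simp add: odd_coeffs_def)
  next
    case (Suc k)
    have a: "\<alpha> (int (Suc k)) = \<alpha>' (int (Suc k))"
    proof (cases "Suc k \<le> n")
      case True
      then have k: "int k \<in> {0..int n}" by simp
      have "of_int (2 * (int k + 1)) * \<alpha> (int k + 1) = of_int (2 * (int k + 1)) * \<alpha>' (int k + 1)"
        using c c' k Suc unfolding odd_coeffs_def by (metis diff_eq_eq add_diff_cancel_left')
      then show ?thesis by (simp add: add.commute del: of_int_add of_int_mult)
    qed (use c c' in \<open>simp add: odd_coeffs_def\<close>)
    have "\<beta> (int (Suc k)) = \<beta>' (int (Suc k))"
    proof (cases "Suc k \<le> n")
      case True
      then have k: "int (Suc k) \<in> {0..int n}" by simp
      have k': "int (Suc k) - 1 = int k" by simp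
      have "of_int (2 * int (Suc k) + 1) * \<beta> (int (Suc k)) =
          of_int (2 * int (Suc k) + 1) * \<beta>' (int (Suc k))"
        using c c' k Suc a unfolding odd_coeffs_def by (metis diff_eq_eq k')
      then show ?thesis by (simp del: of_int_add of_int_mult)
    qed (use c c' in \<open>simp add: odd_coeffs_def\<close>)
    with a show ?case by simp
  qed
  have "\<alpha> k = \<alpha>' k \<and> \<beta> k = \<beta>' k" for k
  proof (cases "k \<ge> 0")
    case True
    then show ?thesis using nat[of "nat k"] by simp
  qed (use c c' in \<open>simp add: odd_coeffs_def\<close>)
  then show "\<alpha> = \<alpha>'" "\<beta> = \<beta>'" by auto
qed

section \<open>Irreducibility and isomorphism in degree one\<close>

lemma generators_in_s14_ABD: "tB \<in> s14_ABD" "tD \<in> s14_ABD"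
  by (auto simp: s14_ABD_def intro: functional_algebra.gen)

lemma has_basis_neq_0: "has_basis V I v \<Longrightarrow> i \<in> I \<Longrightarrow> v i \<noteq> 0"
  unfolding has_basis_def using cvs.dependent_zero by (metis imageI)

lemma degree_one_vectors_neq_0: "Sa + Sd \<noteq> 0" "Sb - Sc \<noteq> 0"
  using has_basis_neq_0[OF has_basis_V1, of 0] has_basis_neq_0[OF has_basis_V2, of 0] by simp_all

lemma irreducible_V1:
  assumes "\<A> \<in> {s14, s14_ABD}"
  shows "irreducible_rep \<A> (cvs.span {Sa + Sd, Sb + Sc})"
  using assms s14_ABD_subset generators_in_s14_ABD
  by (intro irreducible_repI subrep_mono[OF subrep_V1] degree_one_action degree_one_vectors_neq_0)
    auto

lemma irreducible_V2:
  assumes "\<A> \<in> {s14, s14_ABD}"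
  shows "irreducible_rep \<A> (cvs.span {Sb - Sc, Sa - Sd})"
  using assms s14_ABD_subset generators_in_s14_ABD
  by (intro irreducible_repI subrep_mono[OF subrep_V2] degree_one_action degree_one_vectors_neq_0)
    auto

lemma isomorphic_V1_V2:
  assumes "\<A> \<in> {s14, s14_ABD}"
  shows "isomorphic_reps \<A> (cvs.span {Sa + Sd, Sb + Sc}) (cvs.span {Sb - Sc, Sa - Sd})"
  unfolding V2_eq_span_flip
  using assms s14_ABD_subset
  by (intro isomorphic_reps_flip subrep_V1 subrep_V2[unfolded V2_eq_span_flip]) auto

section \<open>Eigenvectors\<close>

text \<open>Stands for a^N p(d/a), where p has the coefficients x; only x 0, ..., x N enter.\<close>

definition ad_vec :: "nat \<Rightarrow> (nat \<Rightarrow> complex) \<Rightarrow> S14" where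
  "ad_vec N x = (\<Sum>l\<le>N. x l *\<^sub>C (Sa ^ (N - l) * Sd ^ l))"

lemma ad_vec_cong: "(\<And>l. l \<le> N \<Longrightarrow> x l = y l) \<Longrightarrow> ad_vec N x = ad_vec N y"
  by (simp add: ad_vec_def)

lemma ad_vec_scale: "c *\<^sub>C ad_vec N x = ad_vec N (\<lambda>l. c * x l)"
  by (simp add: ad_vec_def cvs.scale_sum_right scaleC_scaleC)

lemma ad_vec_in_W_ad: "ad_vec N x \<in> W_ad N"
  unfolding ad_vec_def W_ad_def
  by (intro cvs.span_sum cvs.span_scale cvs.span_base) force

lemma ad_vec_nonzero:
  assumes "x 0 \<noteq> 0"
  shows "ad_vec N x \<noteq> 0"
proof
  assume "ad_vec N x = 0"
  then have "0 = coord_ad N 0 (ad_vec N x)" by (simp add: clinear_zero coord_ad)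
  also have "\<dots> = (\<Sum>l\<le>N. if l = 0 then x 0 else 0)"
    unfolding ad_vec_def
    by (subst clinear_sum[OF coord_ad(1)], rule sum.cong)
      (auto simp: clinear_scale[OF coord_ad(1)] coord_ad(2) scaleC_complex_def)
  finally show False using assms by simp
qed

text \<open>Each term moves by one index, so its sign is opposite to \<open>(-1) ^ l\<close> at the
  target; hence the term lowering the exponent of d is the positive one in \<open>rec_op\<close>.
  The hypothesis is there because \<open>rec_op N x N\<close> contains \<open>x (Suc N)\<close>,
  which the vector does not.\<close>

lemma piR_tD_ad_vec:
  assumes "x (Suc N) = 0"
  shows "piR tD (ad_vec N x) = ad_vec N (\<lambda>l. (-1) ^ l * rec_op N x l)"
proof -
  define m where "m l = Sa ^ (N - l) * Sd ^ l" for l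
  define F where "F l = ((-1) ^ l * of_nat (N - l) * x l) *\<^sub>C m (Suc l)" for l
  define G where "G l = ((-1) ^ l * of_nat l * x l) *\<^sub>C m (l - 1)" for l
  have "piR tD (ad_vec N x) = (\<Sum>l\<le>N. x l *\<^sub>C piR tD (Sa ^ (N - l) * Sd ^ l))"
    unfolding ad_vec_def
    by (simp add: clinear_sum[OF clinear_piR] clinear_scale[OF clinear_piR] tD_basis(1))
  also have "\<dots> = (\<Sum>l\<le>N. F l - G l)"
  proof (rule sum.cong)
    fix l assume "l \<in> {..N}"
    \<comment> \<open>At l = 0 truncation makes the two monomials differ, but the coefficient l
      removes the term.\<close>
    then have "l = 0 \<or> Sa ^ (N - l + 1) * Sd ^ (l - 1) = m (l - 1)"
      by (cases l) (auto simp: m_def Suc_diff_Suc)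
    then have eq: "of_nat l *\<^sub>C (Sa ^ (N - l + 1) * Sd ^ (l - 1)) = of_nat l *\<^sub>C m (l - 1)"
      by auto
    show "x l *\<^sub>C piR tD (Sa ^ (N - l) * Sd ^ l) = F l - G l"
      unfolding piR_tD_monomial eq F_def G_def
      by (simp add: m_def cvs.scale_right_diff_distrib scaleC_scaleC mult_ac)
  qed simp
  also have "\<dots> = (\<Sum>l\<le>N. F l) - (\<Sum>l\<le>N. G l)" by (rule sum_subtractf)
  \<comment> \<open>Shifting the indices loses nothing at the ends: F N = 0 because of the factor N
    - N, and for the other sum G 0 = 0 and, by hypothesis, G (N + 1) = 0.\<close>
  also have "(\<Sum>l\<le>N. F l) = (\<Sum>l\<le>N. if l = 0 then 0 else F (l - 1))"
    by (subst sum.atMost_shift) (simp add: F_def flip: lessThan_Suc_atMost)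
  also have "(\<Sum>l\<le>N. G l) = (\<Sum>l\<le>N. G (Suc l))"
    by (subst sum.atMost_shift) (simp add: G_def assms flip: lessThan_Suc_atMost)
  also have "(\<Sum>l\<le>N. if l = 0 then 0 else F (l - 1)) - (\<Sum>l\<le>N. G (Suc l)) =
      (\<Sum>l\<le>N. (if l = 0 then 0 else F (l - 1)) - G (Suc l))"
    by (rule sum_subtractf[symmetric])
  also have "\<dots> = ad_vec N (\<lambda>l. (-1) ^ l * rec_op N x l)"
    unfolding ad_vec_def
  proof (rule sum.cong)
    fix l assume l: "l \<in> {..N}"
    show "(if l = 0 then 0 else F (l - 1)) - G (Suc l) =
        ((-1) ^ l * rec_op N x l) *\<^sub>C (Sa ^ (N - l) * Sd ^ l)"
    proof (cases l)
      case 0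
      then show ?thesis by (simp add: G_def m_def rec_op_def)
    next
      case (Suc k)
      then have "of_nat (N - k) = (of_nat N - of_nat k :: complex)" using l by (simp add: of_nat_diff)
      then show ?thesis unfolding m_def[symmetric] Suc
        by (simp add: F_def G_def rec_op_def flip: cvs.scale_left_diff_distrib)
          (simp add: algebra_simps)
    qed
  qed simp
  finally show ?thesis .
qed

lemma ad_vec_eigen:
  assumes "x (Suc N) = 0" "\<And>l. l \<le> N \<Longrightarrow> (-1) ^ l * rec_op N x l = c * x l"
  shows "piR tD (ad_vec N x) = c *\<^sub>C ad_vec N x"
  unfolding piR_tD_ad_vec[of x N, OF assms(1)] ad_vec_scale by (rule ad_vec_cong) (rule assms(2))

lemma sum_parity_even:
  fixes f :: "nat \<Rightarrow> 'a::comm_monoid_add"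
  shows "(\<Sum>l\<le>2 * n. f l) = (\<Sum>k=0..n. f (2 * k)) + (\<Sum>k<n. f (2 * k + 1))"
  by (induction n) (simp_all add: add_ac)

lemma sum_parity_odd:
  fixes f :: "nat \<Rightarrow> 'a::comm_monoid_add"
  shows "(\<Sum>l\<le>2 * n + 1. f l) = (\<Sum>k=0..n. f (2 * k)) + (\<Sum>k=0..n. f (2 * k + 1))"
  by (induction n) (simp_all add: add_ac)

definition interleave :: "(nat \<Rightarrow> complex) \<Rightarrow> (nat \<Rightarrow> complex) \<Rightarrow> nat \<Rightarrow> complex" where
  "interleave f g l = (if even l then f (l div 2) else g (l div 2))"

lemma interleave [simp]:
  "interleave f g (2 * k) = f k" "interleave f g (Suc (2 * k)) = g k" "interleave f g 0 = f 0"
  by (simp_all add: interleave_def)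

lemma rec_op_interleave_even:
  "rec_op N (interleave f g) (2 * k) = of_nat (2 * k + 1) * g k -
    (if k = 0 then 0 else (of_nat N - of_nat (2 * k) + 1) * g (k - 1))"
proof (cases k)
  case (Suc j)
  then have "2 * k - 1 = Suc (2 * j)" by simp
  with Suc show ?thesis by (simp add: rec_op_def del: mult_Suc_right)
qed (simp add: rec_op_def interleave_def)

lemma rec_op_interleave_odd:
  "rec_op N (interleave f g) (Suc (2 * k)) = of_nat (2 * k + 2) * f (Suc k) -
    (of_nat N - of_nat (2 * k)) * f k"
  using interleave(1)[of f g "Suc k"] by (simp add: rec_op_def)

lemma even_vec_eq: "even_vec n \<alpha> \<beta> s \<tau> =
    ad_vec (2 * n) (interleave (\<lambda>k. \<alpha> (int k)) (\<lambda>k. of_int (s * int \<tau>) * \<beta> (int k)))"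
  unfolding even_vec_def ad_vec_def sum_parity_even
  by (simp add: cvs.scale_sum_right scaleC_scaleC)

lemma odd_vec_eq: "odd_vec n \<alpha> \<beta> s \<tau> =
    ad_vec (2 * n + 1) (interleave (\<lambda>k. \<alpha> (int k)) (\<lambda>k. of_int (s * int \<tau>) * \<beta> (int k)))"
  unfolding odd_vec_def ad_vec_def sum_parity_odd
  by (simp add: cvs.scale_sum_right scaleC_scaleC Suc_diff_le)

lemma even_null_vec_eq: "even_null_vec n =
    ad_vec (2 * n) (interleave (\<lambda>k. of_nat (n choose k)) (\<lambda>k. 0))"
  unfolding even_null_vec_def ad_vec_def sum_parity_even by simp

lemma parity_cases_le:
  assumes "\<And>k. k \<le> n \<Longrightarrow> P (2 * k)" "\<And>k. Suc (2 * k) \<le> N \<Longrightarrow> P (Suc (2 * k))"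
    and "l \<le> N" "N \<le> 2 * n + 1"
  shows "P l"
  using assms by (cases "even l") (auto elim!: evenE oddE)

text \<open>At even indices the claim is the second recursion times s\<tau>. At odd indices it is
  the first one: \<open>(-1) ^ l\<close> reverses the difference, and s * s = 1 leaves \<tau>^2. The
  convention \<beta> n = 0 supplies the vanishing at index 2n + 1 that \<open>ad_vec_eigen\<close>
  asks for.\<close>

lemma even_vec_eigen:
  assumes c: "even_coeffs n \<tau> \<alpha> \<beta>" and s: "s = 1 \<or> s = - 1"
  shows "piR tD (even_vec n \<alpha> \<beta> s \<tau>) = of_int (s * int \<tau>) *\<^sub>C even_vec n \<alpha> \<beta> s \<tau>"
  unfolding even_vec_eq
proof (rule ad_vec_eigen)
  let ?f = "\<lambda>k. \<alpha> (int k)" and ?g = "\<lambda>k. of_int (s * int \<tau>) * \<beta> (int k)"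
  show "interleave ?f ?g (Suc (2 * n)) = 0" using c by (simp add: even_coeffs_def)
  have ss: "of_int s * (of_int s * z) = z" for z :: complex using s by auto
  fix l assume "l \<le> 2 * n"
  then show "(- 1) ^ l * rec_op (2 * n) (interleave ?f ?g) l =
      of_int (s * int \<tau>) * interleave ?f ?g l"
  proof (rule parity_cases_le[where n = n, rotated 2])
    fix k assume "k \<le> n"
    then have eq: "\<alpha> (int k) = of_int (2 * int k + 1) * \<beta> (int k)
        - of_int (2 * int n - 2 * int k + 1) * \<beta> (int k - 1)"
      using c by (simp add: even_coeffs_def)
    have "\<beta> (- 1) = 0" using c by (simp add: even_coeffs_def)
    then show "(- 1) ^ (2 * k) * rec_op (2 * n) (interleave ?f ?g) (2 * k) =
        of_int (s * int \<tau>) * interleave ?f ?g (2 * k)"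
      unfolding rec_op_interleave_even interleave(1) eq
      by (cases k) (simp_all add: algebra_simps)
  next
    fix k assume "Suc (2 * k) \<le> 2 * n"
    then have "of_nat \<tau> ^ 2 * \<beta> (int k) =
        of_int (2 * (int n - int k)) * \<alpha> (int k) - of_int (2 * (int k + 1)) * \<alpha> (int k + 1)"
      using c by (simp add: even_coeffs_def)
    then show "(- 1) ^ Suc (2 * k) * rec_op (2 * n) (interleave ?f ?g) (Suc (2 * k)) =
        of_int (s * int \<tau>) * interleave ?f ?g (Suc (2 * k))"
      unfolding rec_op_interleave_odd interleave(2)
      by (simp add: algebra_simps power2_eq_square ss)
  qed simp
qed

lemma odd_vec_eigen:
  assumes c: "odd_coeffs n \<tau> \<alpha> \<beta>" and s: "s = 1 \<or> s = - 1"
  shows "piR tD (odd_vec n \<alpha> \<beta> s \<tau>) = of_int (s * int \<tau>) *\<^sub>C odd_vec n \<alpha> \<beta> s \<tau>"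
  unfolding odd_vec_eq
proof (rule ad_vec_eigen)
  let ?f = "\<lambda>k. \<alpha> (int k)" and ?g = "\<lambda>k. of_int (s * int \<tau>) * \<beta> (int k)"
  show "interleave ?f ?g (Suc (2 * n + 1)) = 0"
    using c interleave(1)[of ?f ?g "Suc n"] by (simp add: odd_coeffs_def)
  have ss: "of_int s * (of_int s * z) = z" for z :: complex using s by auto
  fix l assume "l \<le> 2 * n + 1"
  then show "(- 1) ^ l * rec_op (2 * n + 1) (interleave ?f ?g) l =
      of_int (s * int \<tau>) * interleave ?f ?g l"
  proof (rule parity_cases_le[where n = n, rotated 2])
    fix k assume "k \<le> n"
    then have eq: "\<alpha> (int k) = of_int (2 * int k + 1) * \<beta> (int k)
        - of_int (2 * (int n - int k + 1)) * \<beta> (int k - 1)"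
      using c by (simp add: odd_coeffs_def)
    have "\<beta> (- 1) = 0" using c by (simp add: odd_coeffs_def)
    then show "(- 1) ^ (2 * k) * rec_op (2 * n + 1) (interleave ?f ?g) (2 * k) =
        of_int (s * int \<tau>) * interleave ?f ?g (2 * k)"
      unfolding rec_op_interleave_even interleave(1) eq
      by (cases k) (simp_all add: algebra_simps)
  next
    fix k assume "Suc (2 * k) \<le> 2 * n + 1"
    then have "of_nat \<tau> ^ 2 * \<beta> (int k) =
        of_int (2 * int n - 2 * int k + 1) * \<alpha> (int k) - of_int (2 * (int k + 1)) * \<alpha> (int k + 1)"
      using c by (simp add: odd_coeffs_def)
    then show "(- 1) ^ Suc (2 * k) * rec_op (2 * n + 1) (interleave ?f ?g) (Suc (2 * k)) =
        of_int (s * int \<tau>) * interleave ?f ?g (Suc (2 * k))"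
      unfolding rec_op_interleave_odd interleave(2)
      by (simp add: algebra_simps power2_eq_square ss)
  qed simp
qed

text \<open>The vector corresponds to (1 + t^2)^n = (1 + it)^n (1 - it)^n, the eigenfunction for
  \<tau> = 0. On coefficients this is binomial absorption at odd indices; at even indices only the
  zero odd part enters.\<close>

lemma even_null_vec_eigen: "piR tD (even_null_vec n) = 0"
proof -
  have "piR tD (even_null_vec n) = 0 *\<^sub>C even_null_vec n"
    unfolding even_null_vec_eq
  proof (rule ad_vec_eigen)
    let ?x = "interleave (\<lambda>k. of_nat (n choose k)) (\<lambda>k. 0)"
    fix l assume "l \<le> 2 * n"
    then show "(- 1) ^ l * rec_op (2 * n) ?x l = 0 * ?x l"
    proof (rule parity_cases_le[where n = n, rotated 2])
      fix k assume "Suc (2 * k) \<le> 2 * n"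
      then have "k \<le> n" by simp
      have "Suc k * (n choose Suc k) = (n - k) * (n choose k)"
        by (simp only: binomial_absorption binomial_absorb_comp)
      from arg_cong[OF this, of "of_nat :: nat \<Rightarrow> complex"] \<open>k \<le> n\<close>
      have "of_nat (Suc k) * of_nat (n choose Suc k) =
          ((of_nat n - of_nat k) * of_nat (n choose k) :: complex)"
        by (simp only: of_nat_mult of_nat_diff)
      from arg_cong[OF this, of "\<lambda>z. 2 * z"]
      show "(- 1) ^ Suc (2 * k) * rec_op (2 * n) ?x (Suc (2 * k)) = 0 * ?x (Suc (2 * k))"
        unfolding rec_op_interleave_odd by (simp add: algebra_simps)
    qed (simp_all add: rec_op_interleave_even)
  qed simp
  then show ?thesis by simp
qed

text \<open>The index set consists of the eigenvalues themselves, so they are distinct by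
  construction, and N + 1 independent eigenvectors span a space generated by N + 1
  monomials.\<close>

lemma W_ad_eigenlines:
  fixes v :: "int \<Rightarrow> S14"
  assumes N: "N \<ge> 2" and I: "finite I" "card I = N + 1"
    and v: "\<And>m. m \<in> I \<Longrightarrow> v m \<in> W_ad N" "\<And>m. m \<in> I \<Longrightarrow> v m \<noteq> 0"
    and eig: "\<And>m. m \<in> I \<Longrightarrow> piR tD (v m) = of_int m *\<^sub>C v m"
  shows "rep_direct_sum s14 I (\<lambda>m. cvs.span {v m}) (W_ad N)"
proof (rule rep_direct_sum_eigenspaces[where T = "piR tD" and \<mu> = of_int])
  let ?M = "(\<lambda>l. Sa ^ (N - l) * Sd ^ l) ` {0..N}"
  have M: "W_ad N = cvs.span ?M" by (simp add: W_ad_def monomials_image)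
  have "inj_on v I"
  proof (rule inj_onI)
    fix m m' assume *: "m \<in> I" "m' \<in> I" "v m = v m'"
    then have "of_int m *\<^sub>C v m = of_int m' *\<^sub>C v m" using eig by metis
    with v(2) * show "m = m'" by simp
  qed
  have "cvs.independent (v ` I)"
  \<comment> \<open>The criterion speaks of a set of vectors, so the eigenvalue of a vector is
    recovered by inverting the injective indexing.\<close>
  proof (rule independent_eigenvectors
      [where T = "piR tD" and \<mu> = "\<lambda>f. complex_of_int (inv_into I v f)"])
    show "inj_on (\<lambda>f. complex_of_int (inv_into I v f)) (v ` I)"
      by (intro inj_onI) (auto simp: \<open>inj_on v I\<close>)
  qed (use v eig \<open>inj_on v I\<close> in \<open>auto simp: clinear_piR tD_basis(1)\<close>)
  moreover have "card ?M \<le> card (v ` I)"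
    using card_image_le[of "{0..N}" "\<lambda>l. Sa ^ (N - l) * Sd ^ l"]
    by (simp add: card_image \<open>inj_on v I\<close> I)
  moreover have "v ` I \<subseteq> cvs.span ?M" using v M by auto
  ultimately have "cvs.span (v ` I) = cvs.span ?M" by (intro span_eq_if_card_ge) simp_all
  moreover have "(\<Union>m\<in>I. {v m}) = v ` I" by auto
  ultimately show "W_ad N = cvs.span (\<Union>m\<in>I. {v m})" by (simp only: M)
  fix m assume m: "m \<in> I"
  show "subrep s14 (cvs.span {v m})"
  proof (rule subrep_span_s14I)
    fix Z b assume Z: "Z \<in> {tA, tB, tD, tE, tK}" "b \<in> {v m}"
    show "piR Z b \<in> cvs.span {v m}"
    proof (cases "Z = tD")
      case True
      then have "piR Z b = of_int m *\<^sub>C v m" using Z eig[OF m] by simp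
      then show ?thesis by (simp only:) (intro cvs.span_scale cvs.span_base, simp)
    next
      case False
      then show ?thesis using Z piR_homogeneous_in_span[of "v m" N Z] v(1)[OF m] W_ad_subset N by auto
    qed
  qed
qed (use I eig in \<open>auto simp: clinear_piR tD_basis(1) inj_on_def\<close>)

lemma card_even_interval: "finite {m::int. even m \<and> \<bar>m\<bar> \<le> 2 * int n}"
    "card {m::int. even m \<and> \<bar>m\<bar> \<le> 2 * int n} = 2 * n + 1"
proof -
  have "{m::int. even m \<and> \<bar>m\<bar> \<le> 2 * int n} = (\<lambda>j. 2 * j) ` {- int n..int n}"
    by (auto elim!: evenE intro!: imageI)
  then show "finite {m::int. even m \<and> \<bar>m\<bar> \<le> 2 * int n}"
    "card {m::int. even m \<and> \<bar>m\<bar> \<le> 2 * int n} = 2 * n + 1"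
    by (simp_all add: card_image inj_on_def)
qed

lemma card_odd_interval: "finite {m::int. odd m \<and> \<bar>m\<bar> \<le> 2 * int n + 1}"
    "card {m::int. odd m \<and> \<bar>m\<bar> \<le> 2 * int n + 1} = (2 * n + 1) + 1"
proof -
  have "{m::int. odd m \<and> \<bar>m\<bar> \<le> 2 * int n + 1} = (\<lambda>j. 2 * j + 1) ` {- int n - 1..int n}"
    by (auto elim!: oddE intro!: imageI)
  then show "finite {m::int. odd m \<and> \<bar>m\<bar> \<le> 2 * int n + 1}"
    "card {m::int. odd m \<and> \<bar>m\<bar> \<le> 2 * int n + 1} = (2 * n + 1) + 1"
    by (simp_all add: card_image inj_on_def)
qed

text \<open>The index m = s\<tau> encodes both choices: \<open>sgn m\<close> is the sign and the
  absolute value is \<tau>. At m = 0 the two signs coincide, and the binomial vector supplies the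
  one missing line.\<close>

lemma even_eigenlines:
  assumes n: "n \<ge> 1" and c: "\<And>\<tau>. even \<tau> \<Longrightarrow> 2 \<le> \<tau> \<Longrightarrow> \<tau> \<le> 2 * n \<Longrightarrow> even_coeffs n \<tau> (\<alpha> \<tau>) (\<beta> \<tau>)"
  defines "I \<equiv> {m::int. even m \<and> \<bar>m\<bar> \<le> 2 * int n}"
    and "v \<equiv> \<lambda>m. if m = 0 then even_null_vec n
      else even_vec n (\<alpha> (nat \<bar>m\<bar>)) (\<beta> (nat \<bar>m\<bar>)) (sgn m) (nat \<bar>m\<bar>)"
  shows "rep_direct_sum s14 I (\<lambda>m. cvs.span {v m}) (W_ad (2 * n))"
    and "\<And>m. m \<in> I \<Longrightarrow> cvs.dim (cvs.span {v m}) = 1"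
proof -
  have c': "even_coeffs n (nat \<bar>m\<bar>) (\<alpha> (nat \<bar>m\<bar>)) (\<beta> (nat \<bar>m\<bar>))" if "m \<in> I" "m \<noteq> 0" for m
  proof (rule c)
    show "even (nat \<bar>m\<bar>)" using that by (simp add: I_def even_nat_iff)
    then show "2 \<le> nat \<bar>m\<bar>" using that by (cases "nat \<bar>m\<bar> = 1") auto
    show "nat \<bar>m\<bar> \<le> 2 * n" using that by (auto simp: I_def nat_le_iff)
  qed
  have nz: "v m \<noteq> 0" if "m \<in> I" for m
    using c'[OF that]
    by (auto simp: v_def even_null_vec_eq even_vec_eq even_coeffs_def intro!: ad_vec_nonzero)
  then show "cvs.dim (cvs.span {v m}) = 1" if "m \<in> I" for m
    using that by (intro dim_span_singleton)
  show "rep_direct_sum s14 I (\<lambda>m. cvs.span {v m}) (W_ad (2 * n))"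
  proof (rule W_ad_eigenlines)
    fix m assume m: "m \<in> I"
    show "v m \<in> W_ad (2 * n)"
      by (simp add: v_def even_null_vec_eq even_vec_eq ad_vec_in_W_ad)
    show "piR tD (v m) = of_int m *\<^sub>C v m"
    proof (cases "m = 0")
      case False
      then have "sgn m * int (nat \<bar>m\<bar>) = m" by (simp add: sgn_mult_abs)
      moreover have "sgn m = 1 \<or> sgn m = - 1" using False by (simp add: sgn_if)
      ultimately show ?thesis using even_vec_eigen[OF c'[OF m False], of "sgn m"] False
        by (simp add: v_def)
    qed (simp add: v_def even_null_vec_eigen)
  qed (use n nz in \<open>auto simp: I_def card_even_interval\<close>)
qed

text \<open>Zero is not odd, so the n + 1 values of \<tau> with two signs each already give all 2n +
  2 lines.\<close>

lemma odd_eigenlines: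
  assumes n: "n \<ge> 1" and c: "\<And>\<tau>. odd \<tau> \<Longrightarrow> 1 \<le> \<tau> \<Longrightarrow> \<tau> \<le> 2 * n + 1 \<Longrightarrow> odd_coeffs n \<tau> (\<alpha> \<tau>) (\<beta> \<tau>)"
  defines "I \<equiv> {m::int. odd m \<and> \<bar>m\<bar> \<le> 2 * int n + 1}"
    and "v \<equiv> \<lambda>m. odd_vec n (\<alpha> (nat \<bar>m\<bar>)) (\<beta> (nat \<bar>m\<bar>)) (sgn m) (nat \<bar>m\<bar>)"
  shows "rep_direct_sum s14 I (\<lambda>m. cvs.span {v m}) (W_ad (2 * n + 1))"
    and "\<And>m. m \<in> I \<Longrightarrow> cvs.dim (cvs.span {v m}) = 1"
proof -
  have c': "odd_coeffs n (nat \<bar>m\<bar>) (\<alpha> (nat \<bar>m\<bar>)) (\<beta> (nat \<bar>m\<bar>))" if "m \<in> I" for m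
  proof (rule c)
    show "odd (nat \<bar>m\<bar>)" using that by (simp add: I_def even_nat_iff)
    then show "1 \<le> nat \<bar>m\<bar>" by (cases "nat \<bar>m\<bar> = 0") auto
    show "nat \<bar>m\<bar> \<le> 2 * n + 1" using that by (auto simp: I_def nat_le_iff)
  qed
  have nz: "v m \<noteq> 0" if "m \<in> I" for m
    using c'[OF that] by (auto simp: v_def odd_vec_eq odd_coeffs_def intro!: ad_vec_nonzero)
  then show "cvs.dim (cvs.span {v m}) = 1" if "m \<in> I" for m
    using that by (intro dim_span_singleton)
  show "rep_direct_sum s14 I (\<lambda>m. cvs.span {v m}) (W_ad (2 * n + 1))"
  proof (rule W_ad_eigenlines)
    fix m assume m: "m \<in> I"
    then have "m \<noteq> 0" by (auto simp: I_def)
    show "v m \<in> W_ad (2 * n + 1)" unfolding v_def odd_vec_eq by (rule ad_vec_in_W_ad)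
    have "sgn m * int (nat \<bar>m\<bar>) = m" by (simp add: sgn_mult_abs)
    moreover have "sgn m = 1 \<or> sgn m = - 1" using \<open>m \<noteq> 0\<close> by (simp add: sgn_if)
    ultimately show "piR tD (v m) = of_int m *\<^sub>C v m"
      using odd_vec_eigen[OF c'[OF m], of "sgn m"] by (simp add: v_def)
  qed (use n nz in \<open>auto simp: I_def card_odd_interval simp del: One_nat_def\<close>)
qed

text \<open>Unique existence of the coefficients for every \<tau> keeps the implications over all
  families \<alpha>, \<beta> from being vacuous and makes the eigenlines well defined.\<close>

theorem mainTheorem10:
  shows
    "(\<forall>N. subrep s14 (W N) \<and> (\<forall>f\<in>W N. piR tA f = of_nat N *\<^sub>C f)) \<and>
     cvs.dim (W 0) = 1 \<and> (\<forall>N\<ge>1. cvs.dim (W N) = 2 * (N + 1)) \<and>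
     \<comment> \<open>(0)\<close>
     W 0 = cvs.span {1} \<and> (\<forall>f\<in>W 0. piR tA f = 0 \<and> piR tB f = 0 \<and> piR tD f = 0) \<and>
     \<comment> \<open>(1)\<close>
     (let v10 = Sa + Sd; v11 = Sb + Sc; v20 = Sb - Sc; v21 = Sa - Sd;
          V1 = cvs.span {v10, v11}; V2 = cvs.span {v20, v21} in
        rep_direct_sum s14 {1, 2::nat} (\<lambda>i. if i = 1 then V1 else V2) (W 1) \<and>
        has_basis V1 {0, 1::nat} (\<lambda>i. if i = 0 then v10 else v11) \<and>
        has_basis V2 {0, 1::nat} (\<lambda>i. if i = 0 then v20 else v21) \<and>
        cvs.dim V1 = 2 \<and> cvs.dim V2 = 2 \<and>
        (\<forall>\<A>\<in>{s14, s14_ABD}.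
          irreducible_rep \<A> V1 \<and> irreducible_rep \<A> V2 \<and> isomorphic_reps \<A> V1 V2) \<and>
        piR tB v10 = v11 \<and> piR tB v11 = v10 \<and> piR tB v20 = v21 \<and> piR tB v21 = v20 \<and>
        piR tD v10 = v10 \<and> piR tD v11 = - v11 \<and> piR tD v20 = v20 \<and> piR tD v21 = - v21 \<and>
        (\<forall>f\<in>W 1. piR (conv tB tB) f = f \<and> piR (conv tD tD) f = f)) \<and>
     \<comment> \<open>(2)\<close>
     (\<forall>N\<ge>2.
        (\<forall>f\<in>W N. piR tB f = 0) \<and>
        rep_direct_sum s14 {1, 2::nat} (\<lambda>i. if i = 1 then W_ad N else W_bc N) (W N) \<and>
        has_basis (W_ad N) {0..N} (\<lambda>l. Sa ^ (N - l) * Sd ^ l) \<and>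
        has_basis (W_bc N) {0..N} (\<lambda>l. Sb ^ (N - l) * Sc ^ l) \<and>
        cvs.dim (W_ad N) = N + 1 \<and> cvs.dim (W_bc N) = N + 1 \<and>
        isomorphic_reps s14_ABD (W_ad N) (W_bc N)) \<and>
     \<comment> \<open>(2a); the summand with index \<open>m\<close> is the one on which \<open>tD\<close> acts by \<open>m\<close>\<close>
     (\<forall>n\<ge>1.
        let T = {\<tau>. even \<tau> \<and> 2 \<le> \<tau> \<and> \<tau> \<le> 2 * n}; I = {m::int. even m \<and> \<bar>m\<bar> \<le> 2 * int n} in
        card I = 2 * n + 1 \<and>
        piR tD (even_null_vec n) = 0 \<and>
        (\<forall>\<tau>\<in>T. \<exists>!c. even_coeffs n \<tau> (fst c) (snd c)) \<and>
        (\<forall>\<alpha> \<beta>. (\<forall>\<tau>\<in>T. even_coeffs n \<tau> (\<alpha> \<tau>) (\<beta> \<tau>)) \<longrightarrow>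
          (let u = (\<lambda>s \<tau>. even_vec n (\<alpha> \<tau>) (\<beta> \<tau>) s \<tau>);
               L = (\<lambda>m. cvs.span {if m = 0 then even_null_vec n else u (sgn m) (nat \<bar>m\<bar>)}) in
            (\<forall>\<tau>\<in>T. piR tD (u 1 \<tau>) = of_nat \<tau> *\<^sub>C u 1 \<tau> \<and>
                    piR tD (u (-1) \<tau>) = (- of_nat \<tau>) *\<^sub>C u (-1) \<tau>) \<and>
            rep_direct_sum s14 I L (W_ad (2 * n)) \<and> (\<forall>m\<in>I. cvs.dim (L m) = 1)))) \<and>
     \<comment> \<open>(2b)\<close>
     (\<forall>n\<ge>1.
        let T = {\<tau>. odd \<tau> \<and> 1 \<le> \<tau> \<and> \<tau> \<le> 2 * n + 1};
            I = {m::int. odd m \<and> \<bar>m\<bar> \<le> 2 * int n + 1} in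
        card I = (2 * n + 1) + 1 \<and>
        (\<forall>\<tau>\<in>T. \<exists>!c. odd_coeffs n \<tau> (fst c) (snd c)) \<and>
        (\<forall>\<alpha> \<beta>. (\<forall>\<tau>\<in>T. odd_coeffs n \<tau> (\<alpha> \<tau>) (\<beta> \<tau>)) \<longrightarrow>
          (let w = (\<lambda>s \<tau>. odd_vec n (\<alpha> \<tau>) (\<beta> \<tau>) s \<tau>);
               L = (\<lambda>m. cvs.span {w (sgn m) (nat \<bar>m\<bar>)}) in
            (\<forall>\<tau>\<in>T. piR tD (w 1 \<tau>) = of_nat \<tau> *\<^sub>C w 1 \<tau> \<and>
                    piR tD (w (-1) \<tau>) = (- of_nat \<tau>) *\<^sub>C w (-1) \<tau>) \<and>
            rep_direct_sum s14 I L (W_ad (2 * n + 1)) \<and> (\<forall>m\<in>I. cvs.dim (L m) = 1))))"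
proof (intro conjI)
  show "\<forall>N. subrep s14 (W N) \<and> (\<forall>f\<in>W N. piR tA f = of_nat N *\<^sub>C f)"
    by (simp add: subrep_W piR_W(1))
  show "cvs.dim (W 0) = 1" using dim_span_singleton[OF S14_one_neq_0] by (simp only: W_0)
  show "\<forall>N\<ge>1. cvs.dim (W N) = 2 * (N + 1)" by (simp add: dim_W)
  show "W 0 = cvs.span {1}" by (rule W_0)
  show "\<forall>f\<in>W 0. piR tA f = 0 \<and> piR tB f = 0 \<and> piR tD f = 0"
    by (auto simp: W_0 cvs.span_singleton clinear_scale[OF clinear_piR] clinear_functionals)
  show "let v10 = Sa + Sd; v11 = Sb + Sc; v20 = Sb - Sc; v21 = Sa - Sd;
          V1 = cvs.span {v10, v11}; V2 = cvs.span {v20, v21} in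
        rep_direct_sum s14 {1, 2::nat} (\<lambda>i. if i = 1 then V1 else V2) (W 1) \<and>
        has_basis V1 {0, 1::nat} (\<lambda>i. if i = 0 then v10 else v11) \<and>
        has_basis V2 {0, 1::nat} (\<lambda>i. if i = 0 then v20 else v21) \<and>
        cvs.dim V1 = 2 \<and> cvs.dim V2 = 2 \<and>
        (\<forall>\<A>\<in>{s14, s14_ABD}.
          irreducible_rep \<A> V1 \<and> irreducible_rep \<A> V2 \<and> isomorphic_reps \<A> V1 V2) \<and>
        piR tB v10 = v11 \<and> piR tB v11 = v10 \<and> piR tB v20 = v21 \<and> piR tB v21 = v20 \<and>
        piR tD v10 = v10 \<and> piR tD v11 = - v11 \<and> piR tD v20 = v20 \<and> piR tD v21 = - v21 \<and>
        (\<forall>f\<in>W 1. piR (conv tB tB) f = f \<and> piR (conv tD tD) f = f)"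
    unfolding Let_def
    by (intro conjI ballI W_1_direct_sum has_basis_V1 has_basis_V2 dim_V1 dim_V2
        degree_one_action W_1_squares)
      (auto intro: irreducible_V1 irreducible_V2 isomorphic_V1_V2)
  show "\<forall>N\<ge>2.
        (\<forall>f\<in>W N. piR tB f = 0) \<and>
        rep_direct_sum s14 {1, 2::nat} (\<lambda>i. if i = 1 then W_ad N else W_bc N) (W N) \<and>
        has_basis (W_ad N) {0..N} (\<lambda>l. Sa ^ (N - l) * Sd ^ l) \<and>
        has_basis (W_bc N) {0..N} (\<lambda>l. Sb ^ (N - l) * Sc ^ l) \<and>
        cvs.dim (W_ad N) = N + 1 \<and> cvs.dim (W_bc N) = N + 1 \<and>
        isomorphic_reps s14_ABD (W_ad N) (W_bc N)"
    using has_basis_dim[OF W_ad_basis] has_basis_dim[OF W_bc_basis]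
    by (intro allI impI conjI ballI W_direct_sum_ad_bc W_ad_basis W_bc_basis
        isomorphic_W_ad_W_bc piR_W(4)) simp_all
  show "\<forall>n\<ge>1.
        let T = {\<tau>. even \<tau> \<and> 2 \<le> \<tau> \<and> \<tau> \<le> 2 * n}; I = {m::int. even m \<and> \<bar>m\<bar> \<le> 2 * int n} in
        card I = 2 * n + 1 \<and>
        piR tD (even_null_vec n) = 0 \<and>
        (\<forall>\<tau>\<in>T. \<exists>!c. even_coeffs n \<tau> (fst c) (snd c)) \<and>
        (\<forall>\<alpha> \<beta>. (\<forall>\<tau>\<in>T. even_coeffs n \<tau> (\<alpha> \<tau>) (\<beta> \<tau>)) \<longrightarrow>
          (let u = (\<lambda>s \<tau>. even_vec n (\<alpha> \<tau>) (\<beta> \<tau>) s \<tau>);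
               L = (\<lambda>m. cvs.span {if m = 0 then even_null_vec n else u (sgn m) (nat \<bar>m\<bar>)}) in
            (\<forall>\<tau>\<in>T. piR tD (u 1 \<tau>) = of_nat \<tau> *\<^sub>C u 1 \<tau> \<and>
                    piR tD (u (-1) \<tau>) = (- of_nat \<tau>) *\<^sub>C u (-1) \<tau>) \<and>
            rep_direct_sum s14 I L (W_ad (2 * n)) \<and> (\<forall>m\<in>I. cvs.dim (L m) = 1)))"
    unfolding Let_def
  proof (intro allI impI conjI ballI card_even_interval even_null_vec_eigen)
    fix n \<tau> :: nat assume "\<tau> \<in> {\<tau>. even \<tau> \<and> 2 \<le> \<tau> \<and> \<tau> \<le> 2 * n}"
    then show "\<exists>!c. even_coeffs n \<tau> (fst c) (snd c)"
      using even_coeffs_exist[of \<tau> n] even_coeffs_unique[of n \<tau>]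
      by (intro ex_ex1I) (auto simp: prod_eq_iff)
  next
    fix n :: nat and \<alpha> \<beta> :: "nat \<Rightarrow> int \<Rightarrow> complex" and \<tau>
    assume n: "n \<ge> 1"
      and c: "\<forall>\<tau>\<in>{\<tau>. even \<tau> \<and> 2 \<le> \<tau> \<and> \<tau> \<le> 2 * n}. even_coeffs n \<tau> (\<alpha> \<tau>) (\<beta> \<tau>)"
    show "rep_direct_sum s14 {m. even m \<and> \<bar>m\<bar> \<le> 2 * int n}
        (\<lambda>m. cvs.span {if m = 0 then even_null_vec n
          else even_vec n (\<alpha> (nat \<bar>m\<bar>)) (\<beta> (nat \<bar>m\<bar>)) (sgn m) (nat \<bar>m\<bar>)}) (W_ad (2 * n))"
      using c by (intro even_eigenlines(1) n) simp
    show "cvs.dim (cvs.span {if m = 0 then even_null_vec n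
          else even_vec n (\<alpha> (nat \<bar>m\<bar>)) (\<beta> (nat \<bar>m\<bar>)) (sgn m) (nat \<bar>m\<bar>)}) = 1"
      if "m \<in> {m. even m \<and> \<bar>m\<bar> \<le> 2 * int n}" for m :: int
      using c that by (intro even_eigenlines(2) n) simp_all
    assume "\<tau> \<in> {\<tau>. even \<tau> \<and> 2 \<le> \<tau> \<and> \<tau> \<le> 2 * n}"
    with c have "even_coeffs n \<tau> (\<alpha> \<tau>) (\<beta> \<tau>)" by blast
    from even_vec_eigen[OF this, of 1] even_vec_eigen[OF this, of "- 1"]
    show "piR tD (even_vec n (\<alpha> \<tau>) (\<beta> \<tau>) 1 \<tau>) =
        of_nat \<tau> *\<^sub>C even_vec n (\<alpha> \<tau>) (\<beta> \<tau>) 1 \<tau>"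
      "piR tD (even_vec n (\<alpha> \<tau>) (\<beta> \<tau>) (- 1) \<tau>) =
        (- of_nat \<tau>) *\<^sub>C even_vec n (\<alpha> \<tau>) (\<beta> \<tau>) (- 1) \<tau>"
      by simp_all
  qed
  show "\<forall>n\<ge>1.
        let T = {\<tau>. odd \<tau> \<and> 1 \<le> \<tau> \<and> \<tau> \<le> 2 * n + 1};
            I = {m::int. odd m \<and> \<bar>m\<bar> \<le> 2 * int n + 1} in
        card I = (2 * n + 1) + 1 \<and>
        (\<forall>\<tau>\<in>T. \<exists>!c. odd_coeffs n \<tau> (fst c) (snd c)) \<and>
        (\<forall>\<alpha> \<beta>. (\<forall>\<tau>\<in>T. odd_coeffs n \<tau> (\<alpha> \<tau>) (\<beta> \<tau>)) \<longrightarrow>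
          (let w = (\<lambda>s \<tau>. odd_vec n (\<alpha> \<tau>) (\<beta> \<tau>) s \<tau>);
               L = (\<lambda>m. cvs.span {w (sgn m) (nat \<bar>m\<bar>)}) in
            (\<forall>\<tau>\<in>T. piR tD (w 1 \<tau>) = of_nat \<tau> *\<^sub>C w 1 \<tau> \<and>
                    piR tD (w (-1) \<tau>) = (- of_nat \<tau>) *\<^sub>C w (-1) \<tau>) \<and>
            rep_direct_sum s14 I L (W_ad (2 * n + 1)) \<and> (\<forall>m\<in>I. cvs.dim (L m) = 1)))"
    unfolding Let_def
  proof (intro allI impI conjI ballI card_odd_interval)
    fix n \<tau> :: nat assume "\<tau> \<in> {\<tau>. odd \<tau> \<and> 1 \<le> \<tau> \<and> \<tau> \<le> 2 * n + 1}"
    then show "\<exists>!c. odd_coeffs n \<tau> (fst c) (snd c)"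
      using odd_coeffs_exist[of \<tau> n] odd_coeffs_unique[of n \<tau>]
      by (intro ex_ex1I) (auto simp: prod_eq_iff)
  next
    fix n :: nat and \<alpha> \<beta> :: "nat \<Rightarrow> int \<Rightarrow> complex" and \<tau>
    assume n: "n \<ge> 1"
      and c: "\<forall>\<tau>\<in>{\<tau>. odd \<tau> \<and> 1 \<le> \<tau> \<and> \<tau> \<le> 2 * n + 1}. odd_coeffs n \<tau> (\<alpha> \<tau>) (\<beta> \<tau>)"
    show "rep_direct_sum s14 {m. odd m \<and> \<bar>m\<bar> \<le> 2 * int n + 1}
        (\<lambda>m. cvs.span {odd_vec n (\<alpha> (nat \<bar>m\<bar>)) (\<beta> (nat \<bar>m\<bar>)) (sgn m) (nat \<bar>m\<bar>)})
        (W_ad (2 * n + 1))"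
      using c by (intro odd_eigenlines(1) n) simp
    show "cvs.dim (cvs.span {odd_vec n (\<alpha> (nat \<bar>m\<bar>)) (\<beta> (nat \<bar>m\<bar>)) (sgn m) (nat \<bar>m\<bar>)}) = 1"
      if "m \<in> {m. odd m \<and> \<bar>m\<bar> \<le> 2 * int n + 1}" for m :: int
      using c that by (intro odd_eigenlines(2) n) simp_all
    assume "\<tau> \<in> {\<tau>. odd \<tau> \<and> 1 \<le> \<tau> \<and> \<tau> \<le> 2 * n + 1}"
    with c have "odd_coeffs n \<tau> (\<alpha> \<tau>) (\<beta> \<tau>)" by blast
    from odd_vec_eigen[OF this, of 1] odd_vec_eigen[OF this, of "- 1"]
    show "piR tD (odd_vec n (\<alpha> \<tau>) (\<beta> \<tau>) 1 \<tau>) =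
        of_nat \<tau> *\<^sub>C odd_vec n (\<alpha> \<tau>) (\<beta> \<tau>) 1 \<tau>"
      "piR tD (odd_vec n (\<alpha> \<tau>) (\<beta> \<tau>) (- 1) \<tau>) =
        (- of_nat \<tau>) *\<^sub>C odd_vec n (\<alpha> \<tau>) (\<beta> \<tau>) (- 1) \<tau>"
      by simp_all
  qed
qed

end
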